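(* Let $n\geq 1$, $\mu>0$, $k\in\mathbb{N}$ with $k\geq 1$, $\varepsilon>0$, and let $p>1$ be arbitrary if $n=1$, and $1<p<p_{\mathrm{Str}}(n)$ if $n\geq 2$. Assume that $u_0\in W^{1,1}_{\mathrm{loc}}(\mathbb{R}^n)$ and $u_1\in L^1_{\mathrm{loc}}(\mathbb{R}^n)$ are nonnegative, compactly supported functions with $\operatorname{supp}(u_0,u_1)\subset B_R(0)$ for some $R>0$, and that $u_0$ does not vanish identically. Let $u$ be a weak solution on $[0,T_\varepsilon)$ of the Cauchy problem $$u_{tt}-\Delta u+b(t)u_t=|u|^p,\qquad u(0,x)=\varepsilon u_0(x),\quad u_t(0,x)=\varepsilon u_1(x).$$ Then $u$ blows up in finite time, and there exists $\varepsilon_0=\varepsilon_0(n,p,\mu,k,u_0,u_1,R)>0$ such that for any $\varepsilon\in(0,\varepsilon_0]$ the lifespan $T_\varepsilon$ of $u$ satisfies $$T_\varepsilon\left(\ln^{[k]}\left(\mathrm{e}^{[k]}+T_\varepsilon\right)\right)^{-\frac{\mu p(p-1)}{\gamma(n,p)}}\leq C\,\varepsilon^{-\frac{p(p-1)}{\gamma(n,p)}},$$ where $C$ is a positive constant independent of $\varepsilon$.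
   Context: Notation. $B_R(0)=\{x\in\mathbb{R}^n:|x|\le R\}$. Iterated logarithms and exponentials: $\ln^{[1]}(r)=\ln r$, $\ln^{[j]}(r)=\ln(\ln^{[j-1]}(r))$ for $j\ge2$; $\mathrm{e}^{[1]}=\mathrm{e}$, $\mathrm{e}^{[j]}=\mathrm{e}^{\mathrm{e}^{[j-1]}}$ for $j\ge2$. The damping coefficient is $$b(t)=\frac{\mu}{(\mathrm{e}^{[k]}+t)\prod_{j=1}^k\ln^{[j]}(\mathrm{e}^{[k]}+t)},\qquad t\ge0.$$ $\gamma(n,p)=1+\frac{n+1}{2}p-\frac{n-1}{2}p^2$, and for $n\ge2$ the Strauss exponent $p_{\mathrm{Str}}(n)$ is the positive root of $\gamma(n,p)=0$. Weak solution. A weak solution on $[0,T)$ of $u_{tt}-\Delta u+b(t)u_t=f(u,u_t)$, $u(0,\cdot)=\varepsilon u_0$, $u_t(0,\cdot)=\varepsilon u_1$ (here $f(u,u_t)=|u|^p$), with data supported in $B_R(0)$, is a function $u\in\mathscr{C}([0,T),W^{1,1}_{\mathrm{loc}}(\mathbb{R}^n))\cap\mathscr{C}^1([0,T),L^1_{\mathrm{loc}}(\mathbb{R}^n))$ with $f(u,u_t)\in L^1_{\mathrm{loc}}([0,T)\times\mathbb{R}^n)$ such that: (1) $\operatorname{supp}u(t,\cdot)\subset B_{R+t}(0)$ for all $t\in(0,T)$; (2) $u(0,\cdot)=\varepsilon u_0$ in $L^1_{\mathrm{loc}}(\mathbb{R}^n)$; (3) for all $t\in(0,T)$ and all $\psi\in\mathscr{C}_0^\infty([0,T)\times\mathbb{R}^n)$,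 $$\int_0^t\int_{\mathbb{R}^n}\big(-u_t\psi_s+\nabla u\cdot\nabla\psi+b(s)u_t\psi\big)\,\mathrm{d}x\,\mathrm{d}s+\int_{\mathbb{R}^n}u_t(t,x)\psi(t,x)\,\mathrm{d}x=\varepsilon\int_{\mathbb{R}^n}u_1(x)\psi(0,x)\,\mathrm{d}x+\int_0^t\int_{\mathbb{R}^n}f(u,u_t)\psi\,\mathrm{d}x\,\mathrm{d}s,$$ where in the double integrals the functions are evaluated at $(s,x)$. The lifespan $T_\varepsilon$ is the maximal existence time of the solution; "$u$ blows up in finite time" means that the lifespan is finite. *)

theory Defs
  imports "HOL-Analysis.Analysis"
begin

section \<open>Damping coefficient and exponents\<close>

text \<open>Both iterations start at index 0, with \<open>iter_ln 0 r = r\<close> and \<open>iter_exp 0 = 1\<close>; hence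
  \<open>iter_ln 1 r = ln r\<close> and \<open>iter_exp 1 = e\<close>.\<close>

definition iter_ln :: "nat \<Rightarrow> real \<Rightarrow> real"
  where "iter_ln j = ln ^^ j"

definition iter_exp :: "nat \<Rightarrow> real"
  where "iter_exp j = (exp ^^ j) 1"

definition damping :: "real \<Rightarrow> nat \<Rightarrow> real \<Rightarrow> real"
  where "damping \<mu> k t = \<mu> / ((iter_exp k + t) * (\<Prod>j=1..k. iter_ln j (iter_exp k + t)))"

definition strauss_gamma :: "nat \<Rightarrow> real \<Rightarrow> real"
  where "strauss_gamma n p = 1 + (real n + 1) / 2 * p - (real n - 1) / 2 * p\<^sup>2"

text \<open>For \<open>n \<ge> 2\<close> the product of the two roots is \<open>- 2 / (n - 1) < 0\<close>, so the positive root is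
  unique. For \<open>n \<le> 1\<close> the value is not meaningful.\<close>

definition strauss_exponent :: "nat \<Rightarrow> real"
  where "strauss_exponent n = (THE p. p > 0 \<and> strauss_gamma n p = 0)"

section \<open>Test functions\<close>

primrec ck_function :: "nat \<Rightarrow> ('a::euclidean_space \<Rightarrow> real) \<Rightarrow> bool"
  where
    "ck_function 0 f \<longleftrightarrow> continuous_on UNIV f"
  | "ck_function (Suc k) f \<longleftrightarrow>
       f differentiable_on UNIV \<and> (\<forall>v. ck_function k (\<lambda>x. frechet_derivative f (at x) v))"

definition smooth_function :: "('a::euclidean_space \<Rightarrow> real) \<Rightarrow> bool"
  where "smooth_function f \<longleftrightarrow> (\<forall>k. ck_function k f)"

definition grad :: "('a::euclidean_space \<Rightarrow> real) \<Rightarrow> 'a \<Rightarrow> 'a"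
  where "grad f x = (\<Sum>i\<in>Basis. frechet_derivative f (at x) i *\<^sub>R i)"

definition test_function :: "('a::euclidean_space \<Rightarrow> real) \<Rightarrow> bool"
  where "test_function \<phi> \<longleftrightarrow> smooth_function \<phi> \<and> compact (closure {x. \<phi> x \<noteq> 0})"

definition time_interval :: "ereal \<Rightarrow> real set"
  where "time_interval T = {s. 0 \<le> s \<and> ereal s < T}"

text \<open>The functions in \<open>C\<^sub>0\<^sup>\<infinity>([0,T) \<times> \<real>\<^sup>n)\<close> need not vanish at time 0. They are
  the restrictions to times \<open>\<ge> 0\<close> of smooth functions on \<open>\<real> \<times> \<real>\<^sup>n\<close> with compact support in
  \<open>(-\<infinity>,T) \<times> \<real>\<^sup>n\<close>; such extensions are used here in place of the restrictions. Only their
  values and derivatives at times \<open>\<ge> 0\<close> enter the weak formulation.\<close>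

definition spacetime_test_function :: "ereal \<Rightarrow> (real \<times> 'a::euclidean_space \<Rightarrow> real) \<Rightarrow> bool"
  where "spacetime_test_function T \<psi> \<longleftrightarrow>
    test_function \<psi> \<and> closure {z. \<psi> z \<noteq> 0} \<subseteq> {s. ereal s < T} \<times> UNIV"

section \<open>Local Lebesgue and Sobolev spaces\<close>

text \<open>An element of \<open>L\<^sup>1\<^sub>l\<^sub>o\<^sub>c\<close> is given by a representative; every notion below is invariant
  under changing it on a null set.\<close>

definition L1loc_on :: "'a::euclidean_space set \<Rightarrow> ('a \<Rightarrow> 'b::euclidean_space) \<Rightarrow> bool"
  where "L1loc_on S f \<longleftrightarrow> (\<forall>K. compact K \<and> K \<subseteq> S \<longrightarrow> f absolutely_integrable_on K)"

abbreviation L1loc :: "('a::euclidean_space \<Rightarrow> 'b::euclidean_space) \<Rightarrow> bool"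
  where "L1loc \<equiv> L1loc_on UNIV"

definition weak_gradient :: "('a::euclidean_space \<Rightarrow> real) \<Rightarrow> ('a \<Rightarrow> 'a) \<Rightarrow> bool"
  where "weak_gradient f G \<longleftrightarrow> L1loc f \<and> L1loc G \<and>
    (\<forall>\<phi>. test_function \<phi> \<longrightarrow>
      (LINT x|lebesgue. f x *\<^sub>R grad \<phi> x) = - (LINT x|lebesgue. \<phi> x *\<^sub>R G x))"

definition W11loc :: "('a::euclidean_space \<Rightarrow> real) \<Rightarrow> bool"
  where "W11loc f \<longleftrightarrow> (\<exists>G. weak_gradient f G)"

text \<open>The support of a class of functions: the complement of the largest open set on which the
  function vanishes almost everywhere.\<close>

definition ess_support :: "('a::euclidean_space \<Rightarrow> real) \<Rightarrow> 'a set"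
  where "ess_support f = - \<Union>{U. open U \<and> (AE x in lebesgue. x \<in> U \<longrightarrow> f x = 0)}"

definition tendsto_L1loc ::
    "('t \<Rightarrow> 'a::euclidean_space \<Rightarrow> 'b::euclidean_space) \<Rightarrow> ('a \<Rightarrow> 'b) \<Rightarrow> 't filter \<Rightarrow> bool"
  where "tendsto_L1loc v w F \<longleftrightarrow>
    (\<forall>K. compact K \<longrightarrow> ((\<lambda>s. LINT x:K|lebesgue. norm (v s x - w x)) \<longlongrightarrow> 0) F)"

definition continuous_L1loc ::
    "real set \<Rightarrow> (real \<Rightarrow> 'a::euclidean_space \<Rightarrow> 'b::euclidean_space) \<Rightarrow> bool"
  where "continuous_L1loc I v \<longleftrightarrow>
    (\<forall>t\<in>I. L1loc (v t) \<and> tendsto_L1loc v (v t) (at t within I))"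

definition has_L1loc_derivative ::
    "real set \<Rightarrow> (real \<Rightarrow> 'a::euclidean_space \<Rightarrow> real) \<Rightarrow> (real \<Rightarrow> 'a \<Rightarrow> real) \<Rightarrow> bool"
  where "has_L1loc_derivative I v v' \<longleftrightarrow>
    (\<forall>t\<in>I. tendsto_L1loc (\<lambda>s x. (v s x - v t x) / (s - t)) (v' t) (at t within I))"

section \<open>Weak solutions and lifespan\<close>

text \<open>Weak solutions on \<open>[0,T)\<close>, \<open>0 < T \<le> \<infinity>\<close>, of
  \<open>u\<^sub>t\<^sub>t - \<Delta>u + b(t) u\<^sub>t = f(u,u\<^sub>t)\<close> with data \<open>\<epsilon> u\<^sub>0\<close>, \<open>\<epsilon> u\<^sub>1\<close>. The
  function \<open>u\<close> is total; only its values at times in \<open>[0,T)\<close> matter. The functions \<open>ut\<close> and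
  \<open>Du\<close> (the derivative in \<open>L\<^sup>1\<^sub>l\<^sub>o\<^sub>c\<close> and the weak gradient) are determined by \<open>u\<close> almost
  everywhere. Continuity of \<open>u\<close> and \<open>Du\<close> into \<open>L\<^sup>1\<^sub>l\<^sub>o\<^sub>c\<close> is continuity of \<open>u\<close> into
  \<open>W\<^sup>1\<^sup>,\<^sup>1\<^sub>l\<^sub>o\<^sub>c\<close>.\<close>

definition weak_solution ::
    "(real \<Rightarrow> real) \<Rightarrow> (real \<Rightarrow> real \<Rightarrow> real) \<Rightarrow> real \<Rightarrow> ('a::euclidean_space \<Rightarrow> real) \<Rightarrow> ('a \<Rightarrow> real)
      \<Rightarrow> real \<Rightarrow> ereal \<Rightarrow> (real \<Rightarrow> 'a \<Rightarrow> real) \<Rightarrow> bool"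
  where "weak_solution b f \<epsilon> u0 u1 R T u \<longleftrightarrow>
    0 < T \<and>
    (\<exists>ut Du.
      (\<forall>t\<in>time_interval T. weak_gradient (u t) (Du t)) \<and>
      continuous_L1loc (time_interval T) u \<and>
      continuous_L1loc (time_interval T) Du \<and>
      has_L1loc_derivative (time_interval T) u ut \<and>
      continuous_L1loc (time_interval T) ut \<and>
      L1loc_on (time_interval T \<times> UNIV) (\<lambda>(s, x). f (u s x) (ut s x)) \<and>
      (\<forall>t\<in>time_interval T. 0 < t \<longrightarrow> ess_support (u t) \<subseteq> cball 0 (R + t)) \<and>
      (AE x in lebesgue. u 0 x = \<epsilon> * u0 x) \<and>
      (\<forall>t\<in>time_interval T. 0 < t \<longrightarrow> (\<forall>\<psi>. spacetime_test_function T \<psi> \<longrightarrow>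
        (LINT s:{0..t}|lebesgue. (LINT x|lebesgue.
            - ut s x * deriv (\<lambda>r. \<psi> (r, x)) s
            + Du s x \<bullet> grad (\<lambda>y. \<psi> (s, y)) x
            + b s * ut s x * \<psi> (s, x)))
          + (LINT x|lebesgue. ut t x * \<psi> (t, x))
        = \<epsilon> * (LINT x|lebesgue. u1 x * \<psi> (0, x))
          + (LINT s:{0..t}|lebesgue. (LINT x|lebesgue. f (u s x) (ut s x) * \<psi> (s, x))))))"

text \<open>\<open>T\<close> is the maximal existence time of the solution \<open>u\<close>: \<open>u\<close> is a weak solution on
  \<open>[0,T)\<close> that has no extension to a weak solution on a longer interval.\<close>

definition solution_with_lifespan ::
    "(real \<Rightarrow> real) \<Rightarrow> (real \<Rightarrow> real \<Rightarrow> real) \<Rightarrow> real \<Rightarrow> ('a::euclidean_space \<Rightarrow> real) \<Rightarrow> ('a \<Rightarrow> real)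
      \<Rightarrow> real \<Rightarrow> ereal \<Rightarrow> (real \<Rightarrow> 'a \<Rightarrow> real) \<Rightarrow> bool"
  where "solution_with_lifespan b f \<epsilon> u0 u1 R T u \<longleftrightarrow>
    weak_solution b f \<epsilon> u0 u1 R T u \<and>
    \<not> (\<exists>T' v. T < T' \<and> weak_solution b f \<epsilon> u0 u1 R T' v \<and>
         (\<forall>t\<in>time_interval T. AE x in lebesgue. v t x = u t x))"

end

(* Testing the equation with the constant 1 and with the radial solution phi of "Laplace phi = phi"
   (growing like exp |x| * |x| powr (-(n - 1)/2)) gives two functionals, U and F. With
   m = (ln^[k](e^[k] + t)) powr mu, the damping is an integrating factor: F grows at least like
   eps * exp t / m t, and Hoelder's inequality against phi bounds the p-th power of u from below by
   eps^p * m^(-p) * t^((n - 1)(1 - p/2)). Integrating twice bounds U from below, while Hoelder's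
   inequality against 1 gives a differential inequality U'' >= c * t^(-n(p - 1)) * U^p up to the
   integrating factor. On [t/2, t] the factor m is comparable to a constant, and a doubling-time
   argument there yields t^gamma * m(t)^(-p(p - 1)) * eps^(p(p - 1)) <= C for every t below the
   lifespan. *)
theory Submission
  imports Defs
begin

section \<open>Smooth functions\<close>


text \<open>The damping is not integrable in time, so \<open>growth\<close> is unbounded and enters
  the lifespan; what makes it manageable is slow variation, a bounded factor under doubling of
  \<open>t\<close>. On \<open>[t/2, t]\<close> it cancels between the two sides of the differential
  inequality, and the whole loss sits in the starting value \<open>U (t/2)\<close>, whose factor
  \<open>m powr (- p)\<close> is raised to \<open>p - 1\<close> by the doubling argument. The power
  of \<open>t\<close> is \<open>2 + n (1 - p) + (\<theta> + 2) (p - 1)\<close> with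
  \<open>\<theta> = (n - 1) (1 - p / 2)\<close>, which is exactly \<open>\<gamma>(n, p)\<close>; the
  power weight in front of \<open>exp |x|\<close> therefore has to be captured sharply. Two
  obstacles shape the rest. Admissible test functions have compact support, so both weights are cut
  off beyond the support of the solution. The nonlinear term is only integrable in time, so the
  equation for a functional is kept in integrated form, and continuous lower bounds replace the
  nonlinear term.\<close>

lemma ck_function_lower: "ck_function (Suc k) f \<Longrightarrow> ck_function k f"
  by (induction k arbitrary: f) (auto simp: differentiable_imp_continuous_on)

text \<open>\<open>frechet_derivative\<close> is a choice operator. An explicit derivative
  determines it, so the inductions below work with derivative formulas instead.\<close>

lemma ck_function_SucI:
  assumes "\<And>x. (f has_derivative f' x) (at x)" and "\<And>v. ck_function k (\<lambda>x. f' x v)"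
  shows "ck_function (Suc k) f"
proof -
  have "f differentiable_on UNIV"
    using assms(1) by (auto simp: differentiable_on_def differentiable_def intro: has_derivative_at_withinI)
  moreover have "frechet_derivative f (at x) = f' x" for x
    using frechet_derivative_at[OF assms(1)] by simp
  ultimately show ?thesis using assms(2) by simp
qed

lemma ck_function_SucD:
  assumes "ck_function (Suc k) f"
  shows "(f has_derivative frechet_derivative f (at x)) (at x)"
    and "ck_function k (\<lambda>x. frechet_derivative f (at x) v)"
  using assms by (auto simp: differentiable_on_def frechet_derivative_works)

lemma ck_function_const [simp]: "ck_function k (\<lambda>x. c)"
proof (induction k arbitrary: c)
  case (Suc k)
  show ?case by (rule ck_function_SucI[where f' = "\<lambda>x v. 0"]) (auto intro: Suc)
qed simp

lemma ck_function_linear: "bounded_linear f \<Longrightarrow> ck_function k f"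
proof (cases k)
  case (Suc j)
  assume "bounded_linear f"
  then show ?thesis unfolding Suc
    by (intro ck_function_SucI[where f' = "\<lambda>x. f"]) (auto intro: bounded_linear_imp_has_derivative)
qed (auto simp: linear_continuous_on)

lemma ck_function_add: "ck_function k f \<Longrightarrow> ck_function k g \<Longrightarrow> ck_function k (\<lambda>x. f x + g x)"
proof (induction k arbitrary: f g)
  case (Suc k)
  show ?case
    by (rule ck_function_SucI[OF has_derivative_add[OF ck_function_SucD(1)[OF Suc(2)] ck_function_SucD(1)[OF Suc(3)]]])
       (intro Suc.IH ck_function_SucD(2)[OF Suc(2)] ck_function_SucD(2)[OF Suc(3)])
qed (auto intro: continuous_on_add)

lemma ck_function_mult: "ck_function k f \<Longrightarrow> ck_function k g \<Longrightarrow> ck_function k (\<lambda>x. f x * g x)"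
proof (induction k arbitrary: f g)
  case (Suc k)
  show ?case
    by (rule ck_function_SucI[OF has_derivative_mult[OF ck_function_SucD(1)[OF Suc(2)] ck_function_SucD(1)[OF Suc(3)]]])
       (intro ck_function_add Suc.IH ck_function_SucD(2)[OF Suc(2)] ck_function_SucD(2)[OF Suc(3)]
          ck_function_lower[OF Suc(2)] ck_function_lower[OF Suc(3)])
qed (auto intro: continuous_on_mult)

lemma ck_function_uminus: "ck_function k f \<Longrightarrow> ck_function k (\<lambda>x. - f x)"
  using ck_function_mult[OF ck_function_const[where c = "-1"]] by simp

lemma ck_function_diff: "ck_function k f \<Longrightarrow> ck_function k g \<Longrightarrow> ck_function k (\<lambda>x. f x - g x)"
  using ck_function_add[OF _ ck_function_uminus] by simp

lemma ck_function_inverse: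
  "ck_function k f \<Longrightarrow> (\<And>x. f x \<noteq> 0) \<Longrightarrow> ck_function k (\<lambda>x. inverse (f x))"
proof (induction k arbitrary: f)
  case (Suc k)
  have "((\<lambda>x. inverse (f x)) has_derivative (\<lambda>h. - (inverse (f x) * frechet_derivative f (at x) h * inverse (f x)))) (at x)" for x
    using Deriv.has_derivative_inverse[OF Suc(3) ck_function_SucD(1)[OF Suc(2)]] by simp
  then show ?case
    by (rule ck_function_SucI)
       (intro ck_function_uminus ck_function_mult Suc.IH ck_function_lower[OF Suc(2)] ck_function_SucD(2)[OF Suc(2)] Suc(3))
qed (auto intro: continuous_on_inverse)

text \<open>Since the outer function lives on the reals, its derivative is multiplication by
  \<open>g'\<close>, and the chain rule yields a product of the composite of \<open>g'\<close> and
  \<open>f\<close> with a derivative of \<open>f\<close>. Only \<open>g\<close> has to vary in the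
  induction.\<close>

lemma ck_function_compose_real:
  fixes g :: "real \<Rightarrow> real"
  shows "ck_function k g \<Longrightarrow> ck_function k f \<Longrightarrow> ck_function k (\<lambda>x. g (f x))"
proof (induction k arbitrary: g)
  case (Suc k)
  have lin: "frechet_derivative g (at y) h = frechet_derivative g (at y) 1 * h" for y h
  proof -
    have "linear (frechet_derivative g (at y))"
      by (rule has_derivative_linear[OF ck_function_SucD(1)[OF Suc(2)]])
    from linear_scale[OF this, of h 1] show ?thesis by simp
  qed
  have "((\<lambda>x. g (f x)) has_derivative (\<lambda>h. frechet_derivative g (at (f x)) 1 * frechet_derivative f (at x) h)) (at x)" for x
    using has_derivative_compose[OF ck_function_SucD(1)[OF Suc(3)] ck_function_SucD(1)[OF Suc(2)]]
    by (subst (asm) lin) simp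
  then show ?case
    by (rule ck_function_SucI)
       (rule ck_function_mult[OF Suc.IH[OF ck_function_SucD(2)[OF Suc(2)] ck_function_lower[OF Suc(3)]]
          ck_function_SucD(2)[OF Suc(3)]])
qed (auto intro: continuous_on_compose2)

lemma ck_function_compose_linear:
  assumes "bounded_linear L"
  shows "ck_function k g \<Longrightarrow> ck_function k (\<lambda>x. g (L x))"
proof (induction k arbitrary: g)
  case (Suc k)
  have "((\<lambda>x. g (L x)) has_derivative (\<lambda>h. frechet_derivative g (at (L x)) (L h))) (at x)" for x
    using has_derivative_compose[OF bounded_linear_imp_has_derivative[OF assms] ck_function_SucD(1)[OF Suc(2)]] by simp
  then show ?case
    by (rule ck_function_SucI) (rule Suc.IH[OF ck_function_SucD(2)[OF Suc(2)]])
qed (auto intro: continuous_on_compose2 linear_continuous_on[OF assms])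

lemma ck_function_inner_self: "ck_function k (\<lambda>x::'a::euclidean_space. x \<bullet> x)"
proof (cases k)
  case (Suc j)
  have "((\<lambda>x::'a. x \<bullet> x) has_derivative (\<lambda>v. v \<bullet> x + v \<bullet> x)) (at x)" for x
    by (auto intro!: derivative_eq_intros simp: inner_commute)
  then show ?thesis unfolding Suc
    by (rule ck_function_SucI)
       (intro ck_function_add ck_function_linear bounded_linear_inner_right)
qed (auto intro: continuous_intros)

text \<open>The family is closed under differentiation, which gives the smoothness of
  \<open>exp (- 1 / x)\<close> at the origin.\<close>
definition flat_fun :: "nat \<Rightarrow> real \<Rightarrow> real"
  where "flat_fun j x = (if x > 0 then exp (- inverse x) * inverse x ^ j else 0)"

text \<open>A single term of the exponential series at \<open>1 / x\<close>, that of order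
  \<open>j + 2\<close>, dominates \<open>inverse x ^ j\<close> with two powers of \<open>x\<close>
  to spare. The quadratic bound is what makes the difference quotient at 0 vanish.\<close>

lemma flat_fun_bound:
  assumes "x > 0"
  shows "flat_fun j x \<le> fact (j + 2) * x\<^sup>2"
proof -
  have "inverse x ^ (j + 2) / fact (j + 2) \<le> exp (inverse x)"
  proof -
    have "(inverse x ^ (j + 2)) /\<^sub>R fact (j + 2) \<le> (\<Sum>n. inverse x ^ n /\<^sub>R fact n)"
      using sum_le_suminf[OF summable_exp_generic[of "inverse x"], of "{j + 2}"] assms by auto
    then show ?thesis unfolding exp_def by (simp add: divide_inverse mult.commute)
  qed
  then have "inverse x ^ j * (inverse x)\<^sup>2 \<le> fact (j + 2) * exp (inverse x)"
    by (simp add: divide_le_eq power_add mult.commute power2_eq_square mult.assoc mult.left_commute)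
  then have "inverse x ^ j * (inverse x)\<^sup>2 * x\<^sup>2 \<le> fact (j + 2) * exp (inverse x) * x\<^sup>2"
    by (rule mult_right_mono) simp
  moreover have "inverse x ^ j * (inverse x)\<^sup>2 * x\<^sup>2 = inverse x ^ j"
    using assms by (simp add: power_mult_distrib[symmetric] mult.assoc)
  ultimately have "inverse x ^ j \<le> fact (j + 2) * exp (inverse x) * x\<^sup>2" by simp
  then have "exp (- inverse x) * inverse x ^ j \<le> exp (- inverse x) * (fact (j + 2) * exp (inverse x) * x\<^sup>2)"
    by (rule mult_left_mono) simp
  also have "\<dots> = fact (j + 2) * x\<^sup>2"
    by (simp add: exp_minus)
  finally show ?thesis using assms by (simp add: flat_fun_def)
qed

lemma flat_fun_deriv:
  "(flat_fun j has_real_derivative flat_fun (j + 2) x - real j * flat_fun (j + 1) x) (at x)"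
proof (cases x "0::real" rule: linorder_cases)
  case less
  have "((\<lambda>x. 0) has_real_derivative 0) (at x)" by simp
  then have "(flat_fun j has_real_derivative 0) (at x)"
    by (rule has_field_derivative_transform_within_open[where S = "{..<0}"])
       (use less in \<open>auto simp: flat_fun_def\<close>)
  then show ?thesis using less by (simp add: flat_fun_def)
next
  case greater
  \<comment> \<open>Differentiating \<open>inverse x ^ j\<close> yields the truncated exponent
    \<open>j - 1\<close>; at \<open>j = 0\<close> the factor \<open>real j\<close> makes both sides
    vanish.\<close>
  have *: "real j * (inverse x * inverse x ^ j) = real j * (inverse x * (inverse x * inverse x ^ (j - 1)))"
    by (cases j) auto
  have "((\<lambda>x. exp (- inverse x) * inverse x ^ j) has_real_derivative
     flat_fun (j + 2) x - real j * flat_fun (j + 1) x) (at x)"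
    using greater * by (auto intro!: derivative_eq_intros simp: flat_fun_def algebra_simps power2_eq_square)
  then show ?thesis
    by (rule has_field_derivative_transform_within_open[where S = "{0<..}"])
       (use greater in \<open>auto simp: flat_fun_def\<close>)
next
  case equal
  have "((\<lambda>h. flat_fun j h / h) \<longlongrightarrow> 0) (at 0)"
  proof (rule Lim_null_comparison)
    show "\<forall>\<^sub>F h in at 0. norm (flat_fun j h / h) \<le> fact (j + 2) * \<bar>h\<bar>"
    proof (rule always_eventually, rule allI)
      fix h :: real
      have "0 \<le> fact (j + 2) * \<bar>h\<bar>" by simp
      then show "norm (flat_fun j h / h) \<le> fact (j + 2) * \<bar>h\<bar>"
      proof (cases "h > 0")
        case True
        then have "flat_fun j h \<ge> 0" by (simp add: flat_fun_def)
        then show ?thesis using flat_fun_bound[OF True, of j] True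
          by (simp add: divide_le_eq power2_eq_square mult.assoc del: fact_Suc)
      qed (simp add: flat_fun_def del: fact_Suc)
    qed
    show "((\<lambda>h. fact (j + 2) * \<bar>h\<bar>) \<longlongrightarrow> 0) (at (0::real))"
      by (auto intro!: tendsto_eq_intros)
  qed
  then show ?thesis using equal by (simp add: DERIV_def flat_fun_def)
qed

lemma ck_flat_fun: "ck_function k (flat_fun j)"
proof (induction k arbitrary: j)
  case 0
  show ?case using flat_fun_deriv
    by (auto intro!: continuous_at_imp_continuous_on DERIV_isCont)
next
  case (Suc k)
  show ?case
    by (rule ck_function_SucI[OF flat_fun_deriv[unfolded has_field_derivative_def]])
       (intro ck_function_mult ck_function_diff ck_function_const Suc.IH)
qed

section \<open>Smooth cutoff functions\<close>

definition smooth_step :: "real \<Rightarrow> real"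
  where "smooth_step x = flat_fun 0 x * inverse (flat_fun 0 x + flat_fun 0 (1 - x))"

lemma flat_fun_pos: "x > 0 \<Longrightarrow> flat_fun j x > 0" and flat_fun_nonneg: "flat_fun j x \<ge> 0"
  by (auto simp: flat_fun_def)

text \<open>At least one of \<open>x\<close> and \<open>1 - x\<close> is positive, so the
  denominator of \<open>smooth_step\<close> never vanishes.\<close>

lemma flat_fun_add_pos: "flat_fun 0 x + flat_fun 0 (1 - x) > 0"
proof (cases "x > 0")
  case True
  then show ?thesis using flat_fun_pos[of x 0] flat_fun_nonneg[of 0 "1 - x"] by linarith
next
  case False
  then show ?thesis using flat_fun_pos[of "1 - x" 0] flat_fun_nonneg[of 0 x] by linarith
qed

lemma ck_smooth_step: "ck_function k smooth_step"
proof -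
  have "ck_function k (\<lambda>x. flat_fun 0 (1 - x))"
    by (rule ck_function_compose_real[OF ck_flat_fun])
       (intro ck_function_diff ck_function_const ck_function_linear bounded_linear_ident)
  then show ?thesis unfolding smooth_step_def
    by (intro ck_function_mult ck_function_inverse ck_function_add ck_flat_fun)
       (use flat_fun_add_pos in \<open>auto simp: less_le\<close>)
qed

lemma smooth_step_eq_1: "x \<ge> 1 \<Longrightarrow> smooth_step x = 1"
  using flat_fun_pos[of x 0] by (simp add: smooth_step_def flat_fun_def)

lemma smooth_step_eq_0: "x \<le> 0 \<Longrightarrow> smooth_step x = 0"
  by (simp add: smooth_step_def flat_fun_def)

lemma smooth_step_nonneg: "smooth_step x \<ge> 0"
  unfolding smooth_step_def using flat_fun_nonneg flat_fun_add_pos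
  by (intro mult_nonneg_nonneg) (auto intro: less_imp_le)

text \<open>The argument contains the square of the norm, which is smooth at the origin. Since
  \<open>(\<rho> + 1)^2 >= \<rho>^2 + 1\<close> for \<open>\<rho> >= 0\<close>, the transition from
  1 to 0 takes place between the radii \<open>\<rho>\<close> and \<open>\<rho> + 1\<close>.\<close>

definition cutoff :: "real \<Rightarrow> 'a::euclidean_space \<Rightarrow> real"
  where "cutoff \<rho> x = smooth_step (\<rho>\<^sup>2 + 1 - x \<bullet> x)"

lemma ck_cutoff: "ck_function k (cutoff \<rho>)"
  unfolding cutoff_def
  by (rule ck_function_compose_real[OF ck_smooth_step])
     (intro ck_function_diff ck_function_const ck_function_inner_self)

lemma cutoff_eq_1: "norm x \<le> \<rho> \<Longrightarrow> cutoff \<rho> x = 1"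
  unfolding cutoff_def
  using power_mono[of "norm x" \<rho> 2] by (intro smooth_step_eq_1) (simp add: dot_square_norm)

lemma cutoff_eq_0: "\<rho> \<ge> 0 \<Longrightarrow> norm x \<ge> \<rho> + 1 \<Longrightarrow> cutoff \<rho> x = 0"
proof -
  assume "\<rho> \<ge> 0" "norm x \<ge> \<rho> + 1"
  then have "(norm x)\<^sup>2 \<ge> (\<rho> + 1)\<^sup>2" by (intro power_mono) auto
  then show ?thesis unfolding cutoff_def using \<open>\<rho> \<ge> 0\<close>
    by (intro smooth_step_eq_0) (simp add: dot_square_norm power2_eq_square algebra_simps)
qed

lemma cutoff_nonneg: "cutoff \<rho> x \<ge> 0"
  by (simp add: cutoff_def smooth_step_nonneg)

lemma compact_support:
  fixes f :: "'a::euclidean_space \<Rightarrow> 'b::zero"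
  assumes "\<And>x. norm x > \<rho> \<Longrightarrow> f x = 0"
  shows "closure {x. f x \<noteq> 0} \<subseteq> cball 0 \<rho>" and "compact (closure {x. f x \<noteq> 0})"
proof -
  have "{x. f x \<noteq> 0} \<subseteq> cball 0 \<rho>"
  proof
    fix x assume "x \<in> {x. f x \<noteq> 0}"
    then have "\<not> norm x > \<rho>" using assms by blast
    then show "x \<in> cball 0 \<rho>" by simp
  qed
  from closure_minimal[OF this closed_cball]
  show *: "closure {x. f x \<noteq> 0} \<subseteq> cball 0 \<rho>" .
  show "compact (closure {x. f x \<noteq> 0})"
    using bounded_subset[OF bounded_cball *] by (simp add: compact_eq_bounded_closed)
qed

lemma test_functionI:
  assumes "\<And>k. ck_function k f" and "\<And>x. norm x > \<rho> \<Longrightarrow> f x = 0"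
  shows "test_function f"
  using assms(1) compact_support(2)[OF assms(2)] by (auto simp: test_function_def smooth_function_def)

section \<open>A positive radial solution of \<open>\<Delta> \<phi> = \<phi>\<close>\<close>


text \<open>Coefficients, in powers of \<open>r^2\<close>, of the normalized modified Bessel
  function \<open>Gamma(n/2) (2/r)^\<nu> I_\<nu>(r)\<close> with \<open>\<nu> = n/2 - 1\<close>. The
  factors are dictated by the radial form of the equation.\<close>

definition bessel_coeff :: "nat \<Rightarrow> nat \<Rightarrow> real"
  where "bessel_coeff n k = (\<Prod>j<k. inverse (4 * (real j + 1) * (real j + real n / 2)))"

lemma bessel_coeff_0 [simp]: "bessel_coeff n 0 = 1"
  by (simp add: bessel_coeff_def)

lemma bessel_coeff_Suc:
  "bessel_coeff n (Suc k) = bessel_coeff n k / (4 * (real k + 1) * (real k + real n / 2))"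
  by (simp only: bessel_coeff_def prod.lessThan_Suc divide_inverse)

lemma bessel_coeff_nonneg: "bessel_coeff n k \<ge> 0"
  by (auto simp: bessel_coeff_def intro!: prod_nonneg)

lemma bessel_coeff_le_fact:
  assumes "n \<ge> 1"
  shows "bessel_coeff n k \<le> 1 / fact k"
proof (induction k)
  case (Suc k)
  have "bessel_coeff n (Suc k) \<le> bessel_coeff n k / (real k + 1)"
  proof -
    have "(real k + 1) * 1 \<le> (real k + 1) * (4 * (real k + real n / 2))"
      using assms by (intro mult_left_mono) auto
    then show ?thesis unfolding bessel_coeff_Suc
      by (intro divide_left_mono) (use bessel_coeff_nonneg assms in \<open>auto simp: algebra_simps intro!: add_pos_nonneg\<close>)
  qed
  also have "\<dots> \<le> 1 / fact k / (real k + 1)"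
    by (intro divide_right_mono Suc) auto
  finally show ?case by (simp add: field_simps)
qed simp

text \<open>The product \<open>fact (2 * k) * bessel_coeff n k\<close> has the factors
  \<open>(j + 1/2) / (j + n/2) = 1 - \<alpha> / (j + n/2)\<close>, each at most \<open>exp (-
  \<alpha> / (j + n)) <= ((j + n) / (j + n + 1)) powr \<alpha>\<close>. These bounds telescope and
  leave the power weight on top of the coefficients of cosh.\<close>

lemma bessel_coeff_le:
  assumes "n \<ge> 1"
  defines "\<alpha> \<equiv> (real n - 1) / 2"
  shows "bessel_coeff n k \<le> real n powr \<alpha> * (real k + real n) powr (- \<alpha>) / fact (2 * k)"
proof (induction k)
  case 0
  then show ?case using assms by (simp add: powr_minus)
next
  case (Suc k)
  have a: "\<alpha> \<ge> 0" using assms by simp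
  let ?x = "real k + real n"
  have x: "?x \<ge> 1" using assms by simp
  have h: "real k + real n / 2 > 0" using assms by simp
  have "(real k + 1/2) / (real k + real n / 2) = 1 + (- \<alpha> / (real k + real n / 2))"
    using h by (simp add: \<alpha>_def field_simps)
  also have "\<dots> \<le> exp (- \<alpha> / (real k + real n / 2))" by (rule exp_ge_add_one_self)
  also have "\<dots> \<le> exp (- \<alpha> / ?x)"
    using a h x by (auto intro!: divide_left_mono mult_pos_pos)
  also have "\<dots> \<le> exp (- \<alpha> * ln ((?x + 1) / ?x))"
  proof -
    have "ln ((?x + 1) / ?x) \<le> 1 / ?x"
      using ln_add_one_self_le_self[of "1 / ?x"] x by (simp add: add_divide_distrib add.commute)
    from mult_left_mono[OF this a] show ?thesis by simp
  qed
  also have "\<dots> = (?x + 1) powr (- \<alpha>) * ?x powr \<alpha>"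
    using x by (simp add: powr_def ln_div exp_add[symmetric] algebra_simps)
  finally have *: "(real k + 1/2) / (real k + real n / 2) \<le> (?x + 1) powr (- \<alpha>) * ?x powr \<alpha>" .
  have "bessel_coeff n (Suc k) = bessel_coeff n k / (4 * (real k + 1) * (real k + real n / 2))"
    by (rule bessel_coeff_Suc)
  also have "\<dots> \<le> real n powr \<alpha> * ?x powr (- \<alpha>) / fact (2 * k) / (4 * (real k + 1) * (real k + real n / 2))"
    using h by (intro divide_right_mono Suc) auto
  also have "\<dots> = real n powr \<alpha> * ?x powr (- \<alpha>) / fact (2 * Suc k) * ((real k + 1/2) / (real k + real n / 2))"
  proof -
    have "fact (2 * Suc k) = (4 * (real k + 1) * (real k + 1/2) * fact (2 * k) :: real)"
      by (simp add: algebra_simps)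
    moreover have "a / F / (4 * K * H) = a / (4 * K * J * F) * (J / H)" if "J \<noteq> 0" for a F K H J :: real
      using that by simp
    ultimately show ?thesis by (simp only:)
  qed
  also have "\<dots> \<le> real n powr \<alpha> * ?x powr (- \<alpha>) / fact (2 * Suc k) * ((?x + 1) powr (- \<alpha>) * ?x powr \<alpha>)"
    by (intro mult_left_mono *) simp
  also have "\<dots> = real n powr \<alpha> * (real (Suc k) + real n) powr (- \<alpha>) / fact (2 * Suc k)"
    using x by (simp add: powr_minus field_simps del: fact_Suc)
  finally show ?case .
qed

lemma summable_bessel:
  assumes "n \<ge> 1"
  shows "summable (\<lambda>k. bessel_coeff n k * y ^ k)"
proof (rule summable_comparison_test[OF _ summable_exp[of "\<bar>y\<bar>"]], intro exI allI impI)
  fix k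
  have "\<bar>bessel_coeff n k * y ^ k\<bar> \<le> (1 / fact k) * \<bar>y\<bar> ^ k"
    using mult_right_mono[OF bessel_coeff_le_fact[OF assms], of "\<bar>y\<bar> ^ k" k]
    by (simp add: abs_mult power_abs bessel_coeff_nonneg)
  then show "norm (bessel_coeff n k * y ^ k) \<le> inverse (fact k) * \<bar>y\<bar> ^ k"
    by (simp only: real_norm_def divide_inverse mult_1_left)
qed

text \<open>The derivative is again an everywhere convergent power series, so the induction runs
  over all coefficient sequences.\<close>

lemma ck_powser:
  fixes c :: "nat \<Rightarrow> real"
  assumes "\<And>y. summable (\<lambda>n. c n * y ^ n)"
  shows "ck_function k (\<lambda>y. \<Sum>n. c n * y ^ n)"
  using assms
proof (induction k arbitrary: c)
  case 0
  show ?case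
    using termdiffs_strong_converges_everywhere[OF 0]
    by (auto intro!: continuous_at_imp_continuous_on DERIV_isCont)
next
  case (Suc k)
  show ?case
    by (rule ck_function_SucI[OF termdiffs_strong_converges_everywhere[OF Suc.prems, unfolded has_field_derivative_def]])
       (intro ck_function_mult ck_function_const Suc.IH termdiff_converges_all Suc.prems)
qed

definition bessel_fun :: "nat \<Rightarrow> real \<Rightarrow> real"
  where "bessel_fun n y = (\<Sum>k. bessel_coeff n k * y ^ k)"

text \<open>Up to normalization this is the mean of \<open>exp (x \<bullet> \<omega>)\<close> over the unit sphere.\<close>
definition spherical_exp :: "'a::euclidean_space \<Rightarrow> real"
  where "spherical_exp x = bessel_fun DIM('a) (x \<bullet> x)"

lemma ck_spherical_exp: "ck_function k (spherical_exp :: 'a::euclidean_space \<Rightarrow> real)"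
proof -
  have "ck_function k (bessel_fun DIM('a))"
    unfolding bessel_fun_def by (intro ck_powser summable_bessel) (simp add: DIM_positive Suc_leI)
  from ck_function_compose_real[OF this ck_function_inner_self] show ?thesis
    unfolding spherical_exp_def .
qed

definition partial2 :: "('a::euclidean_space \<Rightarrow> real) \<Rightarrow> 'a \<Rightarrow> 'a \<Rightarrow> real"
  where "partial2 f i x = frechet_derivative (\<lambda>y. frechet_derivative f (at y) i) (at x) i"

lemma has_real_derivative_imp_has_derivative_compose:
  fixes g :: "real \<Rightarrow> real"
  assumes "(g has_real_derivative g') (at (f x))" and "(f has_derivative f') (at x)"
  shows "((\<lambda>x. g (f x)) has_derivative (\<lambda>v. g' * f' v)) (at x)"
  using has_derivative_compose[OF assms(2) assms(1)[unfolded has_field_derivative_def]]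
  by simp

text \<open>For \<open>g (|x|^2)\<close> the Laplacian is \<open>4 |x|^2 g'' + 2 n g'\<close>.
  Comparing coefficients, equality with \<open>g\<close> is the recursion
  \<open>c k = 4 (k + 1) (k + n/2) c (k + 1)\<close>.\<close>

lemma spherical_exp_laplace:
  fixes x :: "'a::euclidean_space"
  shows "(\<Sum>i\<in>Basis. partial2 spherical_exp i x) = spherical_exp x"
proof -
  define c where "c = bessel_coeff DIM('a)"
  have D: "DIM('a) \<ge> 1" by (simp add: DIM_positive Suc_leI)
  have s0: "summable (\<lambda>n. c n * y ^ n)" for y
    unfolding c_def by (rule summable_bessel[OF D])
  have s1: "summable (\<lambda>n. diffs c n * y ^ n)" for y
    by (rule termdiff_converges_all[OF s0])
  have s2: "summable (\<lambda>n. diffs (diffs c) n * y ^ n)" for y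
    by (rule termdiff_converges_all[OF s1])
  define g0 where "g0 y = (\<Sum>n. c n * y ^ n)" for y
  define g1 where "g1 y = (\<Sum>n. diffs c n * y ^ n)" for y
  define g2 where "g2 y = (\<Sum>n. diffs (diffs c) n * y ^ n)" for y
  have d0: "(g0 has_real_derivative g1 y) (at y)" for y
    unfolding g0_def[abs_def] g1_def by (rule termdiffs_strong_converges_everywhere[OF s0])
  have d1: "(g1 has_real_derivative g2 y) (at y)" for y
    unfolding g1_def[abs_def] g2_def by (rule termdiffs_strong_converges_everywhere[OF s1])
  have phi: "spherical_exp = (\<lambda>x::'a. g0 (x \<bullet> x))"
    by (rule ext) (simp add: spherical_exp_def bessel_fun_def g0_def c_def)
  have in_self: "((\<lambda>x::'a. x \<bullet> x) has_derivative (\<lambda>v. 2 * (y \<bullet> v))) (at y)" for y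
    by (auto intro!: derivative_eq_intros simp: inner_commute)
  have f1: "frechet_derivative spherical_exp (at y) = (\<lambda>v. g1 (y \<bullet> y) * (2 * (y \<bullet> v)))" for y :: 'a
    unfolding phi
    by (rule frechet_derivative_at[symmetric], rule has_real_derivative_imp_has_derivative_compose[OF d0 in_self])
  have f2: "partial2 spherical_exp i x = 4 * g2 (x \<bullet> x) * (x \<bullet> i)\<^sup>2 + 2 * g1 (x \<bullet> x)" if "i \<in> Basis" for i
  proof -
    have "((\<lambda>y::'a. g1 (y \<bullet> y) * (2 * (y \<bullet> i))) has_derivative
        (\<lambda>v. g1 (x \<bullet> x) * (2 * (v \<bullet> i)) + g2 (x \<bullet> x) * (2 * (x \<bullet> v)) * (2 * (x \<bullet> i)))) (at x)"
      by (rule has_derivative_mult[OF has_real_derivative_imp_has_derivative_compose[OF d1 in_self]])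
         (auto intro!: derivative_eq_intros)
    from frechet_derivative_at[OF this, symmetric] that show ?thesis
      by (simp add: partial2_def f1 power2_eq_square)
  qed
  have "(\<Sum>i\<in>Basis. partial2 spherical_exp i x) =
      4 * g2 (x \<bullet> x) * (\<Sum>i\<in>Basis. (x \<bullet> i)\<^sup>2) + 2 * real DIM('a) * g1 (x \<bullet> x)"
    by (simp add: f2 sum.distrib sum_distrib_left)
  also have "(\<Sum>i\<in>Basis. (x \<bullet> i)\<^sup>2) = x \<bullet> x"
    by (subst euclidean_inner) (simp add: power2_eq_square)
  also have "4 * g2 (x \<bullet> x) * (x \<bullet> x) + 2 * real DIM('a) * g1 (x \<bullet> x) = g0 (x \<bullet> x)"
  proof -
    define y where "y = x \<bullet> x"
    have e: "4 * (diffs (\<lambda>n. real n * c n) n * y ^ n) - 4 * (diffs c n * y ^ n) + 2 * real DIM('a) * (diffs c n * y ^ n)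
        = c n * y ^ n" for n
    proof -
      have "c n = c (Suc n) * (4 * (real n + 1) * (real n + real DIM('a) / 2))"
      proof -
        have "real n + real DIM('a) / 2 > 0" by (simp add: add_nonneg_pos)
        then show ?thesis using bessel_coeff_Suc[of "DIM('a)" n] unfolding c_def by simp
      qed
      then show ?thesis by (simp add: diffs_def algebra_simps)
    qed
    \<comment> \<open>Multiplication by \<open>y\<close> shifts the powers by one; the resulting
      coefficient \<open>n (n + 1) c (n + 1)\<close> is split into two \<open>diffs\<close> terms to
      match \<open>e\<close>.\<close>
    have t: "(\<lambda>n. diffs (\<lambda>n. real n * c n) n * y ^ n - diffs c n * y ^ n) sums (g2 y * y)"
    proof -
      have "(\<lambda>n. (diffs (diffs c) n * y ^ n) * y) sums (g2 y * y)"
        unfolding g2_def by (intro sums_mult2 summable_sums s2)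
      then have "(\<lambda>n. real (Suc n) * diffs c (Suc n) * y ^ Suc n) sums (g2 y * y)"
        by (simp add: diffs_def mult_ac)
      then have "(\<lambda>n. real n * diffs c n * y ^ n) sums (g2 y * y)"
        by (subst (asm) sums_Suc_iff) simp
      then show ?thesis by (simp add: diffs_def algebra_simps)
    qed
    have "(\<lambda>n. 4 * (diffs (\<lambda>n. real n * c n) n * y ^ n - diffs c n * y ^ n)
        + 2 * real DIM('a) * (diffs c n * y ^ n)) sums (4 * (g2 y * y) + 2 * real DIM('a) * g1 y)"
      unfolding g1_def by (intro sums_add sums_mult t summable_sums s1)
    also have "(\<lambda>n. 4 * (diffs (\<lambda>n. real n * c n) n * y ^ n - diffs c n * y ^ n)
        + 2 * real DIM('a) * (diffs c n * y ^ n)) = (\<lambda>n. c n * y ^ n)"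
      by (rule ext) (use e in \<open>simp add: right_diff_distrib\<close>)
    finally have "g0 y = 4 * (g2 y * y) + 2 * real DIM('a) * g1 y"
      unfolding g0_def by (simp add: sums_iff)
    then show ?thesis unfolding y_def by simp
  qed
  finally show ?thesis unfolding phi .
qed

lemma bessel_fun_ge_1:
  assumes "n \<ge> 1" "y \<ge> 0"
  shows "bessel_fun n y \<ge> 1"
  using sum_le_suminf[OF summable_bessel[OF assms(1), of y], of "{0}"] assms(2)
  by (simp add: bessel_fun_def bessel_coeff_nonneg)

lemma spherical_exp_ge_1: "spherical_exp x \<ge> 1"
  unfolding spherical_exp_def by (rule bessel_fun_ge_1) (simp_all add: DIM_positive Suc_leI)

text \<open>Distinct exponents pick out distinct terms of the exponential series. It is meant for
  the even exponents \<open>2 * k\<close> and their shifts \<open>2 * k + n\<close>.\<close>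

lemma sum_exp_terms_le:
  fixes r :: real
  assumes "r \<ge> 0" "inj h" "finite A"
  shows "(\<Sum>k\<in>A. r ^ h k / fact (h k)) \<le> exp r"
proof -
  have "(\<Sum>k\<in>A. r ^ h k / fact (h k)) = (\<Sum>j\<in>h ` A. inverse (fact j) * r ^ j)"
    using inj_on_subset[OF assms(2)] by (subst sum.reindex) (auto simp: divide_inverse mult.commute)
  also have "\<dots> \<le> (\<Sum>j. inverse (fact j) * r ^ j)"
    by (rule sum_le_suminf[OF summable_exp]) (use assms in auto)
  also have "\<dots> = exp r" by (simp add: exp_def)
  finally show ?thesis .
qed

text \<open>The weight \<open>(k + n) powr -\<alpha>\<close> is at most \<open>r powr -\<alpha> * (1 + (r / (k + n)) ^ n)\<close>, and the factor
  \<open>(k + n) ^ n\<close> is absorbed by shifting the factorial.\<close>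
lemma bessel_fun_le:
  assumes n: "n \<ge> 1" and r: "r > 0"
  defines "\<alpha> \<equiv> (real n - 1) / 2"
  shows "bessel_fun n (r\<^sup>2) \<le> real n powr \<alpha> * (1 + 2 ^ n) * (r powr (- \<alpha>) * exp r)"
proof -
  have a: "\<alpha> \<ge> 0" "\<alpha> \<le> real n" using n by (auto simp: \<alpha>_def)
  have w: "(real k + real n) powr (- \<alpha>) \<le> r powr (- \<alpha>) * (1 + (r / (real k + real n)) ^ n)" for k
  proof -
    let ?x = "real k + real n"
    have x: "?x > 0" using n by simp
    have "(r / ?x) powr \<alpha> \<le> 1 + (r / ?x) ^ n"
    proof (cases "r / ?x \<le> 1")
      case True
      have "(r / ?x) powr \<alpha> \<le> 1" using True r x a by (intro powr_le1) auto
      also have "\<dots> \<le> 1 + (r / ?x) ^ n" using r x by simp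
      finally show ?thesis .
    next
      case False
      have "(r / ?x) powr \<alpha> \<le> (r / ?x) powr real n" using False a by (intro powr_mono) auto
      then show ?thesis using r x by (simp add: powr_realpow)
    qed
    from mult_left_mono[OF this, of "r powr (- \<alpha>)"]
    show ?thesis using r x by (simp add: powr_divide powr_minus field_simps)
  qed
  have f: "r ^ (2 * k) / fact (2 * k) * (r / (real k + real n)) ^ n \<le> 2 ^ n * (r ^ (2 * k + n) / fact (2 * k + n))" for k
  proof -
    have "fact (2 * k + n) \<le> (fact (2 * k) * real (2 * k + n) ^ n :: real)"
    proof -
      have "fact (2 * k + n) div fact (2 * k + n - n) \<le> (2 * k + n) ^ n"
        by (rule fact_div_fact_le_pow) simp
      then have "(fact (2 * k + n) :: nat) \<le> fact (2 * k) * (2 * k + n) ^ n"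
        by (metis add_diff_cancel_right' dvd_mult_div_cancel fact_dvd le_add1 mult_le_mono2)
      then have "real (fact (2 * k + n)) \<le> real (fact (2 * k) * (2 * k + n) ^ n)"
        by (simp only: of_nat_le_iff)
      then show ?thesis by simp
    qed
    also have "\<dots> \<le> fact (2 * k) * (2 * (real k + real n)) ^ n"
      by (intro mult_left_mono power_mono) auto
    finally have *: "fact (2 * k + n) \<le> fact (2 * k) * (2 ^ n * (real k + real n) ^ n)"
      by (simp only: power_mult_distrib)
    have "r ^ (2 * k) / fact (2 * k) * (r / (real k + real n)) ^ n = 2 ^ n * (r ^ (2 * k + n) / (fact (2 * k) * (2 ^ n * (real k + real n) ^ n)))"
      by (simp add: power_add power_divide)
    also have "\<dots> \<le> 2 ^ n * (r ^ (2 * k + n) / fact (2 * k + n))"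
      using r n * by (intro mult_left_mono divide_left_mono) auto
    finally show ?thesis .
  qed
  let ?A = "real n powr \<alpha>"
  have term_le: "bessel_coeff n k * (r\<^sup>2) ^ k \<le>
      ?A * r powr (- \<alpha>) * (r ^ (2 * k) / fact (2 * k) + 2 ^ n * (r ^ (2 * k + n) / fact (2 * k + n)))" for k
  proof -
    have "bessel_coeff n k * (r\<^sup>2) ^ k \<le> ?A * (real k + real n) powr (- \<alpha>) / fact (2 * k) * r ^ (2 * k)"
      using mult_right_mono[OF bessel_coeff_le[OF n, of k], of "r ^ (2 * k)"] r
      by (simp add: \<alpha>_def power_mult[symmetric])
    also have "\<dots> = ?A * (r ^ (2 * k) / fact (2 * k)) * (real k + real n) powr (- \<alpha>)" by simp
    also have "\<dots> \<le> ?A * (r ^ (2 * k) / fact (2 * k)) * (r powr (- \<alpha>) * (1 + (r / (real k + real n)) ^ n))"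
      using r by (intro mult_left_mono w) auto
    also have "\<dots> = ?A * r powr (- \<alpha>) * (r ^ (2 * k) / fact (2 * k) + r ^ (2 * k) / fact (2 * k) * (r / (real k + real n)) ^ n)"
      by (simp only: distrib_left distrib_right mult_ac mult_1_right)
    also have "\<dots> \<le> ?A * r powr (- \<alpha>) * (r ^ (2 * k) / fact (2 * k) + 2 ^ n * (r ^ (2 * k + n) / fact (2 * k + n)))"
      by (intro mult_left_mono add_left_mono f) simp
    finally show ?thesis .
  qed
  show ?thesis unfolding bessel_fun_def
  proof (rule suminf_le_const[OF summable_bessel[OF n]])
    fix N
    have "(\<Sum>k<N. bessel_coeff n k * (r\<^sup>2) ^ k) \<le>
      ?A * r powr (- \<alpha>) * ((\<Sum>k<N. r ^ (2 * k) / fact (2 * k)) + 2 ^ n * (\<Sum>k<N. r ^ (2 * k + n) / fact (2 * k + n)))"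
      unfolding sum_distrib_left sum.distrib[symmetric] by (intro sum_mono order.trans[OF term_le]) (simp add: sum_distrib_left)
    also have "\<dots> \<le> ?A * r powr (- \<alpha>) * (exp r + 2 ^ n * exp r)"
      using r by (intro mult_left_mono add_mono sum_exp_terms_le) (auto simp: inj_def)
    finally show "(\<Sum>k<N. bessel_coeff n k * (r\<^sup>2) ^ k) \<le> ?A * (1 + 2 ^ n) * (r powr (- \<alpha>) * exp r)"
      by (simp add: algebra_simps)
  qed
qed

text \<open>The weight \<open>n + norm x\<close> avoids the behaviour of
  \<open>norm x powr (- \<alpha>)\<close> at the origin. Outside the unit ball the two are
  comparable because \<open>n + norm x <= (n + 1) * norm x\<close>; inside it the series is at most
  \<open>exp ((norm x)^2) <= exp 1\<close>.\<close>

lemma spherical_exp_le: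
  defines "n \<equiv> real DIM('a::euclidean_space)"
  obtains A where "A > 0" and "\<And>x::'a. spherical_exp x \<le> A * ((n + norm x) powr (- ((n - 1) / 2)) * exp (norm x))"
proof -
  have D: "DIM('a) \<ge> 1" by (simp add: DIM_positive Suc_leI)
  define \<alpha> where "\<alpha> = (n - 1) / 2"
  have a: "\<alpha> \<ge> 0" using D by (simp add: \<alpha>_def n_def)
  have n: "n \<ge> 1" using D by (simp add: n_def)
  define B where "B = n powr \<alpha> * (1 + 2 ^ DIM('a))"
  have B: "B > 0" unfolding B_def using n by (auto intro!: mult_pos_pos add_pos_pos)
  have shift: "1 \<le> (n + 1) powr \<alpha> * (n + r) powr (- \<alpha>) * s powr \<alpha>" if "n + r \<le> (n + 1) * s" "r \<ge> 0" "s > 0" for r s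
  proof -
    have "(n + r) powr \<alpha> \<le> ((n + 1) * s) powr \<alpha>" using that a n by (intro powr_mono2) auto
    also have "\<dots> = (n + 1) powr \<alpha> * s powr \<alpha>" using n that by (simp add: powr_mult)
    finally show ?thesis using n that by (simp add: powr_minus field_simps)
  qed
  have "spherical_exp x \<le> ((B + exp 1) * (n + 1) powr \<alpha>) * ((n + norm x) powr (- \<alpha>) * exp (norm x))" for x :: 'a
  proof (cases "norm x \<ge> 1")
    case True
    have "spherical_exp x \<le> B * (norm x powr (- \<alpha>) * exp (norm x))"
      using bessel_fun_le[OF D, of "norm x"] order.strict_trans2[OF zero_less_one True]
      by (simp add: spherical_exp_def B_def \<alpha>_def n_def dot_square_norm)
    also have "\<dots> = B * (norm x powr (- \<alpha>) * exp (norm x)) * 1" by simp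
    also have "\<dots> \<le> B * (norm x powr (- \<alpha>) * exp (norm x)) * ((n + 1) powr \<alpha> * (n + norm x) powr (- \<alpha>) * norm x powr \<alpha>)"
      using True n B by (intro mult_left_mono shift) (auto simp: algebra_simps mult_left_mono)
    also have "\<dots> = B * (n + 1) powr \<alpha> * ((n + norm x) powr (- \<alpha>) * exp (norm x))"
      using order.strict_trans2[OF zero_less_one True] by (simp add: powr_minus field_simps)
    also have "\<dots> \<le> (B + exp 1) * (n + 1) powr \<alpha> * ((n + norm x) powr (- \<alpha>) * exp (norm x))"
      by (intro mult_right_mono) auto
    finally show ?thesis .
  next
    case False
    have "spherical_exp x \<le> exp 1"
    proof -
      have "bessel_fun DIM('a) (x \<bullet> x) \<le> (\<Sum>k. inverse (fact k) * (x \<bullet> x) ^ k)"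
        unfolding bessel_fun_def using bessel_coeff_le_fact[OF D]
        by (intro suminf_le summable_bessel D summable_exp mult_right_mono) (auto simp: divide_inverse)
      also have "\<dots> = exp (x \<bullet> x)" by (simp add: exp_def)
      also have "\<dots> \<le> exp 1" using False power_le_one[of "norm x" 2] by (simp add: dot_square_norm)
      finally show ?thesis by (simp add: spherical_exp_def)
    qed
    also have "\<dots> = exp 1 * 1" by simp
    also have "\<dots> \<le> exp 1 * ((n + 1) powr \<alpha> * (n + norm x) powr (- \<alpha>) * 1 powr \<alpha>)"
      using False n by (intro mult_left_mono shift) auto
    also have "\<dots> = exp 1 * (n + 1) powr \<alpha> * ((n + norm x) powr (- \<alpha>) * 1)" by simp
    also have "\<dots> \<le> (B + exp 1) * (n + 1) powr \<alpha> * ((n + norm x) powr (- \<alpha>) * exp (norm x))"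
      using B by (intro mult_mono) auto
    finally show ?thesis .
  qed
  moreover have "(B + exp 1) * (n + 1) powr \<alpha> > 0"
    using B n by (intro mult_pos_pos add_pos_pos) auto
  ultimately show thesis using that unfolding \<alpha>_def by blast
qed


section \<open>Integrals of the weights over balls\<close>

lemma set_integrable_continuous_lebesgue:
  fixes f :: "'a::euclidean_space \<Rightarrow> real"
  assumes "continuous_on UNIV f" and "bounded S" and "S \<in> sets lebesgue"
  shows "set_integrable lebesgue S f"
proof -
  obtain B where "\<And>x. x \<in> S \<Longrightarrow> norm x \<le> B" using assms(2) unfolding bounded_iff by metis
  then have B: "S \<subseteq> cball 0 B" by auto
  have "continuous_on (cball 0 B) f" using assms(1) by (rule continuous_on_subset) simp
  from borel_integrable_compact[OF compact_cball this]
  have *: "integrable lborel (\<lambda>x. indicator (cball 0 B) x *\<^sub>R f x)" .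
  have "set_integrable lebesgue (cball 0 B) f"
    unfolding set_integrable_def using * integrable_completion[OF borel_measurable_integrable[OF *]] by simp
  then show ?thesis using assms(3) B by (rule set_integrable_subset)
qed

text \<open>Instead of polar coordinates, unit shells are peeled off the ball: a shell of outer
  radius \<open>\<rho>\<close> has volume at most \<open>\<omega> n \<rho>^(n-1)\<close>, and the
  bound for the remaining ball carries an extra factor \<open>exp (- \<delta>)\<close>.\<close>

lemma exp_norm_integral_cball_le:
  fixes \<delta> :: real
  assumes "\<delta> > 0"
  defines "n \<equiv> DIM('a::euclidean_space)"
  obtains C where "C > 0"
    and "\<And>\<rho>. \<rho> \<ge> 0 \<Longrightarrow> (LINT x:cball (0::'a) \<rho>|lebesgue. exp (\<delta> * norm x)) \<le> C * (exp (\<delta> * \<rho>) * (1 + \<rho>) ^ (n - 1))"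
proof -
  define I where "I \<rho> = (LINT x:cball (0::'a) \<rho>|lebesgue. exp (\<delta> * norm x))" for \<rho>
  define \<omega> where "\<omega> = unit_ball_vol n"
  have n: "n \<ge> 1" by (simp add: n_def DIM_positive Suc_leI)
  have om: "\<omega> > 0" by (simp add: \<omega>_def)
  have int: "set_integrable lebesgue S (\<lambda>x::'a. exp (\<delta> * norm x))"
    if "bounded S" "S \<in> sets lebesgue" for S
    using that by (intro set_integrable_continuous_lebesgue) (auto intro!: continuous_intros)
  have vol: "measure lborel (cball (0::'a) \<rho>) = \<omega> * \<rho> ^ n" if "\<rho> \<ge> 0" for \<rho>
    using content_cball[OF that, of "0::'a"] by (simp add: \<omega>_def n_def)
  have fin: "emeasure lebesgue S \<noteq> \<infinity>" if "bounded S" "S \<in> sets lebesgue" for S :: "'a set"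
    using bounded_set_imp_lmeasurable[OF that] by (auto simp: fmeasurable_def)
  \<comment> \<open>The first summand serves balls of radius below 1. The second comes from solving
    \<open>C * exp (- \<delta>) + \<omega> * n <= C\<close>, the condition under which the shell
    recursion closes.\<close>
  define C where "C = \<omega> * exp \<delta> + \<omega> * real n / (1 - exp (- \<delta>))"
  have e1: "1 - exp (- \<delta>) > 0" using assms by simp
  have C: "C \<ge> \<omega> * exp \<delta>" "C * exp (- \<delta>) + \<omega> * real n \<le> C"
  proof -
    show "C \<ge> \<omega> * exp \<delta>" using om e1 by (simp add: C_def)
    have "\<omega> * real n / (1 - exp (- \<delta>)) \<le> C" using om by (simp add: C_def)
    then have "\<omega> * real n \<le> C * (1 - exp (- \<delta>))" using e1 by (simp add: divide_le_eq)
    then show "C * exp (- \<delta>) + \<omega> * real n \<le> C" by (simp add: algebra_simps)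
  qed
  have shell: "(LINT x:S|lebesgue. exp (\<delta> * norm x)) \<le> measure lebesgue S * exp (\<delta> * \<rho>)"
    if "S \<subseteq> cball (0::'a) \<rho>" "S \<in> sets lebesgue" for S \<rho>
  proof -
    have b: "bounded S" using bounded_subset[OF bounded_cball that(1)] .
    have "(LINT x:S|lebesgue. exp (\<delta> * norm x)) \<le> (LINT x:S|lebesgue. exp (\<delta> * \<rho>))"
    proof (rule set_integral_mono)
      show "set_integrable lebesgue S (\<lambda>x. exp (\<delta> * \<rho>))"
        using b that by (intro set_integrable_continuous_lebesgue) auto
    qed (use int b that assms in auto)
    also have "\<dots> = measure lebesgue S * exp (\<delta> * \<rho>)"
      using set_integral_const[OF that(2) fin[OF b that(2)], of "exp (\<delta> * \<rho>)"] by simp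
    finally show ?thesis .
  qed
  \<comment> \<open>\<open>N\<close> bounds the number of shells and turns the recursion on the real
    radius into an induction.\<close>
  have main: "I \<rho> \<le> C * (exp (\<delta> * \<rho>) * (1 + \<rho>) ^ (n - 1))" if "0 \<le> \<rho>" "\<rho> < real N" for \<rho> N
    using that
  proof (induction N arbitrary: \<rho>)
    case (Suc N)
    show ?case
    proof (cases "\<rho> < 1")
      case True
      have "I \<rho> \<le> measure lebesgue (cball (0::'a) \<rho>) * exp (\<delta> * \<rho>)"
        unfolding I_def by (rule shell) auto
      also have "\<dots> \<le> \<omega> * exp \<delta>"
      proof -
        have "\<rho> ^ n \<le> 1" using True Suc.prems by (intro power_le_one) auto
        then have "\<omega> * \<rho> ^ n \<le> \<omega>" using om by simp
        moreover have "exp (\<delta> * \<rho>) \<le> exp \<delta>" using True assms by simp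
        ultimately show ?thesis using om Suc.prems by (simp add: vol mult_mono)
      qed
      also have "\<dots> \<le> C * 1" using C by simp
      also have "\<dots> \<le> C * (exp (\<delta> * \<rho>) * (1 + \<rho>) ^ (n - 1))"
      proof (rule mult_left_mono)
        have "1 * 1 \<le> exp (\<delta> * \<rho>) * (1 + \<rho>) ^ (n - 1)"
          using Suc.prems assms by (intro mult_mono one_le_power) auto
        then show "1 \<le> exp (\<delta> * \<rho>) * (1 + \<rho>) ^ (n - 1)" by simp
        show "0 \<le> C" using C om by (meson exp_ge_zero less_imp_le mult_nonneg_nonneg order.trans)
      qed
      finally show ?thesis .
    next
      case False
      let ?S = "cball (0::'a) \<rho> - cball 0 (\<rho> - 1)"
      have S: "?S \<in> sets lebesgue" "bounded ?S" by (auto intro: bounded_diff)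
      have U: "cball (0::'a) \<rho> = cball 0 (\<rho> - 1) \<union> ?S" by auto
      have "I \<rho> = I (\<rho> - 1) + (LINT x:?S|lebesgue. exp (\<delta> * norm x))"
        unfolding I_def by (subst U, rule set_integral_Un) (use S in \<open>auto intro!: int\<close>)
      also have "\<dots> \<le> C * (exp (\<delta> * (\<rho> - 1)) * (1 + (\<rho> - 1)) ^ (n - 1)) + measure lebesgue ?S * exp (\<delta> * \<rho>)"
        using Suc.prems False by (intro add_mono Suc.IH shell) auto
      also have "measure lebesgue ?S = \<omega> * \<rho> ^ n - \<omega> * (\<rho> - 1) ^ n"
        using False fin[of "cball 0 \<rho>"] by (subst measure_Diff) (auto simp: vol)
      also have "\<dots> \<le> \<omega> * real n * \<rho> ^ (n - 1)"
      proof -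
        have "\<rho> ^ n - (\<rho> - 1) ^ n = (\<Sum>i<n. (\<rho> - 1) ^ (n - Suc i) * \<rho> ^ i)"
          by (subst power_diff_sumr2) simp
        also have "\<dots> \<le> (\<Sum>i<n. \<rho> ^ (n - Suc i) * \<rho> ^ i)"
          using False by (intro sum_mono mult_right_mono power_mono) auto
        also have "\<dots> = (\<Sum>i<n. \<rho> ^ (n - 1))"
          by (intro sum.cong) (auto simp: power_add[symmetric])
        finally have "\<rho> ^ n - (\<rho> - 1) ^ n \<le> real n * \<rho> ^ (n - 1)" by simp
        from mult_left_mono[OF this, of \<omega>] om show ?thesis by (simp add: algebra_simps)
      qed
      also have "C * (exp (\<delta> * (\<rho> - 1)) * (1 + (\<rho> - 1)) ^ (n - 1)) + \<omega> * real n * \<rho> ^ (n - 1) * exp (\<delta> * \<rho>)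
          = (C * exp (- \<delta>) + \<omega> * real n) * (exp (\<delta> * \<rho>) * \<rho> ^ (n - 1))"
        by (simp add: algebra_simps exp_diff exp_minus divide_inverse)
      also have "\<dots> \<le> C * (exp (\<delta> * \<rho>) * \<rho> ^ (n - 1))"
        using False by (intro mult_right_mono C) auto
      also have "\<dots> \<le> C * (exp (\<delta> * \<rho>) * (1 + \<rho>) ^ (n - 1))"
      proof (intro mult_left_mono power_mono)
        show "0 \<le> C" using C om by (meson exp_ge_zero less_imp_le mult_nonneg_nonneg order.trans)
      qed (use False in auto)
      finally show ?thesis by simp
    qed
  qed simp
  show thesis
  proof (rule that)
    show "C > 0" using C(1) om by (meson exp_gt_zero mult_pos_pos order.strict_trans2)
    show "(LINT x:cball (0::'a) \<rho>|lebesgue. exp (\<delta> * norm x)) \<le> C * (exp (\<delta> * \<rho>) * (1 + \<rho>) ^ (n - 1))"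
      if "\<rho> \<ge> 0" for \<rho>
    proof -
      obtain N :: nat where "\<rho> < real N" using reals_Archimedean2 by blast
      from main[OF that this] show ?thesis by (simp add: I_def)
    qed
  qed
qed

lemma continuous_on_spherical_exp: "continuous_on UNIV (spherical_exp :: 'a::euclidean_space \<Rightarrow> real)"
  using ck_spherical_exp[of 0] by simp

text \<open>Half of the exponential growth is spent on making \<open>exp (r / 2) * (n + r) powr -\<alpha>\<close>
  increasing, so that the power weight can be evaluated at the boundary of the ball.\<close>
lemma spherical_exp_integral_le:
  fixes q :: real
  assumes q: "q > 0"
  defines "n \<equiv> real DIM('a::euclidean_space)"
  obtains C where "C > 0"
    and "\<And>\<rho>. \<rho> \<ge> 0 \<Longrightarrow> (LINT x:cball (0::'a) \<rho>|lebesgue. spherical_exp x powr q)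
           \<le> C * (exp (q * \<rho>) * (1 + \<rho>) powr (n - 1 - (n - 1) / 2 * q))"
proof -
  obtain A where A: "A > 0" "\<And>x::'a. spherical_exp x \<le> A * ((n + norm x) powr (- ((n - 1) / 2)) * exp (norm x))"
    using spherical_exp_le unfolding n_def by metis
  have q2: "q / 2 > 0" using q by simp
  obtain C where C: "C > 0" "\<And>\<rho>. \<rho> \<ge> 0 \<Longrightarrow> (LINT x:cball (0::'a) \<rho>|lebesgue. exp (q / 2 * norm x)) \<le> C * (exp (q / 2 * \<rho>) * (1 + \<rho>) ^ (DIM('a) - 1))"
    using exp_norm_integral_cball_le[OF q2] by metis
  define \<alpha> where "\<alpha> = (n - 1) / 2"
  have n: "n \<ge> 1" by (simp add: n_def DIM_positive Suc_leI)
  then have a: "\<alpha> \<ge> 0" by (simp add: \<alpha>_def)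
  \<comment> \<open>In logarithms the weight costs at most \<open>\<alpha> / n <= 1/2\<close> per
    unit of radius, which the factor \<open>exp (r / 2)\<close> pays for.\<close>
  have mono: "exp (r / 2) * (n + r) powr (- \<alpha>) \<le> exp (\<rho> / 2) * (n + \<rho>) powr (- \<alpha>)" if "0 \<le> r" "r \<le> \<rho>" for r \<rho>
  proof -
    have "ln ((n + \<rho>) / (n + r)) \<le> (n + \<rho>) / (n + r) - 1"
      using that n by (intro ln_le_minus_one) auto
    also have "\<dots> = (\<rho> - r) / (n + r)" using that n by (simp add: field_simps)
    also have "\<dots> \<le> (\<rho> - r) / n" using that n by (intro divide_left_mono) auto
    finally have "\<alpha> * ln ((n + \<rho>) / (n + r)) \<le> \<alpha> * ((\<rho> - r) / n)" using a by (rule mult_left_mono)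
    also have "\<dots> \<le> (\<rho> - r) / 2"
    proof -
      have "\<alpha> / n * (\<rho> - r) \<le> 1 / 2 * (\<rho> - r)"
        using that n by (intro mult_right_mono) (auto simp: \<alpha>_def field_simps)
      then show ?thesis by simp
    qed
    finally have "exp (r / 2 - \<alpha> * ln (n + r)) \<le> exp (\<rho> / 2 - \<alpha> * ln (n + \<rho>))"
      using that n by (simp add: ln_div algebra_simps)
    then show ?thesis using that n by (simp add: powr_def exp_add[symmetric])
  qed
  show thesis
  proof (rule that)
    show "A powr q * C > 0" using A C by simp
    fix \<rho> :: real assume rho: "\<rho> \<ge> 0"
    have "(LINT x:cball (0::'a) \<rho>|lebesgue. spherical_exp x powr q)
        \<le> (LINT x:cball (0::'a) \<rho>|lebesgue. A powr q * (exp (q / 2 * \<rho>) * (n + \<rho>) powr (- \<alpha> * q)) * exp (q / 2 * norm x))"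
    proof (rule set_integral_mono)
      show "set_integrable lebesgue (cball (0::'a) \<rho>) (\<lambda>x. spherical_exp x powr q)"
      proof (rule set_integrable_continuous_lebesgue)
        have "spherical_exp x \<noteq> 0" for x :: 'a using spherical_exp_ge_1[of x] by simp
        then show "continuous_on UNIV (\<lambda>x::'a. spherical_exp x powr q)"
          by (intro continuous_intros continuous_on_spherical_exp) auto
      qed auto
      show "set_integrable lebesgue (cball (0::'a) \<rho>) (\<lambda>x. A powr q * (exp (q / 2 * \<rho>) * (n + \<rho>) powr (- \<alpha> * q)) * exp (q / 2 * norm x))"
        by (intro set_integrable_continuous_lebesgue continuous_intros) auto
      fix x :: 'a assume x: "x \<in> cball 0 \<rho>"
      have "spherical_exp x \<le> A * ((n + norm x) powr (- \<alpha>) * exp (norm x))"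
        using A(2) by (simp add: \<alpha>_def)
      also have "\<dots> = A * (exp (norm x / 2) * (exp (norm x / 2) * (n + norm x) powr (- \<alpha>)))"
      proof -
        have "exp (norm x) = exp (norm x / 2) * exp (norm x / 2)" by (simp flip: exp_add)
        then show ?thesis by (simp only: mult_ac)
      qed
      also have "\<dots> \<le> A * (exp (norm x / 2) * (exp (\<rho> / 2) * (n + \<rho>) powr (- \<alpha>)))"
        using A(1) x by (intro mult_left_mono mono) auto
      finally have "spherical_exp x powr q \<le> (A * (exp (norm x / 2) * (exp (\<rho> / 2) * (n + \<rho>) powr (- \<alpha>)))) powr q"
        using spherical_exp_ge_1[of x] q by (intro powr_mono2) auto
      also have "\<dots> = A powr q * (exp (q / 2 * \<rho>) * (n + \<rho>) powr (- \<alpha> * q)) * exp (q / 2 * norm x)"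
      proof -
        have "exp (s / 2) powr q = exp (q / 2 * s)" for s
          by (simp add: exp_powr_real mult.commute)
        then show ?thesis by (simp only: powr_mult powr_powr mult_ac)
      qed
      finally show "spherical_exp x powr q \<le> A powr q * (exp (q / 2 * \<rho>) * (n + \<rho>) powr (- \<alpha> * q)) * exp (q / 2 * norm x)" .
    qed
    also have "\<dots> = A powr q * (exp (q / 2 * \<rho>) * (n + \<rho>) powr (- \<alpha> * q)) * (LINT x:cball (0::'a) \<rho>|lebesgue. exp (q / 2 * norm x))"
      by simp
    also have "\<dots> \<le> A powr q * (exp (q / 2 * \<rho>) * (1 + \<rho>) powr (- \<alpha> * q)) * (C * (exp (q / 2 * \<rho>) * (1 + \<rho>) ^ (DIM('a) - 1)))"
    proof (intro mult_mono C rho order.refl)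
      show "(n + \<rho>) powr (- \<alpha> * q) \<le> (1 + \<rho>) powr (- \<alpha> * q)"
        using n rho a q by (intro powr_mono2') auto
    qed (use C rho A in \<open>auto simp: set_lebesgue_integral_def intro!: integral_nonneg\<close>)
    also have "(1 + \<rho>) ^ (DIM('a) - 1) = (1 + \<rho>) powr (n - 1)"
      using rho by (subst powr_realpow[symmetric]) (auto simp: n_def of_nat_diff DIM_positive Suc_leI)
    also have "A powr q * (exp (q / 2 * \<rho>) * (1 + \<rho>) powr (- \<alpha> * q)) * (C * (exp (q / 2 * \<rho>) * (1 + \<rho>) powr (n - 1)))
       = A powr q * C * ((exp (q / 2 * \<rho>) * exp (q / 2 * \<rho>)) * ((1 + \<rho>) powr (n - 1) * (1 + \<rho>) powr (- \<alpha> * q)))"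
      by (simp only: mult_ac)
    also have "\<dots> = A powr q * C * (exp (q * \<rho>) * (1 + \<rho>) powr (n - 1 - (n - 1) / 2 * q))"
      by (simp add: exp_add[symmetric] powr_add[symmetric] \<alpha>_def)
    finally show "(LINT x:cball (0::'a) \<rho>|lebesgue. spherical_exp x powr q)
           \<le> A powr q * C * (exp (q * \<rho>) * (1 + \<rho>) powr (n - 1 - (n - 1) / 2 * q))" .
  qed
qed

section \<open>Iterated logarithms and the damping coefficient\<close>


lemma iter_ln_simps [simp]: "iter_ln 0 x = x" "iter_ln (Suc j) x = ln (iter_ln j x)"
  by (simp_all add: iter_ln_def)

lemma iter_exp_simps [simp]: "iter_exp 0 = 1" "iter_exp (Suc j) = exp (iter_exp j)"
  by (simp_all add: iter_exp_def)

lemma iter_exp_ge_1: "iter_exp k \<ge> 1"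
proof (induction k)
  case (Suc k)
  then show ?case using exp_ge_add_one_self[of "iter_exp k"] by simp
qed simp

lemma iter_ln_iter_exp: "j \<le> k \<Longrightarrow> iter_ln j (iter_exp k) = iter_exp (k - j)"
proof (induction j)
  case (Suc j)
  then have "k - j = Suc (k - Suc j)" by simp
  then show ?case using Suc by simp
qed simp

text \<open>Iterated logarithms are monotone only while all intermediate values stay positive; the
  threshold \<open>iter_exp k\<close> guarantees this for the first \<open>k\<close> of
  them.\<close>

lemma iter_ln_mono:
  assumes "j \<le> k" "iter_exp k \<le> x" "x \<le> y"
  shows "1 \<le> iter_ln j x" "iter_ln j x \<le> iter_ln j y"
proof -
  \<comment> \<open>The lower bound 1 is not inherited by a logarithm;
    \<open>iter_exp (k - j)\<close> is, because one logarithm lowers the tower by one level.\<close>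
  have "iter_exp (k - j) \<le> iter_ln j x \<and> iter_ln j x \<le> iter_ln j y"
    using assms(1)
  proof (induction j)
    case 0
    then show ?case using assms by simp
  next
    case (Suc j)
    then have IH: "iter_exp (k - j) \<le> iter_ln j x" "iter_ln j x \<le> iter_ln j y" by auto
    have kj: "k - j = Suc (k - Suc j)" using Suc by simp
    have pos: "0 < iter_ln j x" using IH(1) iter_exp_ge_1[of "k - j"] by linarith
    have "iter_exp (k - Suc j) = ln (iter_exp (k - j))" using kj by simp
    also have "\<dots> \<le> ln (iter_ln j x)"
      using IH(1) iter_exp_ge_1[of "k - j"] by (intro ln_mono) auto
    finally show ?case using IH pos by simp
  qed
  then show "1 \<le> iter_ln j x" "iter_ln j x \<le> iter_ln j y"
    using iter_exp_ge_1[of "k - j"] by linarith+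
qed

lemma iter_ln_pos: "j \<le> k \<Longrightarrow> iter_exp k \<le> x \<Longrightarrow> 0 < iter_ln j x"
  using iter_ln_mono(1)[of j k x x] by simp

text \<open>A logarithm turns the factor 2 into the summand \<open>ln 2 < 1\<close>, which is
  absorbed because every iterate is at least 1. This is the source of the slow variation of
  \<open>growth\<close>.\<close>

lemma iter_ln_double:
  assumes "j \<le> k" "iter_exp k \<le> x"
  shows "iter_ln j (2 * x) \<le> 2 * iter_ln j x"
  using assms(1)
proof (induction j)
  case (Suc j)
  have pos: "0 < iter_ln j x" using iter_ln_pos[of j k x] Suc assms by simp
  have "0 < iter_ln j (2 * x)"
    using iter_ln_pos[of j k "2 * x"] Suc assms iter_exp_ge_1[of k] by simp
  then have "ln (iter_ln j (2 * x)) \<le> ln (2 * iter_ln j x)"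
    using Suc pos by simp
  also have "\<dots> = ln 2 + ln (iter_ln j x)" using pos by (simp add: ln_mult)
  also have "\<dots> \<le> 2 * ln (iter_ln j x)"
    using iter_ln_mono(1)[of "Suc j" k x x] Suc assms ln_2_less_1 by simp
  finally show ?case by simp
qed simp

lemma iter_ln_le_ln:
  assumes "1 \<le> j" "j \<le> k" "iter_exp k \<le> x"
  shows "iter_ln j x \<le> ln x"
  using assms(1,2)
proof (induction j rule: dec_induct)
  case (step j)
  have "0 < iter_ln j x" using iter_ln_pos[of j k x] step assms by simp
  then have "ln (iter_ln j x) \<le> iter_ln j x" using ln_le_minus_one[of "iter_ln j x"] by simp
  then show ?case using step by simp
qed simp

lemma DERIV_iter_ln:
  assumes "j \<le> k" "iter_exp k \<le> x"
  shows "(iter_ln j has_real_derivative inverse (\<Prod>i<j. iter_ln i x)) (at x)"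
  using assms(1)
proof (induction j)
  case 0
  have "iter_ln 0 = (\<lambda>x. x)" by (rule ext) simp
  then show ?case by simp
next
  case (Suc j)
  have pos: "0 < iter_ln j x" using iter_ln_pos[of j k x] Suc assms by simp
  have "((\<lambda>y. ln (iter_ln j y)) has_real_derivative inverse (iter_ln j x) * inverse (\<Prod>i<j. iter_ln i x)) (at x)"
    by (rule DERIV_chain2[OF DERIV_ln[OF pos] Suc.IH]) (use Suc in simp)
  moreover have "iter_ln (Suc j) = (\<lambda>y. ln (iter_ln j y))" by (rule ext) simp
  ultimately show ?case by (simp add: mult.commute)
qed

text \<open>\<open>growth \<mu> k t\<close> is \<open>exp\<close> of the integral of the damping coefficient over \<open>[0, t]\<close>.\<close>
definition growth :: "real \<Rightarrow> nat \<Rightarrow> real \<Rightarrow> real"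
  where "growth \<mu> k t = iter_ln k (iter_exp k + t) powr \<mu>"

text \<open>The factor \<open>iter_exp k + t\<close> is the iterate of index 0. In this form the
  damping is \<open>\<mu>\<close> times the derivative of the next iterated logarithm, which is why
  \<open>growth\<close> is a power of \<open>iter_ln k\<close>.\<close>

lemma damping_eq: "damping \<mu> k t = \<mu> / (\<Prod>i<Suc k. iter_ln i (iter_exp k + t))"
  using prod.atLeast1_atMost_eq[of "\<lambda>j. iter_ln j (iter_exp k + t)" k]
  by (simp only: damping_def prod.lessThan_Suc_shift iter_ln_simps(1) o_def One_nat_def)

lemma damping_nonneg:
  assumes "\<mu> > 0" "t \<ge> 0"
  shows "damping \<mu> k t \<ge> 0"
  unfolding damping_eq using assms iter_ln_pos[of _ k "iter_exp k + t"]
  by (intro divide_nonneg_nonneg prod_nonneg) (auto intro: less_imp_le)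

lemma DERIV_growth:
  assumes "t \<ge> 0"
  shows "(growth \<mu> k has_real_derivative damping \<mu> k t * growth \<mu> k t) (at t)"
proof -
  let ?L = "iter_ln k (iter_exp k + t)"
  have L: "?L > 0" using iter_ln_pos[of k k] assms by simp
  have "((\<lambda>t. iter_ln k (iter_exp k + t)) has_real_derivative inverse (\<Prod>i<k. iter_ln i (iter_exp k + t)) * 1) (at t)"
    by (rule DERIV_chain2[OF DERIV_iter_ln]) (use assms in \<open>auto intro!: derivative_eq_intros\<close>)
  from DERIV_fun_powr[OF this L, of \<mu>]
  have "((\<lambda>t. iter_ln k (iter_exp k + t) powr \<mu>) has_real_derivative
      \<mu> * ?L powr (\<mu> - 1) * (inverse (\<Prod>i<k. iter_ln i (iter_exp k + t)) * 1)) (at t)"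
    by simp
  moreover have "?L powr (\<mu> - 1) = ?L powr \<mu> / ?L"
    using L by (simp add: powr_diff)
  ultimately show ?thesis
    by (simp add: growth_def[abs_def] damping_eq divide_inverse mult_ac)
qed

lemma continuous_on_damping: "continuous_on {0..} (damping \<mu> k)"
proof -
  have c: "continuous_on {0..} (\<lambda>t. iter_ln j (iter_exp k + t))" if "j \<le> k" for j
  proof -
    have "continuous_on {iter_exp k..} (iter_ln j)"
      by (rule DERIV_continuous_on[OF has_field_derivative_at_within[OF DERIV_iter_ln[OF that]]]) simp
    then show ?thesis
      by (rule continuous_on_compose2) (auto intro!: continuous_intros)
  qed
  have "(\<Prod>i<Suc k. iter_ln i (iter_exp k + t)) \<noteq> 0" if "t \<in> {0..}" for t
  proof -
    have "iter_ln i (iter_exp k + t) \<noteq> 0" if "i < Suc k" for i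
      using iter_ln_pos[of i k "iter_exp k + t"] that \<open>t \<in> {0..}\<close> by simp
    then show ?thesis by simp
  qed
  then show ?thesis unfolding damping_eq[abs_def]
    by (intro continuous_on_divide continuous_on_prod continuous_on_const) (auto intro: c)
qed

lemma growth_0: "growth \<mu> k 0 = 1"
  using iter_ln_iter_exp[of k k] by (simp add: growth_def)

lemma growth_mono: "\<mu> > 0 \<Longrightarrow> 0 \<le> s \<Longrightarrow> s \<le> t \<Longrightarrow> growth \<mu> k s \<le> growth \<mu> k t"
  using iter_ln_mono[of k k "iter_exp k + s" "iter_exp k + t"]
  by (simp add: growth_def powr_mono2)

lemma growth_ge_1: "\<mu> > 0 \<Longrightarrow> 0 \<le> t \<Longrightarrow> growth \<mu> k t \<ge> 1"
  using growth_mono[of \<mu> 0 t k] by (simp add: growth_0)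

lemma growth_double:
  assumes "\<mu> > 0" "0 \<le> t"
  shows "growth \<mu> k (2 * t) \<le> 2 powr \<mu> * growth \<mu> k t"
proof -
  have "iter_ln k (iter_exp k + 2 * t) \<le> iter_ln k (2 * (iter_exp k + t))"
    using assms iter_exp_ge_1[of k] by (intro iter_ln_mono(2)[of k k]) auto
  also have "\<dots> \<le> 2 * iter_ln k (iter_exp k + t)"
    using assms by (intro iter_ln_double[of k k]) auto
  finally have "iter_ln k (iter_exp k + 2 * t) powr \<mu> \<le> (2 * iter_ln k (iter_exp k + t)) powr \<mu>"
    using assms iter_ln_pos[of k k "iter_exp k + 2 * t"] by (intro powr_mono2) auto
  then show ?thesis using iter_ln_pos[of k k "iter_exp k + t"] assms
    by (simp add: growth_def powr_mult)
qed

section \<open>Integral inequalities\<close>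


lemma integral_has_real_derivative_open:
  fixes f :: "real \<Rightarrow> real"
  assumes "continuous_on {a..b} f" "a < x" "x < b"
  shows "((\<lambda>t. integral {a..t} f) has_real_derivative f x) (at x)"
  using integral_has_real_derivative[OF assms(1), of x] assms(2,3)
  by (simp add: at_within_Icc_at)

lemma continuous_on_integral_upper:
  fixes f :: "real \<Rightarrow> real"
  assumes "continuous_on {a..b} f"
  shows "continuous_on {a..b} (\<lambda>t. integral {a..t} f)"
  using integral_has_real_derivative[OF assms] by (intro DERIV_continuous_on)

text \<open>The integrating factor \<open>m\<close> is applied without assuming that \<open>D\<close> is differentiable: on \<open>[0, t]\<close>
  the monotone remainder \<open>D\<close> is bounded by its final value, which produces the right sign.\<close>
lemma integrating_factor_le:
  fixes m b G S D :: "real \<Rightarrow> real"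
  assumes b: "continuous_on {0..T} b" "\<And>t. t \<in> {0..T} \<Longrightarrow> b t \<ge> 0"
    and m: "\<And>t. t \<in> {0..T} \<Longrightarrow> (m has_real_derivative b t * m t) (at t)"
      "\<And>t. t \<in> {0..T} \<Longrightarrow> m t > 0" "m 0 = 1"
    and G: "continuous_on {0..T} G" and S: "continuous_on {0..T} S"
    and D: "\<And>s t. 0 \<le> s \<Longrightarrow> s \<le> t \<Longrightarrow> t \<le> T \<Longrightarrow> D s \<le> D t" "D 0 \<ge> 0"
    and eq: "\<And>t. t \<in> {0<..T} \<Longrightarrow> G t + integral {0..t} (\<lambda>s. b s * G s) = G0 + integral {0..t} S + D t"
    and t: "t \<in> {0<..T}"
  shows "G0 + integral {0..t} (\<lambda>s. m s * S s) \<le> m t * G t"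
proof -
  have cm: "continuous_on {0..T} m"
    by (rule DERIV_continuous_on[OF has_field_derivative_at_within[OF m(1)]])
  have cbG: "continuous_on {0..T} (\<lambda>s. b s * G s)" and cmS: "continuous_on {0..T} (\<lambda>s. m s * S s)"
    by (intro continuous_intros b G S cm)+
  define B where "B t = integral {0..t} (\<lambda>s. b s * G s)" for t
  define H where "H t = G0 + integral {0..t} S" for t
  define Q where "Q s = m s * (B s - H s - D t) + integral {0..s} (\<lambda>s. m s * S s)" for s
  have eqs: "G s = H s + D s - B s" if "s \<in> {0<..T}" for s
    using eq[OF that] by (simp add: B_def H_def)
  have "Q t \<le> Q 0"
  proof (rule DERIV_nonpos_imp_decreasing_open[where f = Q])
    show "0 \<le> t" using t by simp
    have "continuous_on {0..T} Q" unfolding Q_def B_def H_def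
      by (intro continuous_intros continuous_on_integral_upper cbG cmS S cm)
    then show "continuous_on {0..t} Q" by (rule continuous_on_subset) (use t in auto)
    fix s assume s: "0 < s" "s < t"
    then have sT: "s < T" "s \<in> {0..T}" "s \<in> {0<..T}" using t by auto
    have "(Q has_real_derivative (b s * m s * (B s - H s - D t) + m s * (b s * G s - S s) + m s * S s)) (at s)"
      unfolding Q_def B_def H_def
      by (auto intro!: derivative_eq_intros m(1)[OF sT(2)] integral_has_real_derivative_open[OF cbG s(1) sT(1)]
          integral_has_real_derivative_open[OF cmS s(1) sT(1)] integral_has_real_derivative_open[OF S s(1) sT(1)])
    \<comment> \<open>Substituting the equation for \<open>G s\<close> cancels everything except the
      difference between \<open>D s\<close> and its frozen value \<open>D t\<close>.\<close>
    also have "b s * m s * (B s - H s - D t) + m s * (b s * G s - S s) + m s * S s = b s * m s * (D s - D t)"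
      unfolding eqs[OF sT(3)] by (simp add: algebra_simps)
    finally have "(Q has_real_derivative b s * m s * (D s - D t)) (at s)" .
    moreover have "b s * m s * (D s - D t) \<le> 0"
      using b(2)[OF sT(2)] m(2)[OF sT(2)] D(1)[of s t] s t by (intro mult_nonneg_nonpos) auto
    ultimately show "\<exists>y. (Q has_real_derivative y) (at s) \<and> y \<le> 0" by blast
  qed
  moreover have "Q 0 \<le> - G0" using m(3) D(1)[of 0 t] D(2) t by (simp add: Q_def B_def H_def)
  moreover have "Q t = - (m t * G t) + integral {0..t} (\<lambda>s. m s * S s)"
    unfolding Q_def eqs[OF t] by (simp add: algebra_simps)
  ultimately show ?thesis by simp
qed

lemma DERIV_nonneg_imp_le:
  fixes f :: "real \<Rightarrow> real"
  assumes "a \<le> b" "continuous_on {a..b} f"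
    and "\<And>x. a < x \<Longrightarrow> x < b \<Longrightarrow> (f has_real_derivative f' x) (at x)"
    and "\<And>x. a < x \<Longrightarrow> x < b \<Longrightarrow> f' x \<ge> 0"
  shows "f a \<le> f b"
  by (rule DERIV_nonneg_imp_increasing_open) (use assms in blast)+

text \<open>Let \<open>P = m F + K\<close> with \<open>K\<close> the integral of \<open>m F\<close>.
  Once \<open>F\<close> is known to be positive, \<open>P' >= P\<close>, so
  \<open>P >= F 0 * exp\<close>. Since \<open>F' + F >= P / m\<close>, a second integration gives
  the bound; the factor 1/2 is that of the primitive of \<open>exp (2 s)\<close>.\<close>

lemma exponential_growth:
  fixes m b F G :: "real \<Rightarrow> real"
  assumes b: "\<And>t. t \<in> {0..T} \<Longrightarrow> b t \<ge> 0"
    and m: "\<And>t. t \<in> {0..T} \<Longrightarrow> (m has_real_derivative b t * m t) (at t)"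
      "\<And>t. t \<in> {0..T} \<Longrightarrow> m t \<ge> 1" "m 0 = 1"
      "\<And>s t. 0 \<le> s \<Longrightarrow> s \<le> t \<Longrightarrow> t \<le> T \<Longrightarrow> m s \<le> m t"
    and F: "continuous_on {0..T} F" "\<And>t. t \<in> {0<..<T} \<Longrightarrow> (F has_real_derivative G t) (at t)" "F 0 > 0"
    and G: "\<And>t. t \<in> {0<..T} \<Longrightarrow> integral {0..t} (\<lambda>s. m s * F s) \<le> m t * G t"
    and t: "t \<in> {0..T}"
  shows "F 0 * exp t / (2 * m t) \<le> F t"
proof -
  have cm: "continuous_on {0..T} m"
    by (rule DERIV_continuous_on[OF has_field_derivative_at_within[OF m(1)]])
  have cmF: "continuous_on {0..T} (\<lambda>s. m s * F s)"
    by (intro continuous_intros F cm)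
  define K where "K t = integral {0..t} (\<lambda>s. m s * F s)" for t
  \<comment> \<open>Before the first time \<open>z\<close> with \<open>F z <= 0\<close> the integral
    of \<open>m F\<close> is nonnegative, hence so is \<open>G\<close>, and \<open>F\<close> cannot
    fall below \<open>F 0 > 0\<close>.\<close>
  have pos: "F s > 0" if "s \<in> {0..T}" for s
  proof (rule ccontr)
    assume "\<not> F s > 0"
    define Z where "Z = {0..T} \<inter> F -` {..0}"
    have "s \<in> Z" using that \<open>\<not> F s > 0\<close> by (simp add: Z_def)
    moreover have "compact Z" unfolding compact_eq_bounded_closed Z_def
      using continuous_closed_preimage[OF F(1), of "{..0}"] by (auto intro: bounded_Int)
    ultimately obtain z where z: "z \<in> Z" "\<And>y. y \<in> Z \<Longrightarrow> z \<le> y"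
      using compact_attains_inf[of Z] by auto
    have zT: "0 \<le> z" "z \<le> T" "F z \<le> 0" using z(1) by (auto simp: Z_def)
    have Fpos: "F y > 0" if "0 \<le> y" "y < z" for y
      using z(2)[of y] that zT by (force simp: Z_def)
    have "F 0 \<le> F z"
    proof (rule DERIV_nonneg_imp_le[OF zT(1), where f = F])
      show "continuous_on {0..z} F" by (rule continuous_on_subset[OF F(1)]) (use zT in auto)
      fix x assume x: "0 < x" "x < z"
      then show "(F has_real_derivative G x) (at x)" using F(2)[of x] zT by simp
      have "0 \<le> integral {0..x} (\<lambda>s. m s * F s)"
      proof (rule integral_nonneg)
        show "(\<lambda>s. m s * F s) integrable_on {0..x}"
          by (rule integrable_continuous_real, rule continuous_on_subset[OF cmF]) (use x zT in auto)
        show "0 \<le> m s * F s" if "s \<in> {0..x}" for s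
          using that x zT Fpos[of s] m(2)[of s] by (intro mult_nonneg_nonneg) auto
      qed
      then have "0 \<le> m x * G x" using G[of x] x zT by simp
      then show "G x \<ge> 0" using m(2)[of x] x zT by (simp add: zero_le_mult_iff)
    qed
    then show False using F(3) zT by simp
  qed
  define P where "P t = m t * F t + K t" for t
  have cP: "continuous_on {0..T} P" unfolding P_def K_def
    by (intro continuous_intros cm F continuous_on_integral_upper cmF)
  have P: "exp s * F 0 \<le> P s" if "s \<in> {0..T}" for s
  proof -
    have "exp (- 0) * P 0 \<le> exp (- s) * P s"
    proof (rule DERIV_nonneg_imp_le[where f = "\<lambda>s. exp (- s) * P s"])
      show "continuous_on {0..s} (\<lambda>s. exp (- s) * P s)"
        by (intro continuous_intros continuous_on_subset[OF cP]) (use that in auto)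
      fix x assume x: "0 < x" "x < s"
      then have xT: "x < T" "x \<in> {0..T}" "x \<in> {0<..T}" "x \<in> {0<..<T}" using that by auto
      have "(K has_real_derivative m x * F x) (at x)"
        unfolding K_def by (rule integral_has_real_derivative_open[OF cmF x(1) xT(1)])
      then show "((\<lambda>s. exp (- s) * P s) has_real_derivative
          (exp (- x) * (b x * m x * F x + (m x * G x - K x)))) (at x)"
        unfolding P_def
        by (auto intro!: derivative_eq_intros m(1)[OF xT(2)] F(2)[OF xT(4)] simp: algebra_simps)
      show "0 \<le> exp (- x) * (b x * m x * F x + (m x * G x - K x))"
        using G[OF xT(3)] b[OF xT(2)] m(2)[OF xT(2)] pos[OF xT(2)]
        by (intro mult_nonneg_nonneg add_nonneg_nonneg) (auto simp: K_def)
    qed (use that in auto)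
    then show ?thesis using m(3) by (simp add: P_def K_def exp_minus field_simps)
  qed
  have mt: "m t \<ge> 1" using m(2) t by simp
  \<comment> \<open>The factor \<open>m x\<close> is replaced by the larger \<open>m t\<close>, so
    that the lower bound for the derivative integrates explicitly to a multiple of
    \<open>exp (2 * s)\<close>.\<close>
  have "exp 0 * F 0 - exp (2 * 0) * F 0 / (2 * m t) \<le> exp t * F t - exp (2 * t) * F 0 / (2 * m t)"
  proof (rule DERIV_nonneg_imp_le[where f = "\<lambda>s. exp s * F s - exp (2 * s) * F 0 / (2 * m t)"])
    show "continuous_on {0..t} (\<lambda>s. exp s * F s - exp (2 * s) * F 0 / (2 * m t))"
      by (intro continuous_intros continuous_on_subset[OF F(1)]) (use t mt in auto)
    fix x assume x: "0 < x" "x < t"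
    then have xT: "x < T" "x \<in> {0..T}" "x \<in> {0<..T}" "x \<in> {0<..<T}" using t by auto
    show "((\<lambda>s. exp s * F s - exp (2 * s) * F 0 / (2 * m t)) has_real_derivative
       (exp x * (F x + G x) - exp (2 * x) * F 0 / m t)) (at x)"
      using mt by (auto intro!: derivative_eq_intros F(2)[OF xT(4)] simp: field_simps)
    have mx: "m x \<ge> 1" "m x \<le> m t" using m(2)[OF xT(2)] m(4)[of x t] x t by auto
    have "exp (2 * x) * F 0 / m t \<le> exp (2 * x) * F 0 / m x"
      using mx mt F(3) by (intro divide_left_mono) auto
    also have "\<dots> = exp x * ((exp x * F 0) / m x)" by (simp add: exp_add[symmetric])
    also have "\<dots> \<le> exp x * (P x / m x)"
      using P[OF xT(2)] mx by (intro mult_left_mono divide_right_mono) auto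
    also have "P x / m x = F x + K x / m x" using mx by (simp add: P_def field_simps)
    also have "\<dots> \<le> F x + G x"
      using G[OF xT(3)] mx by (simp add: K_def divide_le_eq mult.commute)
    finally show "0 \<le> exp x * (F x + G x) - exp (2 * x) * F 0 / m t" by simp
  qed (use t in auto)
  then have "exp t * (F 0 * exp t / (2 * m t)) + F 0 * (1 - 1 / (2 * m t)) \<le> exp t * F t"
    by (simp add: algebra_simps exp_add[symmetric])
  moreover have "1 / (2 * m t) \<le> 1" using mt by simp
  then have "0 \<le> F 0 * (1 - 1 / (2 * m t))" using F(3) by simp
  ultimately have "exp t * (F 0 * exp t / (2 * m t)) \<le> exp t * F t" by linarith
  then show ?thesis by (rule mult_left_le_imp_le) simp
qed

lemma quadratic_lower_bound:
  fixes U V :: "real \<Rightarrow> real"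
  assumes "a \<le> b" "continuous_on {a..b} U"
    and "\<And>x. a < x \<Longrightarrow> x < b \<Longrightarrow> (U has_real_derivative V x) (at x)"
    and "\<And>x. a < x \<Longrightarrow> x < b \<Longrightarrow> c * (x - a) \<le> V x"
  shows "U a + c * (b - a)\<^sup>2 / 2 \<le> U b"
proof -
  have "U a - c * (a - a)\<^sup>2 / 2 \<le> U b - c * (b - a)\<^sup>2 / 2"
    by (rule DERIV_nonneg_imp_le[where f' = "\<lambda>x. V x - c * (x - a)"])
       (use assms in \<open>auto intro!: continuous_intros derivative_eq_intros\<close>)
  then show ?thesis by simp
qed

text \<open>The doubling times of \<open>U\<close> decay geometrically with ratio \<open>2 powr -((p - 1) / 2)\<close>.\<close>
lemma doubling_blowup:
  fixes U V :: "real \<Rightarrow> real"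
  assumes p: "p > 1" and A: "A > 0" and M0: "M0 > 0" and T: "t0 \<le> T"
    and U: "continuous_on {t0..T} U" "\<And>t. t \<in> {t0<..<T} \<Longrightarrow> (U has_real_derivative V t) (at t)" "M0 \<le> U t0"
    and V: "\<And>t. t \<in> {t0<..<T} \<Longrightarrow> A * integral {t0..t} (\<lambda>s. \<bar>U s\<bar> powr p) \<le> V t"
  shows "(T - t0)\<^sup>2 * A * M0 powr (p - 1) \<le> 2 / (1 - 2 powr (- (p - 1) / 2))\<^sup>2"
proof -
  define q where "q = 2 powr (- (p - 1) / 2)"
  have q: "0 < q" "q < 1" using p by (auto simp: q_def intro: powr_less_one)
  \<comment> \<open>At level \<open>M0\<close> the slope of \<open>U\<close> is at least
    \<open>A * M0 powr p * (x - t0)\<close>; \<open>\<tau>\<close> solves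
    \<open>A * M0 powr p * \<tau>^2 / 2 = M0\<close>, so it suffices for one doubling.\<close>
  define \<tau> where "\<tau> = sqrt (2 / (A * M0 powr (p - 1)))"
  have AM: "A * M0 powr (p - 1) > 0" using A M0 by simp
  then have tau: "\<tau> > 0" "\<tau>\<^sup>2 = 2 / (A * M0 powr (p - 1))" by (auto simp: \<tau>_def)
  have cUp: "continuous_on {t0..T} (\<lambda>s. \<bar>U s\<bar> powr p)"
    using p by (intro continuous_on_powr' continuous_intros U) auto
  have int: "(\<lambda>s. \<bar>U s\<bar> powr p) integrable_on {x..y}" if "t0 \<le> x" "y \<le> T" for x y
    by (rule integrable_continuous_real, rule continuous_on_subset[OF cUp]) (use that in auto)
  have Vge: "A * integral {x..t} (\<lambda>s. \<bar>U s\<bar> powr p) \<le> V t" if "t0 \<le> x" "x \<le> t" "t0 < t" "t < T" for x t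
  proof -
    have "integral {x..t} (\<lambda>s. \<bar>U s\<bar> powr p) \<le> integral {t0..t} (\<lambda>s. \<bar>U s\<bar> powr p)"
      by (rule integral_subset_le) (use that int in auto)
    then have "A * integral {x..t} (\<lambda>s. \<bar>U s\<bar> powr p) \<le> A * integral {t0..t} (\<lambda>s. \<bar>U s\<bar> powr p)"
      using A by (intro mult_left_mono) auto
    also have "\<dots> \<le> V t" using V[of t] that by simp
    finally show ?thesis .
  qed
  have mono: "U x \<le> U y" if "t0 \<le> x" "x \<le> y" "y \<le> T" for x y
  proof (rule DERIV_nonneg_imp_le[OF that(2), where f = U])
    show "continuous_on {x..y} U" by (rule continuous_on_subset[OF U(1)]) (use that in auto)
    fix t assume t: "x < t" "t < y"
    then show "(U has_real_derivative V t) (at t)" using U(2) that by simp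
    have "0 \<le> A * integral {t..t} (\<lambda>s. \<bar>U s\<bar> powr p)" by simp
    also have "\<dots> \<le> V t" using Vge[of t t] t that by simp
    finally show "0 \<le> V t" .
  qed
  \<comment> \<open>\<open>S j\<close> is a time by which the level \<open>2 ^ j * M0\<close> is
    reached. Replacing \<open>M0\<close> by this level in \<open>\<tau>\<close> multiplies it by
    \<open>q ^ j\<close>.\<close>
  define S where "S j = t0 + \<tau> * (\<Sum>i<j. q ^ i)" for j
  have S_le: "S j \<le> t0 + \<tau> / (1 - q)" and S_ge: "t0 \<le> S j" for j
  proof -
    have "(\<Sum>i<j. q ^ i) = (1 - q ^ j) / (1 - q)" using q by (subst sum_gp_strict) auto
    also have "\<dots> \<le> 1 / (1 - q)" using q by (intro divide_right_mono) auto
    finally have "\<tau> * (\<Sum>i<j. q ^ i) \<le> \<tau> * (1 / (1 - q))" using tau by (intro mult_left_mono) auto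
    then show "S j \<le> t0 + \<tau> / (1 - q)" by (simp add: S_def)
    show "t0 \<le> S j" using tau q by (auto simp: S_def intro!: mult_nonneg_nonneg sum_nonneg)
  qed
  \<comment> \<open>If \<open>T\<close> lay beyond the limit of the doubling times, all of them
    would fit into \<open>[t0, T]\<close>, and \<open>U T\<close> would be at least every
    \<open>2 ^ j * M0\<close>.\<close>
  have "T - t0 \<le> \<tau> / (1 - q)"
  proof (rule ccontr)
    assume "\<not> T - t0 \<le> \<tau> / (1 - q)"
    then have ST: "S j \<le> T" for j using S_le[of j] by linarith
    have dbl: "2 ^ j * M0 \<le> U (S j)" for j
    proof (induction j)
      case 0
      then show ?case using U(3) by (simp add: S_def)
    next
      case (Suc j)
      let ?M = "2 ^ j * M0"
      have M: "?M > 0" using M0 by simp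
      have SS: "S (Suc j) - S j = \<tau> * q ^ j" by (simp add: S_def algebra_simps)
      then have le: "S j \<le> S (Suc j)" using tau q by (smt (verit) mult_pos_pos zero_less_power)
      have "U (S j) + A * ?M powr p * (S (Suc j) - S j)\<^sup>2 / 2 \<le> U (S (Suc j))"
      proof (rule quadratic_lower_bound[OF le])
        show "continuous_on {S j..S (Suc j)} U"
          by (rule continuous_on_subset[OF U(1)]) (use S_ge ST in auto)
        fix x assume x: "S j < x" "x < S (Suc j)"
        then have xT: "t0 < x" "x < T" using S_ge[of j] ST[of "Suc j"] by auto
        then show "(U has_real_derivative V x) (at x)" using U(2) by simp
        have "A * (?M powr p * (x - S j)) = A * integral {S j..x} (\<lambda>s. ?M powr p)" using x by simp
        also have "\<dots> \<le> A * integral {S j..x} (\<lambda>s. \<bar>U s\<bar> powr p)"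
        proof (intro mult_left_mono integral_le int)
          fix s assume s: "s \<in> {S j..x}"
          have "?M \<le> U (S j)" by (rule Suc)
          also have "\<dots> \<le> U s" using s xT S_ge[of j] by (intro mono) auto
          finally show "?M powr p \<le> \<bar>U s\<bar> powr p" using M p by (intro powr_mono2) auto
        qed (use xT S_ge A in auto)
        also have "\<dots> \<le> V x" using Vge[of "S j" x] S_ge xT x by auto
        finally show "A * ?M powr p * (x - S j) \<le> V x" by (simp only: mult.assoc)
      qed
      moreover have "A * ?M powr p * (S (Suc j) - S j)\<^sup>2 / 2 = ?M"
      proof -
        have q2: "(q ^ j)\<^sup>2 = (2 ^ j) powr (- (p - 1))"
          by (simp add: q_def powr_realpow[symmetric] powr_powr power2_eq_square powr_add[symmetric] mult.commute)
        have "?M powr p = ?M * ?M powr (p - 1)" using M by (simp add: powr_diff)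
        also have "?M powr (p - 1) = (2 ^ j) powr (p - 1) * M0 powr (p - 1)" using M0 by (simp add: powr_mult)
        finally have Mp: "?M powr p = ?M * ((2 ^ j) powr (p - 1) * M0 powr (p - 1))" .
        have one: "(2 ^ j) powr (p - 1) * (2 ^ j) powr (- (p - 1)) = (1::real)"
          by (simp flip: powr_add)
        have "A * ?M powr p * (S (Suc j) - S j)\<^sup>2 / 2 =
            ?M * ((2 ^ j) powr (p - 1) * (2 ^ j) powr (- (p - 1))) * (A * M0 powr (p - 1) * \<tau>\<^sup>2 / 2)"
          unfolding SS power_mult_distrib q2 Mp by (simp only: mult_ac times_divide_eq_right times_divide_eq_left)
        also have "A * M0 powr (p - 1) * \<tau>\<^sup>2 / 2 = 1" unfolding tau(2) using AM by auto
        finally show ?thesis by (simp only: one mult_1_right)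
      qed
      ultimately show ?case using Suc by simp
    qed
    have "2 ^ j * M0 \<le> U T" for j using dbl[of j] mono[OF S_ge[of j] ST[of j]] by simp
    moreover obtain j where "U T / M0 < 2 ^ j" using real_arch_pow[of 2 "U T / M0"] by auto
    ultimately show False using M0 by (metis divide_less_eq linorder_not_less)
  qed
  then have "(T - t0)\<^sup>2 \<le> (\<tau> / (1 - q))\<^sup>2" using T by (intro power_mono) auto
  also have "\<dots> = 2 / (A * M0 powr (p - 1)) / (1 - q)\<^sup>2" using tau by (simp add: power_divide)
  finally have "(T - t0)\<^sup>2 * (A * M0 powr (p - 1)) \<le> 2 / (A * M0 powr (p - 1)) / (1 - q)\<^sup>2 * (A * M0 powr (p - 1))"
    using AM by (intro mult_right_mono) auto
  also have "\<dots> = 2 / (1 - q)\<^sup>2" using A M0 by simp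
  finally show ?thesis by (simp add: q_def mult.assoc)
qed

text \<open>On \<open>[t/2, t]\<close> the source is bounded below by its value at \<open>t\<close>,
  up to \<open>2 powr (- \<bar>\<theta>\<bar>)\<close>, and integrated twice; the constant 1/8 is
  \<open>(1/2)^2 / 2\<close>. The powers of \<open>m\<close> cost nothing extra:
  \<open>m powr (1 - p)\<close> decreases, and dividing by \<open>m t\<close> restores
  \<open>m t powr (- p)\<close>.\<close>

lemma power_growth:
  fixes m U V :: "real \<Rightarrow> real"
  assumes m: "continuous_on {0..T} m" "\<And>t. t \<in> {0..T} \<Longrightarrow> m t \<ge> 1"
      "\<And>s t. 0 \<le> s \<Longrightarrow> s \<le> t \<Longrightarrow> t \<le> T \<Longrightarrow> m s \<le> m t"
    and p: "p > 1" and r: "r \<ge> 1" and \<kappa>: "\<kappa> > 0"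
    and U: "continuous_on {0..T} U" "\<And>t. t \<in> {0<..<T} \<Longrightarrow> (U has_real_derivative V t) (at t)" "0 \<le> U 0"
    and V: "\<And>t. t \<in> {0<..T} \<Longrightarrow> integral {0..t} (\<lambda>s. m s * (\<kappa> * m s powr (- p) * (r + s) powr \<theta>)) \<le> m t * V t"
    and t: "t \<in> {0..T}"
  shows "\<kappa> * 2 powr (- \<bar>\<theta>\<bar>) / 8 * m t powr (- p) * (r + t) powr \<theta> * t\<^sup>2 \<le> U t"
proof -
  let ?f = "\<lambda>s. m s * (\<kappa> * m s powr (- p) * (r + s) powr \<theta>)"
  have mT: "m t \<ge> 1" using m t by auto
  have cf: "continuous_on {0..T} ?f"
    using m(2) r by (intro continuous_intros m(1)) force+
  have int: "?f integrable_on {x..y}" if "0 \<le> x" "y \<le> T" for x y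
    by (rule integrable_continuous_real, rule continuous_on_subset[OF cf]) (use that in auto)
  have f0: "?f s \<ge> 0" if "s \<in> {0..T}" for s
    using m(2)[OF that] \<kappa> by simp
  have Vge: "integral {x..s} ?f \<le> m t * V s" if "0 \<le> x" "x \<le> s" "0 < s" "s \<le> t" for x s
  proof -
    have "0 \<le> integral {0..s} ?f" by (rule integral_nonneg) (use that t int f0 in auto)
    also have "\<dots> \<le> m s * V s" using V that t by auto
    finally have "0 \<le> V s" using m(2)[of s] that t by (simp add: zero_le_mult_iff)
    have "integral {x..s} ?f \<le> integral {0..s} ?f"
      by (rule integral_subset_le) (use that t int f0 in auto)
    also have "\<dots> \<le> m s * V s" using V that t by auto
    also have "\<dots> \<le> m t * V s" using m(3)[of s t] \<open>0 \<le> V s\<close> that t by (intro mult_right_mono) auto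
    finally show ?thesis .
  qed
  have t2: "0 \<le> t / 2" "t / 2 \<le> t" using t by auto
  have "U 0 \<le> U (t / 2)"
  proof (rule DERIV_nonneg_imp_le[OF t2(1), where f = U])
    show "continuous_on {0..t / 2} U" by (rule continuous_on_subset[OF U(1)]) (use t in auto)
    fix x assume x: "0 < x" "x < t / 2"
    then show "(U has_real_derivative V x) (at x)" using U(2) t by auto
    have "0 \<le> m t * V x" using Vge[of x x] x by simp
    then show "0 \<le> V x" using mT by (simp add: zero_le_mult_iff)
  qed
  define c where "c = \<kappa> * m t powr (- p) * (2 powr (- \<bar>\<theta>\<bar>) * (r + t) powr \<theta>)"
  have "U (t / 2) + c * (t - t / 2)\<^sup>2 / 2 \<le> U t"
  proof (rule quadratic_lower_bound[OF t2(2)])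
    show "continuous_on {t / 2..t} U" by (rule continuous_on_subset[OF U(1)]) (use t in auto)
    fix x assume x: "t / 2 < x" "x < t"
    then show "(U has_real_derivative V x) (at x)" using U(2) t by auto
    have "m t * c * (x - t / 2) = integral {t / 2..x} (\<lambda>s. m t * c)" using x by simp
    also have "\<dots> \<le> integral {t / 2..x} ?f"
    proof (rule integral_le)
      fix s assume s: "s \<in> {t / 2..x}"
      then have sT: "0 \<le> s" "s \<le> t" "s \<in> {0..T}" using x t by auto
      have ms: "1 \<le> m s" "m s \<le> m t" using m(2)[OF sT(3)] m(3)[of s t] sT t by auto
      have "m t * m t powr (- p) = m t powr (1 - p)" using mT by (simp add: powr_diff powr_minus divide_inverse)
      also have "\<dots> \<le> m s powr (1 - p)" using p ms by (intro powr_mono2') auto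
      also have "\<dots> = m s * m s powr (- p)" using ms by (simp add: powr_diff powr_minus divide_inverse)
      finally have 1: "m t * m t powr (- p) \<le> m s * m s powr (- p)" .
      have 2: "2 powr (- \<bar>\<theta>\<bar>) * (r + t) powr \<theta> \<le> (r + s) powr \<theta>"
      proof (cases "\<theta> \<ge> 0")
        case True
        have "((r + t) / 2) powr \<theta> \<le> (r + s) powr \<theta>" using True r s x t by (intro powr_mono2) auto
        then show ?thesis using True r t by (simp add: powr_divide powr_minus field_simps)
      next
        case False
        have "2 powr (- \<bar>\<theta>\<bar>) * (r + t) powr \<theta> \<le> 1 * (r + s) powr \<theta>"
          using False r sT powr_mono[of \<theta> 0 2] by (intro mult_mono powr_mono2') auto
        then show ?thesis by simp
      qed
      have "m t * c = \<kappa> * ((m t * m t powr (- p)) * (2 powr (- \<bar>\<theta>\<bar>) * (r + t) powr \<theta>))"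
        by (simp add: c_def)
      also have "\<dots> \<le> \<kappa> * ((m s * m s powr (- p)) * (r + s) powr \<theta>)"
        using \<kappa> ms by (intro mult_left_mono mult_mono 1 2) auto
      also have "\<dots> = ?f s" by simp
      finally show "m t * c \<le> ?f s" .
    qed (use x t int in auto)
    also have "\<dots> \<le> m t * V x" using Vge[of "t / 2" x] x t by auto
    finally have "m t * (c * (x - t / 2)) \<le> m t * V x" by (simp only: mult.assoc)
    then show "c * (x - t / 2) \<le> V x" using mT by simp
  qed
  moreover have "c * (t - t / 2)\<^sup>2 / 2 = \<kappa> * 2 powr (- \<bar>\<theta>\<bar>) / 8 * m t powr (- p) * (r + t) powr \<theta> * t\<^sup>2"
    by (simp add: c_def power2_eq_square)
  ultimately show ?thesis using \<open>U 0 \<le> U (t / 2)\<close> U(3) by linarith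
qed

section \<open>Integration in local Lebesgue spaces\<close>


text \<open>The complement of the essential support is a union of possibly uncountably many open
  sets; by Lindelof's theorem countably many suffice, and their exceptional null sets can be
  united.\<close>

lemma ess_support_AE:
  fixes f :: "'a::euclidean_space \<Rightarrow> real"
  assumes "ess_support f \<subseteq> S"
  shows "AE x in lebesgue. x \<notin> S \<longrightarrow> f x = 0"
proof -
  define \<F> where "\<F> = {U::'a set. open U \<and> (AE x in lebesgue. x \<in> U \<longrightarrow> f x = 0)}"
  obtain \<F>' where F': "\<F>' \<subseteq> \<F>" "countable \<F>'" "\<Union>\<F>' = \<Union>\<F>"
    using Lindelof[of \<F>] by (auto simp: \<F>_def)
  have "AE x in lebesgue. \<forall>U\<in>\<F>'. x \<in> U \<longrightarrow> f x = 0"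
    using F'(1,2) by (subst AE_ball_countable) (auto simp: \<F>_def)
  then show ?thesis
  proof eventually_elim
    case (elim x)
    have "x \<in> \<Union>\<F>'" if "x \<notin> S"
      using assms that unfolding F'(3) by (auto simp: ess_support_def \<F>_def)
    then show ?case using elim by auto
  qed
qed

lemma integrable_bounded_mult:
  fixes f g :: "'a \<Rightarrow> real"
  assumes "integrable M f" "g \<in> borel_measurable M" "\<And>x. x \<in> space M \<Longrightarrow> \<bar>g x\<bar> \<le> B"
  shows "integrable M (\<lambda>x. g x * f x)"
proof (rule Bochner_Integration.integrable_bound)
  show "integrable M (\<lambda>x. B * f x)" using assms(1) by simp
  show "(\<lambda>x. g x * f x) \<in> borel_measurable M"
    using assms(2) borel_measurable_integrable[OF assms(1)] by (rule borel_measurable_times)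
  show "AE x in M. norm (g x * f x) \<le> norm (B * f x)"
  proof (rule AE_I2)
    fix x assume "x \<in> space M"
    then have "\<bar>g x\<bar> \<le> \<bar>B\<bar>" using assms(3)[of x] by linarith
    then show "norm (g x * f x) \<le> norm (B * f x)" by (simp add: abs_mult mult_right_mono)
  qed
qed

lemma continuous_imp_lebesgue_measurable:
  fixes f :: "'a::euclidean_space \<Rightarrow> real"
  shows "continuous_on UNIV f \<Longrightarrow> f \<in> borel_measurable lebesgue"
  by (intro measurable_completion) (simp add: borel_measurable_continuous_onI)

lemma continuous_compact_support_bounded:
  fixes \<Phi> :: "'a::euclidean_space \<Rightarrow> real"
  assumes "continuous_on UNIV \<Phi>" "\<And>x. norm x > \<rho> \<Longrightarrow> \<Phi> x = 0"
  obtains B where "B > 0" "\<And>x. \<bar>\<Phi> x\<bar> \<le> B"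
proof -
  have "bounded (\<Phi> ` cball 0 \<rho>)"
    by (intro compact_imp_bounded compact_continuous_image continuous_on_subset[OF assms(1)]) auto
  then obtain B where B: "B > 0" "\<And>x. x \<in> cball 0 \<rho> \<Longrightarrow> \<bar>\<Phi> x\<bar> \<le> B"
    unfolding bounded_pos by auto
  have "\<bar>\<Phi> x\<bar> \<le> B" for x
    using B assms(2)[of x] by (cases "norm x \<le> \<rho>") auto
  with B(1) show thesis by (rule that)
qed

lemma mult_eq_indicator_mult:
  fixes \<Phi> v :: "'a::real_normed_vector \<Rightarrow> real"
  assumes "\<And>x. norm x > \<rho> \<Longrightarrow> \<Phi> x = 0"
  shows "(\<lambda>x. \<Phi> x * v x) = (\<lambda>x. \<Phi> x * (indicator (cball 0 \<rho>) x *\<^sub>R v x))"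
  using assms by (auto simp: fun_eq_iff indicator_def)

lemma L1loc_integrable_mult:
  fixes \<Phi> v :: "'a::euclidean_space \<Rightarrow> real"
  assumes "continuous_on UNIV \<Phi>" "\<And>x. norm x > \<rho> \<Longrightarrow> \<Phi> x = 0" "L1loc v"
  shows "integrable lebesgue (\<lambda>x. \<Phi> x * v x)"
proof -
  obtain B where B: "\<And>x. \<bar>\<Phi> x\<bar> \<le> B" using continuous_compact_support_bounded[OF assms(1,2)] by metis
  have "set_integrable lebesgue (cball 0 \<rho>) v" using assms(3) by (auto simp: L1loc_on_def)
  then have "integrable lebesgue (\<lambda>x. indicator (cball 0 \<rho>) x *\<^sub>R v x)" by (simp add: set_integrable_def)
  from integrable_bounded_mult[OF this continuous_imp_lebesgue_measurable[OF assms(1)] B]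
  show ?thesis by (subst mult_eq_indicator_mult[of \<rho> \<Phi>, OF assms(2)])
qed

lemma L1loc_inner:
  fixes v :: "'a::euclidean_space \<Rightarrow> 'b::euclidean_space"
  assumes "L1loc v"
  shows "L1loc (\<lambda>x. v x \<bullet> i)"
  using assms unfolding L1loc_on_def set_integrable_def
  by (auto intro: integrable_inner_left simp flip: inner_scaleR_left)

lemma L1loc_diff:
  fixes v w :: "'a::euclidean_space \<Rightarrow> real"
  shows "L1loc v \<Longrightarrow> L1loc w \<Longrightarrow> L1loc (\<lambda>x. v x - w x)"
  unfolding L1loc_on_def by (auto intro: set_integral_diff(1))

lemma tendsto_L1loc_integral:
  fixes \<Phi> :: "'a::euclidean_space \<Rightarrow> real" and v :: "'t \<Rightarrow> 'a \<Rightarrow> real"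
  assumes \<Phi>: "continuous_on UNIV \<Phi>" "\<And>x. norm x > \<rho> \<Longrightarrow> \<Phi> x = 0"
    and lim: "tendsto_L1loc v w F" and v: "\<forall>\<^sub>F s in F. L1loc (v s)" and w: "L1loc w"
  shows "((\<lambda>s. LINT x|lebesgue. \<Phi> x * v s x) \<longlongrightarrow> (LINT x|lebesgue. \<Phi> x * w x)) F"
proof -
  obtain B where B: "\<And>x. \<bar>\<Phi> x\<bar> \<le> B" using continuous_compact_support_bounded[OF \<Phi>] by metis
  have "((\<lambda>s. (LINT x|lebesgue. \<Phi> x * v s x) - (LINT x|lebesgue. \<Phi> x * w x)) \<longlongrightarrow> 0) F"
  proof (rule Lim_null_comparison)
    show "\<forall>\<^sub>F s in F. norm ((LINT x|lebesgue. \<Phi> x * v s x) - (LINT x|lebesgue. \<Phi> x * w x))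
        \<le> B * (LINT x:cball 0 \<rho>|lebesgue. norm (v s x - w x))"
      using v
    proof eventually_elim
      case (elim s)
      have int: "set_integrable lebesgue (cball 0 \<rho>) (\<lambda>x. v s x - w x)"
        using L1loc_diff[OF elim w] by (auto simp: L1loc_on_def)
      have "(LINT x|lebesgue. \<Phi> x * v s x) - (LINT x|lebesgue. \<Phi> x * w x) = (LINT x|lebesgue. \<Phi> x * (v s x - w x))"
        by (simp add: right_diff_distrib Bochner_Integration.integral_diff L1loc_integrable_mult[OF \<Phi>] elim w)
      also have "norm \<dots> \<le> (LINT x|lebesgue. norm (\<Phi> x * (v s x - w x)))"
        by (rule integral_norm_bound)
      also have "\<dots> \<le> (LINT x|lebesgue. B * (indicator (cball 0 \<rho>) x *\<^sub>R norm (v s x - w x)))"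
      proof (rule integral_mono)
        show "integrable lebesgue (\<lambda>x. norm (\<Phi> x * (v s x - w x)))"
          by (intro integrable_norm L1loc_integrable_mult[OF \<Phi>] L1loc_diff elim w)
        show "integrable lebesgue (\<lambda>x. B * (indicator (cball 0 \<rho>) x *\<^sub>R norm (v s x - w x)))"
          using set_integrable_norm[OF int] by (simp add: set_integrable_def)
        show "norm (\<Phi> x * (v s x - w x)) \<le> B * (indicator (cball 0 \<rho>) x *\<^sub>R norm (v s x - w x))" for x
          using B[of x] \<Phi>(2)[of x] by (auto simp: indicator_def abs_mult intro: mult_right_mono)
      qed
      also have "\<dots> = B * (LINT x:cball 0 \<rho>|lebesgue. norm (v s x - w x))"
        by (simp add: set_lebesgue_integral_def)
      finally show ?case .
    qed
    show "((\<lambda>s. B * (LINT x:cball 0 \<rho>|lebesgue. norm (v s x - w x))) \<longlongrightarrow> 0) F"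
      using lim by (auto simp: tendsto_L1loc_def intro!: tendsto_eq_intros)
  qed
  then show ?thesis by (rule LIM_zero_cancel)
qed

text \<open>Completeness of Lebesgue measure supplies the measurability of \<open>g\<close>; the
  proof obtains it by passing through negligible sets.\<close>

lemma integrable_lebesgue_AE_cong:
  fixes f g :: "'a::euclidean_space \<Rightarrow> real"
  assumes "integrable lebesgue f" "AE x in lebesgue. g x = f x"
  shows "integrable lebesgue g"
proof -
  obtain N where N: "\<And>x. x \<in> space lebesgue - N \<Longrightarrow> g x = f x" "N \<in> null_sets lebesgue"
    using AE_E3[OF assms(2)] by blast
  have "g absolutely_integrable_on UNIV"
  proof (rule absolutely_integrable_spike)
    show "f absolutely_integrable_on UNIV" using assms(1) by (simp add: set_integrable_def)
    show "negligible N" using N(2) by (simp add: negligible_iff_null_sets)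
    show "g x = f x" if "x \<in> UNIV - N" for x using N(1)[of x] that by simp
  qed
  then show ?thesis by (simp add: set_integrable_def)
qed

text \<open>The product lemmas of the library are stated for Borel measures; the function is replaced by a
  Borel representative.\<close>
lemma Fubini_lebesgue:
  fixes g :: "'a::euclidean_space \<times> 'b::euclidean_space \<Rightarrow> real"
  assumes "integrable lebesgue g"
  shows "AE s in lebesgue. integrable lebesgue (\<lambda>x. g (s, x))"
    and "integrable lebesgue (\<lambda>s. LINT x|lebesgue. g (s, x))"
proof -
  obtain g' where g': "g' \<in> borel_measurable lborel" "AE z in lborel. g z = g' z"
    using completion_ex_borel_measurable_real[OF borel_measurable_integrable[OF assms]] by auto
  have "AE z in lebesgue. g' z = g z" using AE_completion[OF g'(2)] by eventually_elim simp
  from integrable_lebesgue_AE_cong[OF assms this] have "integrable lborel g'"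
    using integrable_completion g'(1) by blast
  then have i: "integrable (lborel \<Otimes>\<^sub>M lborel) g'" by (simp add: lborel_prod)
  have "AE z in lborel \<Otimes>\<^sub>M lborel. g z = g' z" using g'(2) unfolding lborel_prod .
  from lborel_pair.AE_pair[OF this] have 1: "AE s in lborel. AE x in lborel. g (s, x) = g' (s, x)" .
  have 2: "AE s in lborel. integrable lborel (\<lambda>x. g' (s, x))" by (rule lborel_pair.AE_integrable_fst'[OF i])
  have 3: "integrable lborel (\<lambda>s. LINT x|lborel. g' (s, x))" by (rule lborel_pair.integrable_fst'[OF i])
  have conv: "integrable lebesgue (\<lambda>x. g (s, x)) \<and> (LINT x|lebesgue. g (s, x)) = (LINT x|lborel. g' (s, x))"
    if "AE x in lborel. g (s, x) = g' (s, x)" "integrable lborel (\<lambda>x. g' (s, x))" for s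
  proof -
    have m: "(\<lambda>x. g' (s, x)) \<in> borel_measurable lborel" using that(2) by (rule borel_measurable_integrable)
    have i': "integrable lebesgue (\<lambda>x. g' (s, x))" using that(2) integrable_completion[OF m] by blast
    have ae: "AE x in lebesgue. g (s, x) = g' (s, x)" by (rule AE_completion[OF that(1)])
    have i'': "integrable lebesgue (\<lambda>x. g (s, x))" by (rule integrable_lebesgue_AE_cong[OF i' ae])
    have "(LINT x|lebesgue. g (s, x)) = (LINT x|lebesgue. g' (s, x))"
      by (rule integral_cong_AE[OF borel_measurable_integrable[OF i''] borel_measurable_integrable[OF i'] ae])
    with i'' show ?thesis using integral_completion[OF m] by simp
  qed
  have 4: "AE s in lebesgue. integrable lebesgue (\<lambda>x. g (s, x)) \<and> (LINT x|lebesgue. g (s, x)) = (LINT x|lborel. g' (s, x))"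
    using AE_completion[OF 1] AE_completion[OF 2]
    by eventually_elim (rule conv)
  then show "AE s in lebesgue. integrable lebesgue (\<lambda>x. g (s, x))" by eventually_elim simp
  have "integrable lebesgue (\<lambda>s. LINT x|lborel. g' (s, x))"
    using 3 integrable_completion[OF borel_measurable_integrable[OF 3]] by blast
  then show "integrable lebesgue (\<lambda>s. LINT x|lebesgue. g (s, x))"
    by (rule integrable_lebesgue_AE_cong) (use 4 in eventually_elim, simp)
qed

text \<open>The left-hand side is the tangent at \<open>\<sigma>\<close> of the convex function
  \<open>a powr p\<close>. Young's inequality for \<open>a\<close> and
  \<open>\<sigma> powr (p - 1)\<close> is the same statement.\<close>

lemma Young_tangent:
  fixes p a \<sigma> :: real
  assumes "p > 1" "a \<ge> 0" "\<sigma> \<ge> 0"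
  shows "p * \<sigma> powr (p - 1) * a - (p - 1) * \<sigma> powr p \<le> a powr p"
proof -
  have "a * \<sigma> powr (p - 1) \<le> a powr p / p + (\<sigma> powr (p - 1)) powr (p / (p - 1)) / (p / (p - 1))"
    using assms by (intro Youngs_inequality) (auto simp: field_simps)
  also have "(\<sigma> powr (p - 1)) powr (p / (p - 1)) = \<sigma> powr p"
    using assms by (simp add: powr_powr)
  finally have "p * (a * \<sigma> powr (p - 1)) \<le> p * (a powr p / p + \<sigma> powr p / (p / (p - 1)))"
    using assms by (intro mult_left_mono) auto
  moreover have "p * (X / p + Y / (p / (p - 1))) = X + (p - 1) * Y" for X Y
    using assms by (simp add: distrib_left)
  ultimately show ?thesis by (simp only:) (simp add: mult_ac)
qed

text \<open>Hoelder's inequality, read as a lower bound for the \<open>p\<close>-th power: the tangent inequality is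
  integrated at \<open>\<sigma> = A / B * \<phi> powr (1 / (p - 1))\<close>.\<close>
lemma Holder_lower_bound:
  fixes \<phi> w :: "'a::euclidean_space \<Rightarrow> real"
  assumes p: "p > 1" and S: "S \<in> sets lebesgue"
    and \<phi>: "\<And>x. \<phi> x > 0"
    and int: "set_integrable lebesgue S (\<lambda>x. \<phi> x * w x)" "set_integrable lebesgue S (\<lambda>x. \<bar>w x\<bar> powr p)"
      "set_integrable lebesgue S (\<lambda>x. \<phi> x powr (p / (p - 1)))"
    and A: "0 \<le> A" "A \<le> (LINT x:S|lebesgue. \<phi> x * w x)"
    and B: "0 < B" "(LINT x:S|lebesgue. \<phi> x powr (p / (p - 1))) \<le> B"
  shows "A powr p * B powr (1 - p) \<le> (LINT x:S|lebesgue. \<bar>w x\<bar> powr p)"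
proof -
  \<comment> \<open>This value maximizes
    \<open>p * l powr (p - 1) * A - (p - 1) * l powr p * B\<close>, the lower bound that the
    integrated tangent inequality produces.\<close>
  define l where "l = A / B"
  have l: "l \<ge> 0" using A B by (simp add: l_def)
  let ?g = "\<lambda>x. p * l powr (p - 1) * (\<phi> x * w x) - (p - 1) * l powr p * \<phi> x powr (p / (p - 1))"
  have g: "?g x \<le> \<bar>w x\<bar> powr p" for x
  proof -
    define \<sigma> where "\<sigma> = l * \<phi> x powr (1 / (p - 1))"
    have s: "\<sigma> \<ge> 0" using l by (simp add: \<sigma>_def)
    have 1: "\<sigma> powr (p - 1) = l powr (p - 1) * \<phi> x"
      using l p \<phi>[of x] by (simp add: \<sigma>_def powr_mult powr_powr)
    have 2: "\<sigma> powr p = l powr p * \<phi> x powr (p / (p - 1))"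
      using l p \<phi>[of x] by (simp add: \<sigma>_def powr_mult powr_powr)
    have "p * l powr (p - 1) * (\<phi> x * w x) \<le> p * l powr (p - 1) * (\<phi> x * \<bar>w x\<bar>)"
      using p \<phi>[of x] by (intro mult_left_mono) auto
    then show ?thesis using Young_tangent[OF p _ s, of "\<bar>w x\<bar>"] unfolding 1 2 by (simp add: mult.assoc)
  qed
  have ig: "set_integrable lebesgue S ?g"
    by (intro set_integral_diff(1) set_integrable_mult_right) (use int in auto)
  have "A powr p * B powr (1 - p) = p * l powr (p - 1) * A - (p - 1) * l powr p * B"
  proof (cases "A = 0")
    case False
    then have A0: "A > 0" using A by simp
    have "l powr (p - 1) * A = A powr p * B powr (1 - p)"
      using A0 B by (simp add: l_def powr_divide powr_diff)
    moreover have "l powr p * B = A powr p * B powr (1 - p)"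
      using A0 B by (simp add: l_def powr_divide powr_diff)
    ultimately show ?thesis by (simp add: mult.assoc algebra_simps)
  qed (simp add: l_def)
  also have "\<dots> \<le> p * l powr (p - 1) * (LINT x:S|lebesgue. \<phi> x * w x)
      - (p - 1) * l powr p * (LINT x:S|lebesgue. \<phi> x powr (p / (p - 1)))"
    using A B p by (intro diff_mono mult_left_mono) auto
  also have "\<dots> = (LINT x:S|lebesgue. ?g x)"
    using int by (subst set_integral_diff(2)) auto
  also have "\<dots> \<le> (LINT x:S|lebesgue. \<bar>w x\<bar> powr p)"
    by (rule set_integral_mono[OF ig int(2) g])
  finally show ?thesis .
qed

section \<open>Weak solutions as functionals\<close>


lemma frechet_derivative_eq_0:
  fixes f :: "'a::euclidean_space \<Rightarrow> real"
  assumes "\<And>x. norm x > \<rho> \<Longrightarrow> f x = 0" and "norm x > \<rho>"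
  shows "frechet_derivative f (at x) v = 0"
proof -
  have "open {x::'a. norm x > \<rho>}" by (intro open_Collect_less continuous_intros)
  then have "frechet_derivative (\<lambda>_. 0) (at x) = frechet_derivative f (at x)"
    by (rule frechet_derivative_transform_within_open[OF differentiable_const]) (use assms in auto)
  then have "frechet_derivative f (at x) = (\<lambda>_. 0)" by (simp add: frechet_derivative_const)
  then show ?thesis by simp
qed

lemma partial2_cong_open:
  fixes f g :: "'a::euclidean_space \<Rightarrow> real"
  assumes "\<And>x. f differentiable (at x)" "open S" "x \<in> S" "\<And>y. y \<in> S \<Longrightarrow> f y = g y"
    and "\<And>i x. (\<lambda>y. frechet_derivative f (at y) i) differentiable (at x)"
  shows "partial2 f i x = partial2 g i x"
proof -
  have "frechet_derivative f (at y) = frechet_derivative g (at y)" if "y \<in> S" for y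
    by (rule frechet_derivative_transform_within_open[OF assms(1,2) that assms(4)])
  then show ?thesis unfolding partial2_def
    by (subst frechet_derivative_transform_within_open[OF assms(5) assms(2,3)]) auto
qed

text \<open>The weak gradient is defined by testing with scalar functions. Testing with the partial
  derivative of \<open>\<Phi>\<close> in direction \<open>i\<close> and keeping the
  \<open>i\<close>-th component moves one derivative onto \<open>\<Phi>\<close>; summing over the
  basis gives the Laplacian.\<close>

lemma weak_gradient_laplace:
  fixes \<Phi> v :: "'a::euclidean_space \<Rightarrow> real"
  assumes \<Phi>: "\<And>k. ck_function k \<Phi>" "\<And>x. norm x > \<rho> \<Longrightarrow> \<Phi> x = 0"
    and wg: "weak_gradient v Dv"
  shows "integrable lebesgue (\<lambda>x. Dv x \<bullet> grad \<Phi> x)"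
    and "(LINT x|lebesgue. Dv x \<bullet> grad \<Phi> x) = - (LINT x|lebesgue. (\<Sum>i\<in>Basis. partial2 \<Phi> i x) * v x)"
proof -
  have v: "L1loc v" and Dv: "L1loc Dv" using wg by (auto simp: weak_gradient_def)
  define d where "d i x = frechet_derivative \<Phi> (at x) i" for i x
  have d: "ck_function k (d i)" for k i
    using ck_function_SucD(2)[OF \<Phi>(1)] unfolding d_def[abs_def] .
  have d0: "d i x = 0" if "norm x > \<rho>" for i x
    unfolding d_def by (rule frechet_derivative_eq_0[OF \<Phi>(2) that])
  have dc: "continuous_on UNIV (d i)" for i using d[of 0] by simp
  define dd where "dd i j x = frechet_derivative (d i) (at x) j" for i j x
  have ddc: "continuous_on UNIV (dd i j)" for i j
    using ck_function_SucD(2)[OF d, of 0] unfolding dd_def[abs_def] by simp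
  have dd0: "dd i j x = 0" if "norm x > \<rho>" for i j x
    unfolding dd_def by (rule frechet_derivative_eq_0[OF d0 that])
  have p2: "partial2 \<Phi> i x = dd i i x" for i x
    by (simp add: partial2_def dd_def d_def[abs_def])
  have int1: "integrable lebesgue (\<lambda>x. d i x * (Dv x \<bullet> j))" for i j
    by (rule L1loc_integrable_mult[OF dc d0 L1loc_inner[OF Dv]])
  have int2: "integrable lebesgue (\<lambda>x. dd i j x * v x)" for i j
    by (rule L1loc_integrable_mult[OF ddc dd0 v])
  have parts: "(LINT x|lebesgue. dd i i x * v x) = - (LINT x|lebesgue. d i x * (Dv x \<bullet> i))" if i: "i \<in> Basis" for i
  proof -
    have "test_function (d i)" by (rule test_functionI[OF d d0])
    then have "(LINT x|lebesgue. v x *\<^sub>R grad (d i) x) = - (LINT x|lebesgue. d i x *\<^sub>R Dv x)"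
      using wg by (simp add: weak_gradient_def)
    then have eq: "(LINT x|lebesgue. v x *\<^sub>R grad (d i) x) \<bullet> i = - ((LINT x|lebesgue. d i x *\<^sub>R Dv x) \<bullet> i)" by simp
    have e: "d i x *\<^sub>R Dv x = (\<Sum>j\<in>Basis. (d i x * (Dv x \<bullet> j)) *\<^sub>R j)" for x
    proof -
      have "d i x *\<^sub>R Dv x = d i x *\<^sub>R (\<Sum>j\<in>Basis. (Dv x \<bullet> j) *\<^sub>R j)"
        by (simp only: euclidean_representation)
      then show ?thesis by (simp only: scaleR_sum_right scaleR_scaleR)
    qed
    have i1: "integrable lebesgue (\<lambda>x. d i x *\<^sub>R Dv x)"
      unfolding e by (intro Bochner_Integration.integrable_sum integrable_scaleR_left int1)
    have g: "v x *\<^sub>R grad (d i) x = (\<Sum>j\<in>Basis. (dd i j x * v x) *\<^sub>R j)" for x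
      by (simp add: grad_def dd_def scaleR_sum_right mult.commute)
    have i2: "integrable lebesgue (\<lambda>x. v x *\<^sub>R grad (d i) x)"
      unfolding g by (intro Bochner_Integration.integrable_sum integrable_scaleR_left int2)
    have gi: "grad (d i) x \<bullet> i = dd i i x" for x
      unfolding grad_def dd_def using i by (simp add: inner_sum_left_Basis)
    have "(LINT x|lebesgue. v x *\<^sub>R grad (d i) x) \<bullet> i = (LINT x|lebesgue. dd i i x * v x)"
      by (subst integral_inner_left[symmetric]) (use i2 in \<open>auto simp: gi mult.commute\<close>)
    moreover have "(LINT x|lebesgue. d i x *\<^sub>R Dv x) \<bullet> i = (LINT x|lebesgue. d i x * (Dv x \<bullet> i))"
      by (subst integral_inner_left[symmetric]) (use i1 in auto)
    ultimately show ?thesis using eq by simp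
  qed
  have inner: "Dv x \<bullet> grad \<Phi> x = (\<Sum>i\<in>Basis. d i x * (Dv x \<bullet> i))" for x
    by (simp add: grad_def d_def inner_sum_right)
  show "integrable lebesgue (\<lambda>x. Dv x \<bullet> grad \<Phi> x)"
    unfolding inner by (intro Bochner_Integration.integrable_sum int1)
  have "(LINT x|lebesgue. Dv x \<bullet> grad \<Phi> x) = (\<Sum>i\<in>Basis. (LINT x|lebesgue. d i x * (Dv x \<bullet> i)))"
    unfolding inner by (rule Bochner_Integration.integral_sum[OF int1])
  also have "\<dots> = - (\<Sum>i\<in>Basis. (LINT x|lebesgue. dd i i x * v x))"
    by (simp add: parts sum_negf)
  also have "\<dots> = - (LINT x|lebesgue. (\<Sum>i\<in>Basis. partial2 \<Phi> i x) * v x)"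
    unfolding p2 sum_distrib_right by (simp add: Bochner_Integration.integral_sum int2)
  finally show "(LINT x|lebesgue. Dv x \<bullet> grad \<Phi> x) = - (LINT x|lebesgue. (\<Sum>i\<in>Basis. partial2 \<Phi> i x) * v x)" .
qed

text \<open>The first factor switches off between \<open>a\<close> and \<open>b\<close>. The second
  cuts off towards time \<open>- 2\<close>: test functions are defined at negative times as well and
  must have compact support there.\<close>

definition time_cutoff :: "real \<Rightarrow> real \<Rightarrow> real \<Rightarrow> real"
  where "time_cutoff a b s = smooth_step ((b - s) / (b - a)) * smooth_step (s + 2)"

lemma ck_time_cutoff:
  assumes "a < b"
  shows "ck_function k (time_cutoff a b)"
proof -
  have "ck_function k (\<lambda>s. (b - s) / (b - a))" unfolding divide_inverse
    by (intro ck_function_mult ck_function_diff ck_function_const ck_function_linear bounded_linear_ident)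
  moreover have "ck_function k (\<lambda>s::real. s + 2)"
    by (intro ck_function_add ck_function_const ck_function_linear bounded_linear_ident)
  ultimately show ?thesis unfolding time_cutoff_def[abs_def]
    by (intro ck_function_mult ck_function_compose_real[OF ck_smooth_step])
qed

lemma time_cutoff_eq_1: "a < b \<Longrightarrow> - 1 \<le> s \<Longrightarrow> s \<le> a \<Longrightarrow> time_cutoff a b s = 1"
  by (simp add: time_cutoff_def smooth_step_eq_1)

lemma time_cutoff_eq_0: "a < b \<Longrightarrow> s \<le> - 2 \<or> b \<le> s \<Longrightarrow> time_cutoff a b s = 0"
  by (auto simp: time_cutoff_def smooth_step_eq_0 divide_nonpos_pos)

lemma spacetime_test_function_product:
  fixes \<Phi> :: "'a::euclidean_space \<Rightarrow> real"
  assumes \<Phi>: "\<And>k. ck_function k \<Phi>" "\<And>x. norm x > \<rho> \<Longrightarrow> \<Phi> x = 0" and "a < b" "ereal b < T"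
  shows "spacetime_test_function T (\<lambda>z. time_cutoff a b (fst z) * \<Phi> (snd z))"
proof -
  let ?\<psi> = "\<lambda>z. time_cutoff a b (fst z) * \<Phi> (snd z)"
  have "test_function ?\<psi>"
  proof (rule test_functionI)
    show "ck_function k ?\<psi>" for k
      by (intro ck_function_mult ck_function_compose_linear[OF bounded_linear_fst ck_time_cutoff[OF assms(3)]]
          ck_function_compose_linear[OF bounded_linear_snd \<Phi>(1)])
    fix z :: "real \<times> 'a" assume z: "norm z > 2 + \<bar>b\<bar> + \<bar>\<rho>\<bar>"
    show "?\<psi> z = 0"
    proof (cases "fst z \<le> - 2 \<or> b \<le> fst z")
      case False
      then have "\<bar>fst z\<bar> \<le> 2 + \<bar>b\<bar>" by auto
      moreover have "norm z \<le> \<bar>fst z\<bar> + norm (snd z)" using norm_Pair_le[of "fst z" "snd z"] by simp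
      ultimately show ?thesis using z by (simp add: \<Phi>(2))
    qed (simp add: time_cutoff_eq_0[OF assms(3)])
  qed
  moreover have "closure {z. ?\<psi> z \<noteq> 0} \<subseteq> {..b} \<times> UNIV"
  proof (rule closure_minimal)
    show "{z. ?\<psi> z \<noteq> 0} \<subseteq> {..b} \<times> UNIV"
    proof
      fix z assume "z \<in> {z. ?\<psi> z \<noteq> 0}"
      then have "time_cutoff a b (fst z) \<noteq> 0" by simp
      then have "\<not> b \<le> fst z" using time_cutoff_eq_0[OF assms(3)] by blast
      then show "z \<in> {..b} \<times> UNIV" by (cases z) simp
    qed
  qed (intro closed_Times closed_atMost closed_UNIV)
  moreover have "{..b} \<times> UNIV \<subseteq> {s. ereal s < T} \<times> (UNIV :: 'a set)"
    using assms(4) by (auto elim: order.strict_trans1[rotated])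
  ultimately show ?thesis unfolding spacetime_test_function_def by blast
qed


section \<open>Spatial integrals as functions of time\<close>

lemma Icc_subset_time_interval: "ereal t < T \<Longrightarrow> {0..t} \<subseteq> time_interval T"
  by (auto simp: time_interval_def elim: order.strict_trans1[rotated])

lemma set_LINT_eq_integral:
  fixes f :: "real \<Rightarrow> real"
  assumes "continuous_on {a..b} f"
  shows "set_integrable lebesgue {a..b} f" "(LINT s:{a..b}|lebesgue. f s) = integral {a..b} f"
proof -
  show *: "set_integrable lebesgue {a..b} f" using assms by (rule absolutely_integrable_continuous_real)
  show "(LINT s:{a..b}|lebesgue. f s) = integral {a..b} f"
    by (rule set_lebesgue_integral_eq_integral(2)[OF *])
qed

text \<open>Fubini on the compact cylinder \<open>K\<close>. The slices are obtained for almost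
  every time only, and this exceptional set persists in the later pointwise bounds of the nonlinear
  term.\<close>

lemma L1loc_spacetime_slices:
  fixes h :: "real \<times> 'a::euclidean_space \<Rightarrow> real"
  assumes h: "L1loc_on (time_interval T \<times> UNIV) h" and t: "ereal t < T"
    and \<Phi>: "continuous_on UNIV \<Phi>" "\<And>x. norm x > \<rho> \<Longrightarrow> \<Phi> x = 0"
  shows "AE s in lebesgue. s \<in> {0..t} \<longrightarrow> set_integrable lebesgue (cball 0 \<rho>) (\<lambda>x. h (s, x))"
    and "set_integrable lebesgue {0..t} (\<lambda>s. LINT x|lebesgue. \<Phi> x * h (s, x))"
proof -
  define K where "K = {0..t} \<times> cball (0::'a) \<rho>"
  have "compact K" "K \<subseteq> time_interval T \<times> UNIV"
    unfolding K_def using Icc_subset_time_interval[OF t] by (auto intro: compact_Times)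
  then have "set_integrable lebesgue K h" using h by (auto simp: L1loc_on_def)
  then have i: "integrable lebesgue (\<lambda>z. indicator K z *\<^sub>R h z)" by (simp add: set_integrable_def)
  from Fubini_lebesgue(1)[OF i]
  show "AE s in lebesgue. s \<in> {0..t} \<longrightarrow> set_integrable lebesgue (cball 0 \<rho>) (\<lambda>x. h (s, x))"
  proof eventually_elim
    case (elim s)
    have "(\<lambda>x. indicator K (s, x) *\<^sub>R h (s, x)) = (\<lambda>x. indicator (cball 0 \<rho>) x *\<^sub>R h (s, x))"
      if "s \<in> {0..t}" using that by (auto simp: fun_eq_iff K_def indicator_def)
    then show ?case using elim by (auto simp: set_integrable_def)
  qed
  obtain B where B: "\<And>x. \<bar>\<Phi> x\<bar> \<le> B" using continuous_compact_support_bounded[OF \<Phi>] by metis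
  have "continuous_on UNIV (\<lambda>z::real \<times> 'a. \<Phi> (snd z))"
    by (rule continuous_on_compose2[OF \<Phi>(1)]) (auto intro: continuous_intros)
  from integrable_bounded_mult[OF i continuous_imp_lebesgue_measurable[OF this] B]
  have "integrable lebesgue (\<lambda>z. \<Phi> (snd z) * (indicator K z *\<^sub>R h z))" .
  from Fubini_lebesgue(2)[OF this]
  have "integrable lebesgue (\<lambda>s. LINT x|lebesgue. \<Phi> x * (indicator K (s, x) *\<^sub>R h (s, x)))" by simp
  also have "(\<lambda>s. LINT x|lebesgue. \<Phi> x * (indicator K (s, x) *\<^sub>R h (s, x))) =
      (\<lambda>s. indicator {0..t} s *\<^sub>R (LINT x|lebesgue. \<Phi> x * h (s, x)))"
  proof (rule ext)
    fix s
    have e: "\<Phi> x * (indicator K (s, x) *\<^sub>R h (s, x)) = indicator {0..t} s * (\<Phi> x * h (s, x))" for x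
      using \<Phi>(2)[of x] by (auto simp: K_def indicator_def)
    show "(LINT x|lebesgue. \<Phi> x * (indicator K (s, x) *\<^sub>R h (s, x))) =
      indicator {0..t} s *\<^sub>R (LINT x|lebesgue. \<Phi> x * h (s, x))" unfolding e by simp
  qed
  finally show "set_integrable lebesgue {0..t} (\<lambda>s. LINT x|lebesgue. \<Phi> x * h (s, x))"
    by (simp add: set_integrable_def)
qed

text \<open>The difference quotients converge relative to \<open>I\<close>; the interval
  \<open>[a, b]\<close> around \<open>t\<close> inside \<open>I\<close> makes the limit
  two-sided.\<close>

lemma L1loc_real_derivative:
  fixes \<Phi> :: "'a::euclidean_space \<Rightarrow> real"
  assumes \<Phi>: "continuous_on UNIV \<Phi>" "\<And>x. norm x > \<rho> \<Longrightarrow> \<Phi> x = 0"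
    and u: "\<And>s. s \<in> I \<Longrightarrow> L1loc (u s)" and ut: "L1loc (ut t)" and d: "has_L1loc_derivative I u ut"
    and t: "a < t" "t < b" "{a..b} \<subseteq> I"
  shows "((\<lambda>s. LINT x|lebesgue. \<Phi> x * u s x) has_real_derivative (LINT x|lebesgue. \<Phi> x * ut t x)) (at t)"
proof -
  have tI: "t \<in> I" using t by auto
  have L: "L1loc (\<lambda>x. (u s x - u t x) / (s - t))" if "s \<in> I" for s
    using L1loc_diff[OF u[OF that] u[OF tI]] unfolding L1loc_on_def by (auto intro: set_integrable_divide)
  have "((\<lambda>s. LINT x|lebesgue. \<Phi> x * ((u s x - u t x) / (s - t))) \<longlongrightarrow> (LINT x|lebesgue. \<Phi> x * ut t x)) (at t within I)"
  proof (rule tendsto_L1loc_integral[OF \<Phi> _ _ ut])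
    show "tendsto_L1loc (\<lambda>s x. (u s x - u t x) / (s - t)) (ut t) (at t within I)"
      using d tI by (simp add: has_L1loc_derivative_def)
    show "\<forall>\<^sub>F s in at t within I. L1loc (\<lambda>x. (u s x - u t x) / (s - t))"
      using L by (auto simp: eventually_at_filter)
  qed
  then have "((\<lambda>s. LINT x|lebesgue. \<Phi> x * ((u s x - u t x) / (s - t))) \<longlongrightarrow> (LINT x|lebesgue. \<Phi> x * ut t x)) (at t within {a..b})"
    by (rule tendsto_within_subset) (use t in auto)
  moreover have "\<forall>\<^sub>F s in at t within {a..b}. (LINT x|lebesgue. \<Phi> x * ((u s x - u t x) / (s - t))) =
      ((LINT x|lebesgue. \<Phi> x * u s x) - (LINT x|lebesgue. \<Phi> x * u t x)) / (s - t)"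
    unfolding eventually_at_filter
  proof (rule always_eventually, intro allI impI)
    fix s assume "s \<noteq> t" "s \<in> {a..b}"
    then have "L1loc (u s)" using u t by auto
    from L1loc_integrable_mult[OF \<Phi> this] L1loc_integrable_mult[OF \<Phi> u[OF tI]]
    show "(LINT x|lebesgue. \<Phi> x * ((u s x - u t x) / (s - t))) =
      ((LINT x|lebesgue. \<Phi> x * u s x) - (LINT x|lebesgue. \<Phi> x * u t x)) / (s - t)"
      by (simp add: right_diff_distrib Bochner_Integration.integral_diff)
  qed
  ultimately have "((\<lambda>s. LINT x|lebesgue. \<Phi> x * u s x) has_real_derivative (LINT x|lebesgue. \<Phi> x * ut t x)) (at t within {a..b})"
    unfolding has_field_derivative_iff by (blast intro: Lim_transform_eventually)
  then show ?thesis using t by (simp add: at_within_Icc_at)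
qed

lemma continuous_L1loc_integral:
  fixes \<Phi> :: "'a::euclidean_space \<Rightarrow> real"
  assumes \<Phi>: "continuous_on UNIV \<Phi>" "\<And>x. norm x > \<rho> \<Longrightarrow> \<Phi> x = 0"
    and u: "continuous_L1loc I u"
  shows "continuous_on I (\<lambda>s. LINT x|lebesgue. \<Phi> x * u s x)"
  unfolding continuous_on_def
proof
  fix t assume "t \<in> I"
  then show "((\<lambda>s. LINT x|lebesgue. \<Phi> x * u s x) \<longlongrightarrow> (LINT x|lebesgue. \<Phi> x * u t x)) (at t within I)"
    using u by (intro tendsto_L1loc_integral[OF \<Phi>]) (auto simp: continuous_L1loc_def eventually_at_filter)
qed

text \<open>The test function \<open>\<phi>\<close> is cut off outside the support of \<open>u\<close>, so \<open>\<Delta> \<phi> = l \<phi>\<close> turns the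
  gradient term into \<open>- l F\<close>.\<close>
lemma weak_solution_functional:
  fixes \<phi> u0 u1 :: "'a::euclidean_space \<Rightarrow> real"
  assumes ws: "weak_solution b (\<lambda>y z. \<bar>y\<bar> powr p) \<epsilon> u0 u1 R T u"
    and b: "continuous_on {0..} b" and eps: "\<epsilon> > 0" and R: "R > 0"
    and supp: "ess_support u0 \<subseteq> cball 0 R" and u1: "AE x in lebesgue. u1 x \<ge> 0"
    and t0: "0 < t0" "ereal t0 < T"
    and \<phi>: "\<And>k. ck_function k \<phi>" "\<And>x. (\<Sum>i\<in>Basis. partial2 \<phi> i x) = l * \<phi> x" "\<And>x. \<phi> x \<ge> 0"
  obtains F G N G0 where
    "\<And>s. s \<in> {0..t0} \<Longrightarrow> F s = (LINT x:cball 0 (R + s)|lebesgue. \<phi> x * u s x)"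
    "\<And>s. s \<in> {0..t0} \<Longrightarrow> set_integrable lebesgue (cball 0 (R + s)) (\<lambda>x. \<phi> x * u s x)"
    "F 0 = \<epsilon> * (LINT x:cball 0 R|lebesgue. \<phi> x * u0 x)"
    "continuous_on {0..t0} F" "continuous_on {0..t0} G"
    "\<And>t. t \<in> {0<..<t0} \<Longrightarrow> (F has_real_derivative G t) (at t)"
    "set_integrable lebesgue {0..t0} N" "\<And>s. N s \<ge> 0"
    "AE s in lebesgue. s \<in> {0..t0} \<longrightarrow> set_integrable lebesgue (cball 0 (R + s)) (\<lambda>x. \<bar>u s x\<bar> powr p) \<and>
       (LINT x:cball 0 (R + s)|lebesgue. \<phi> x * \<bar>u s x\<bar> powr p) \<le> N s"
    "G0 \<ge> 0"
    "\<And>t. t \<in> {0<..t0} \<Longrightarrow> G t + integral {0..t} (\<lambda>s. b s * G s) =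
        G0 + integral {0..t} (\<lambda>s. l * F s) + (LINT s:{0..t}|lebesgue. N s)"
proof -
  let ?I = "time_interval T"
  obtain ut Du where
    wg: "\<And>t. t \<in> ?I \<Longrightarrow> weak_gradient (u t) (Du t)" and cu: "continuous_L1loc ?I u"
    and du: "has_L1loc_derivative ?I u ut" and cut: "continuous_L1loc ?I ut"
    and Lp: "L1loc_on (?I \<times> UNIV) (\<lambda>(s, x). \<bar>u s x\<bar> powr p)"
    and su: "\<And>t. t \<in> ?I \<Longrightarrow> 0 < t \<Longrightarrow> ess_support (u t) \<subseteq> cball 0 (R + t)"
    and u_0: "AE x in lebesgue. u 0 x = \<epsilon> * u0 x"
    and weak: "\<And>t \<psi>. t \<in> ?I \<Longrightarrow> 0 < t \<Longrightarrow> spacetime_test_function T \<psi> \<Longrightarrow>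
        (LINT s:{0..t}|lebesgue. (LINT x|lebesgue.
            - ut s x * deriv (\<lambda>r. \<psi> (r, x)) s + Du s x \<bullet> grad (\<lambda>y. \<psi> (s, y)) x + b s * ut s x * \<psi> (s, x)))
          + (LINT x|lebesgue. ut t x * \<psi> (t, x))
        = \<epsilon> * (LINT x|lebesgue. u1 x * \<psi> (0, x))
          + (LINT s:{0..t}|lebesgue. (LINT x|lebesgue. \<bar>u s x\<bar> powr p * \<psi> (s, x)))"
    using ws unfolding weak_solution_def by blast
  have I: "{0..t0} \<subseteq> ?I" by (rule Icc_subset_time_interval[OF t0(2)])
  \<comment> \<open>The margin 1 keeps the support of \<open>u s\<close>, for all
    \<open>s <= t0\<close>, strictly inside the region where \<open>\<Phi>\<close> and
    \<open>\<phi>\<close> coincide, so that their second derivatives coincide there too.\<close>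
  define \<rho> where "\<rho> = R + t0 + 1"
  have rho: "\<rho> \<ge> 0" using R t0 by (simp add: \<rho>_def)
  define \<Phi> where "\<Phi> x = cutoff \<rho> x * \<phi> x" for x
  have ck: "ck_function k \<Phi>" for k unfolding \<Phi>_def by (intro ck_function_mult ck_cutoff \<phi>(1))
  have \<Phi>c: "continuous_on UNIV \<Phi>" using ck[of 0] by simp
  have \<Phi>0: "\<Phi> x = 0" if "norm x > \<rho> + 1" for x using cutoff_eq_0[OF rho, of x] that by (simp add: \<Phi>_def)
  have \<Phi>eq: "\<Phi> x = \<phi> x" if "norm x \<le> \<rho>" for x using cutoff_eq_1[OF that] by (simp add: \<Phi>_def)
  have \<Phi>nn: "\<Phi> x \<ge> 0" for x using mult_nonneg_nonneg[OF cutoff_nonneg \<phi>(3)] by (simp add: \<Phi>_def)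
  have \<phi>c: "continuous_on UNIV \<phi>" using \<phi>(1)[of 0] by simp
  have Lu: "L1loc (u s)" and Lut: "L1loc (ut s)" if "s \<in> ?I" for s
    using cu cut that by (auto simp: continuous_L1loc_def)
  have lap: "(\<Sum>i\<in>Basis. partial2 \<Phi> i x) = l * \<Phi> x" if "norm x < \<rho>" for x
  proof -
    have "partial2 \<Phi> i x = partial2 \<phi> i x" for i
    proof (rule partial2_cong_open)
      show "\<Phi> differentiable at y" for y using ck_function_SucD(1)[OF ck] by (auto simp: differentiable_def)
      show "(\<lambda>y. frechet_derivative \<Phi> (at y) i) differentiable at y" for i y
        using ck_function_SucD(1)[OF ck_function_SucD(2)[OF ck]] by (auto simp: differentiable_def)
      show "open (ball 0 \<rho>)" "x \<in> ball 0 \<rho>" using that by auto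
      show "\<Phi> y = \<phi> y" if "y \<in> ball 0 \<rho>" for y using that by (intro \<Phi>eq) auto
    qed
    then show ?thesis using \<phi>(2) \<Phi>eq[of x] that by simp
  qed
  \<comment> \<open>The support condition covers positive times; at time 0 the statement comes from
    the initial datum.\<close>
  have zero: "AE x in lebesgue. x \<notin> cball 0 (R + s) \<longrightarrow> u s x = 0" if "s \<in> {0..t0}" for s
  proof (cases "s = 0")
    case True
    show ?thesis using u_0 ess_support_AE[OF supp] by eventually_elim (simp add: True)
  next
    case False
    then have "s \<in> ?I" "0 < s" using that I by auto
    then show ?thesis by (intro ess_support_AE su)
  qed
  define F where "F s = (LINT x|lebesgue. \<Phi> x * u s x)" for s
  define G where "G s = (LINT x|lebesgue. \<Phi> x * ut s x)" for s
  define N where "N s = (LINT x|lebesgue. \<Phi> x * \<bar>u s x\<bar> powr p)" for s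
  define G0 where "G0 = \<epsilon> * (LINT x|lebesgue. u1 x * \<Phi> x)"
  have int_u: "integrable lebesgue (\<lambda>x. \<Phi> x * u s x)" if "s \<in> ?I" for s
    by (rule L1loc_integrable_mult[OF \<Phi>c \<Phi>0 Lu[OF that]])
  have int_ut: "integrable lebesgue (\<lambda>x. \<Phi> x * ut s x)" if "s \<in> ?I" for s
    by (rule L1loc_integrable_mult[OF \<Phi>c \<Phi>0 Lut[OF that]])
  have cF: "continuous_on ?I F" unfolding F_def by (rule continuous_L1loc_integral[OF \<Phi>c \<Phi>0 cu])
  have cG: "continuous_on ?I G" unfolding G_def by (rule continuous_L1loc_integral[OF \<Phi>c \<Phi>0 cut])
  have inner: "(LINT x|lebesgue. Du s x \<bullet> grad \<Phi> x) = - l * F s" if s: "s \<in> {0..t0}" for s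
  proof -
    have sI: "s \<in> ?I" using s I by auto
    \<comment> \<open>In the transition zone of the cutoff the Laplacian of \<open>\<Phi>\<close>
      need not be \<open>l * \<Phi>\<close>, but there \<open>u s\<close> vanishes almost
      everywhere.\<close>
    have *: "(\<Sum>i\<in>Basis. partial2 \<Phi> i x) * u s x = l * (\<Phi> x * u s x)" if "x \<notin> cball 0 (R + s) \<longrightarrow> u s x = 0" for x
      using lap[of x] that s by (cases "norm x < \<rho>") (auto simp: \<rho>_def)
    have ae: "AE x in lebesgue. (\<Sum>i\<in>Basis. partial2 \<Phi> i x) * u s x = l * (\<Phi> x * u s x)"
      using zero[OF s] by eventually_elim (rule *)
    have i: "integrable lebesgue (\<lambda>x. l * (\<Phi> x * u s x))" using int_u[OF sI] by simp
    have "(LINT x|lebesgue. (\<Sum>i\<in>Basis. partial2 \<Phi> i x) * u s x) = (LINT x|lebesgue. l * (\<Phi> x * u s x))"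
      by (rule integral_cong_AE[OF borel_measurable_integrable[OF integrable_lebesgue_AE_cong[OF i ae]] borel_measurable_integrable[OF i] ae])
    then show ?thesis using weak_gradient_laplace(2)[OF ck \<Phi>0 wg[OF sI]] by (simp add: F_def)
  qed
  show thesis
  proof (rule that[of F G N G0])
    have FF: "F s = (LINT x:cball 0 (R + s)|lebesgue. \<phi> x * u s x)
        \<and> set_integrable lebesgue (cball 0 (R + s)) (\<lambda>x. \<phi> x * u s x)" if s: "s \<in> {0..t0}" for s
    proof -
      have sI: "s \<in> ?I" using s I by auto
      have *: "indicator (cball 0 (R + s)) x *\<^sub>R (\<phi> x * u s x) = \<Phi> x * u s x" if "x \<notin> cball 0 (R + s) \<longrightarrow> u s x = 0" for x
        using \<Phi>eq[of x] that s by (cases "x \<in> cball 0 (R + s)") (auto simp: \<rho>_def)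
      have ae: "AE x in lebesgue. indicator (cball 0 (R + s)) x *\<^sub>R (\<phi> x * u s x) = \<Phi> x * u s x"
        using zero[OF s] by eventually_elim (rule *)
      note i = integrable_lebesgue_AE_cong[OF int_u[OF sI] ae]
      have "(LINT x|lebesgue. indicator (cball 0 (R + s)) x *\<^sub>R (\<phi> x * u s x)) = F s"
        unfolding F_def
        by (rule integral_cong_AE[OF borel_measurable_integrable[OF i] borel_measurable_integrable[OF int_u[OF sI]] ae])
      with i show ?thesis by (simp add: set_integrable_def set_lebesgue_integral_def)
    qed
    then show "F s = (LINT x:cball 0 (R + s)|lebesgue. \<phi> x * u s x)"
      and "set_integrable lebesgue (cball 0 (R + s)) (\<lambda>x. \<phi> x * u s x)" if "s \<in> {0..t0}" for s
      using that by auto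
    have s0: "0 \<in> {0..t0}" using t0 by simp
    have "(LINT x:cball 0 R|lebesgue. \<phi> x * u 0 x) = (LINT x:cball 0 R|lebesgue. \<epsilon> * (\<phi> x * u0 x))"
    proof -
      have i: "integrable lebesgue (\<lambda>x. indicator (cball 0 R) x *\<^sub>R (\<phi> x * u 0 x))"
        using FF[OF s0] by (simp add: set_integrable_def)
      have ae: "AE x in lebesgue. indicator (cball 0 R) x *\<^sub>R (\<epsilon> * (\<phi> x * u0 x)) = indicator (cball 0 R) x *\<^sub>R (\<phi> x * u 0 x)"
        using u_0 by eventually_elim simp
      show ?thesis unfolding set_lebesgue_integral_def
        by (rule integral_cong_AE[OF borel_measurable_integrable[OF integrable_lebesgue_AE_cong[OF i ae]]
              borel_measurable_integrable[OF i] ae, symmetric])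
    qed
    then show "F 0 = \<epsilon> * (LINT x:cball 0 R|lebesgue. \<phi> x * u0 x)"
      using FF[OF s0] by simp
    show "continuous_on {0..t0} F" "continuous_on {0..t0} G"
      using continuous_on_subset[OF _ I] cF cG by auto
    show "(F has_real_derivative G t) (at t)" if "t \<in> {0<..<t0}" for t
      unfolding F_def[abs_def] G_def
      by (rule L1loc_real_derivative[OF \<Phi>c \<Phi>0 Lu Lut du _ _ I]) (use that I in auto)
    show "set_integrable lebesgue {0..t0} N"
      unfolding N_def[abs_def] using L1loc_spacetime_slices(2)[OF Lp t0(2) \<Phi>c \<Phi>0] by simp
    show "N s \<ge> 0" for s unfolding N_def by (rule integral_nonneg_AE) (simp add: \<Phi>nn)
    have "AE s in lebesgue. s \<in> {0..t0} \<longrightarrow> set_integrable lebesgue (cball 0 (\<rho> + 1)) (\<lambda>x. \<bar>u s x\<bar> powr p)"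
      using L1loc_spacetime_slices(1)[OF Lp t0(2) \<Phi>c \<Phi>0] by simp
    then show "AE s in lebesgue. s \<in> {0..t0} \<longrightarrow> set_integrable lebesgue (cball 0 (R + s)) (\<lambda>x. \<bar>u s x\<bar> powr p) \<and>
       (LINT x:cball 0 (R + s)|lebesgue. \<phi> x * \<bar>u s x\<bar> powr p) \<le> N s"
    proof (eventually_elim, intro impI)
      fix s assume "s \<in> {0..t0} \<longrightarrow> set_integrable lebesgue (cball 0 (\<rho> + 1)) (\<lambda>x. \<bar>u s x\<bar> powr p)" and s: "s \<in> {0..t0}"
      then have i: "set_integrable lebesgue (cball 0 (\<rho> + 1)) (\<lambda>x. \<bar>u s x\<bar> powr p)" by simp
      have sub: "cball 0 (R + s) \<subseteq> (cball 0 (\<rho> + 1) :: 'a set)" using s by (auto simp: \<rho>_def)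
      have 1: "set_integrable lebesgue (cball 0 (R + s)) (\<lambda>x. \<bar>u s x\<bar> powr p)"
        by (rule set_integrable_subset[OF i _ sub]) auto
      obtain B where B: "\<And>x. \<bar>\<Phi> x\<bar> \<le> B" using continuous_compact_support_bounded[OF \<Phi>c \<Phi>0] by metis
      have 2: "integrable lebesgue (\<lambda>x. \<Phi> x * \<bar>u s x\<bar> powr p)"
        using integrable_bounded_mult[OF i[unfolded set_integrable_def] continuous_imp_lebesgue_measurable[OF \<Phi>c] B]
        by (subst mult_eq_indicator_mult[of "\<rho> + 1" \<Phi>, OF \<Phi>0])
      have 3: "integrable lebesgue (\<lambda>x. \<Phi> x * (indicator (cball 0 (R + s)) x *\<^sub>R \<bar>u s x\<bar> powr p))"
        using integrable_bounded_mult[OF 1[unfolded set_integrable_def] continuous_imp_lebesgue_measurable[OF \<Phi>c] B] .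
      have "(LINT x:cball 0 (R + s)|lebesgue. \<phi> x * \<bar>u s x\<bar> powr p) =
          (LINT x|lebesgue. \<Phi> x * (indicator (cball 0 (R + s)) x *\<^sub>R \<bar>u s x\<bar> powr p))"
        unfolding set_lebesgue_integral_def
        using s \<Phi>eq by (intro Bochner_Integration.integral_cong) (auto simp: indicator_def \<rho>_def)
      also have "\<dots> \<le> N s" unfolding N_def
        by (rule integral_mono[OF 3 2]) (use \<Phi>nn in \<open>auto simp: indicator_def\<close>)
      finally show "set_integrable lebesgue (cball 0 (R + s)) (\<lambda>x. \<bar>u s x\<bar> powr p) \<and>
       (LINT x:cball 0 (R + s)|lebesgue. \<phi> x * \<bar>u s x\<bar> powr p) \<le> N s" using 1 by blast
    qed
    have "0 \<le> (LINT x|lebesgue. u1 x * \<Phi> x)"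
      using u1 by (intro integral_nonneg_AE) (auto elim!: eventually_mono simp: \<Phi>nn)
    then show "G0 \<ge> 0" using eps by (simp add: G0_def)
    fix t assume t: "t \<in> {0<..t0}"
    \<comment> \<open>Room is made between \<open>t0\<close> and \<open>T\<close>: the time cutoff
      equals 1 from \<open>- 1\<close> up to \<open>a > t0\<close>, hence near every
      \<open>s\<close> in \<open>[0, t]\<close> including the endpoints, and the term with its time
      derivative drops out.\<close>
    obtain t2 where t2: "t0 < t2" "ereal t2 < T"
      using ereal_dense2[OF t0(2)] by auto
    define a where "a = (t0 + t2) / 2"
    have a: "t0 < a" "a < t2" using t2 by (auto simp: a_def)
    define \<psi> where "\<psi> z = time_cutoff a t2 (fst z) * \<Phi> (snd z)" for z
    have \<psi>: "spacetime_test_function T \<psi>"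
      unfolding \<psi>_def[abs_def] by (rule spacetime_test_function_product[OF ck \<Phi>0 a(2) t2(2)])
    have \<psi>1: "\<psi> (s, x) = \<Phi> x" if "- 1 \<le> s" "s \<le> a" for s x
      using time_cutoff_eq_1[OF a(2) that] by (simp add: \<psi>_def)
    have d\<psi>: "deriv (\<lambda>r. \<psi> (r, x)) s = 0" if "s \<in> {0..t}" for s x
    proof (rule DERIV_imp_deriv)
      have "((\<lambda>r. \<Phi> x) has_real_derivative 0) (at s)" by simp
      then show "((\<lambda>r. \<psi> (r, x)) has_real_derivative 0) (at s)"
        by (rule has_field_derivative_transform_within_open[where S = "{- 1<..<a}"])
           (use that t a \<psi>1 in auto)
    qed
    have g\<psi>: "grad (\<lambda>y. \<psi> (s, y)) = grad \<Phi>" if "s \<in> {0..t}" for s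
    proof -
      have "(\<lambda>y. \<psi> (s, y)) = \<Phi>" using that t a by (intro ext \<psi>1) auto
      then show ?thesis by simp
    qed
    have inner_eq: "(LINT x|lebesgue. - ut s x * deriv (\<lambda>r. \<psi> (r, x)) s + Du s x \<bullet> grad (\<lambda>y. \<psi> (s, y)) x + b s * ut s x * \<psi> (s, x))
        = b s * G s - l * F s" if s: "s \<in> {0..t}" for s
    proof -
      have s': "s \<in> {0..t0}" "s \<in> ?I" using s t I by auto
      have "(LINT x|lebesgue. - ut s x * deriv (\<lambda>r. \<psi> (r, x)) s + Du s x \<bullet> grad (\<lambda>y. \<psi> (s, y)) x + b s * ut s x * \<psi> (s, x))
          = (LINT x|lebesgue. Du s x \<bullet> grad \<Phi> x + b s * (\<Phi> x * ut s x))"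
        using s t a by (intro Bochner_Integration.integral_cong) (simp_all add: d\<psi>[OF s] g\<psi>[OF s] \<psi>1)
      also have "\<dots> = (LINT x|lebesgue. Du s x \<bullet> grad \<Phi> x) + (LINT x|lebesgue. b s * (\<Phi> x * ut s x))"
      proof (rule Bochner_Integration.integral_add)
        show "integrable lebesgue (\<lambda>x. Du s x \<bullet> grad \<Phi> x)"
          by (rule weak_gradient_laplace(1)[OF ck \<Phi>0 wg[OF s'(2)]])
        show "integrable lebesgue (\<lambda>x. b s * (\<Phi> x * ut s x))"
          by (rule Bochner_Integration.integrable_mult_right[OF int_ut[OF s'(2)]])
      qed
      also have "\<dots> = b s * G s - l * F s" using inner[OF s'(1)] by (simp add: G_def)
      finally show ?thesis .
    qed
    have sub: "{0..t} \<subseteq> ?I" using t I by auto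
    have cFt: "continuous_on {0..t} F" and cGt: "continuous_on {0..t} G" and cbt: "continuous_on {0..t} b"
      using continuous_on_subset[OF cF sub] continuous_on_subset[OF cG sub] continuous_on_subset[OF b] by auto
    have c1: "continuous_on {0..t} (\<lambda>s. b s * G s)" and c2: "continuous_on {0..t} (\<lambda>s. l * F s)"
      by (intro continuous_intros cFt cGt cbt)+
    have "(LINT s:{0..t}|lebesgue. (LINT x|lebesgue.
            - ut s x * deriv (\<lambda>r. \<psi> (r, x)) s + Du s x \<bullet> grad (\<lambda>y. \<psi> (s, y)) x + b s * ut s x * \<psi> (s, x)))
        = (LINT s:{0..t}|lebesgue. b s * G s - l * F s)"
    proof (rule set_lebesgue_integral_cong)
      show "{0..t} \<in> sets lebesgue" by simp
    qed (intro allI impI inner_eq)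
    also have "\<dots> = integral {0..t} (\<lambda>s. b s * G s - l * F s)"
      by (rule set_LINT_eq_integral(2)[OF continuous_on_diff[OF c1 c2]])
    also have "\<dots> = integral {0..t} (\<lambda>s. b s * G s) - integral {0..t} (\<lambda>s. l * F s)"
      by (rule integral_diff[OF integrable_continuous_real[OF c1] integrable_continuous_real[OF c2]])
    finally have e1: "(LINT s:{0..t}|lebesgue. (LINT x|lebesgue.
            - ut s x * deriv (\<lambda>r. \<psi> (r, x)) s + Du s x \<bullet> grad (\<lambda>y. \<psi> (s, y)) x + b s * ut s x * \<psi> (s, x)))
        = integral {0..t} (\<lambda>s. b s * G s) - integral {0..t} (\<lambda>s. l * F s)" .
    have e2: "(LINT x|lebesgue. ut t x * \<psi> (t, x)) = G t"
      using t a \<psi>1[of t] by (simp add: G_def mult.commute)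
    have e3: "\<epsilon> * (LINT x|lebesgue. u1 x * \<psi> (0, x)) = G0"
      using t a \<psi>1[of 0] by (simp add: G0_def)
    have e4: "(LINT s:{0..t}|lebesgue. (LINT x|lebesgue. \<bar>u s x\<bar> powr p * \<psi> (s, x))) = (LINT s:{0..t}|lebesgue. N s)"
      by (rule set_lebesgue_integral_cong) (use t a \<psi>1 in \<open>auto simp: N_def mult.commute\<close>)
    have "t \<in> ?I" "0 < t" using t sub by auto
    from weak[OF this \<psi>] show "G t + integral {0..t} (\<lambda>s. b s * G s) =
        G0 + integral {0..t} (\<lambda>s. l * F s) + (LINT s:{0..t}|lebesgue. N s)"
      unfolding e1 e2 e3 e4 by linarith
  qed
qed

section \<open>The lifespan bound\<close>


text \<open>\<open>N\<close> is merely integrable in time, so it is replaced by a continuous lower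
  bound \<open>\<nu>\<close>. The excess, the integral of \<open>N - \<nu>\<close>, is nondecreasing
  and takes the role of the remainder \<open>D\<close> in
  \<open>integrating_factor_le\<close>.\<close>

lemma functional_inequality:
  fixes F G N \<nu> :: "real \<Rightarrow> real"
  assumes \<mu>: "\<mu> > 0" and cF: "continuous_on {0..T} F" and cG: "continuous_on {0..T} G"
    and N: "set_integrable lebesgue {0..T} N"
    and \<nu>: "continuous_on {0..T} \<nu>" "AE s in lebesgue. s \<in> {0..T} \<longrightarrow> \<nu> s \<le> N s"
    and G0: "G0 \<ge> 0"
    and eq: "\<And>t. t \<in> {0<..T} \<Longrightarrow> G t + integral {0..t} (\<lambda>s. damping \<mu> k s * G s) =
        G0 + integral {0..t} (\<lambda>s. l * F s) + (LINT s:{0..t}|lebesgue. N s)"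
    and t: "t \<in> {0<..T}"
  shows "integral {0..t} (\<lambda>s. growth \<mu> k s * (l * F s + \<nu> s)) \<le> growth \<mu> k t * G t"
proof -
  define D where "D t = (LINT s:{0..t}|lebesgue. N s) - integral {0..t} \<nu>" for t
  have sub: "{0..t} \<subseteq> {0..T}" if "t \<le> T" for t using that by auto
  have Nt: "set_integrable lebesgue {0..t} N" if "t \<le> T" for t
    by (rule set_integrable_subset[OF N _ sub[OF that]]) simp
  have c\<nu>: "continuous_on {0..t} \<nu>" and clF: "continuous_on {0..t} (\<lambda>s. l * F s)" if "t \<le> T" for t
    by (intro continuous_on_mult continuous_on_const continuous_on_subset[OF \<nu>(1) sub[OF that]]
        continuous_on_subset[OF cF sub[OF that]])+
  have i: "set_integrable lebesgue {0..t} (\<lambda>s. N s - \<nu> s)" if "t \<le> T" for t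
    by (rule set_integral_diff(1)[OF Nt[OF that] set_LINT_eq_integral(1)[OF c\<nu>[OF that]]])
  have D: "D t = (LINT s:{0..t}|lebesgue. N s - \<nu> s)" if "t \<le> T" for t
    unfolding D_def set_integral_diff(2)[OF Nt[OF that] set_LINT_eq_integral(1)[OF c\<nu>[OF that]]]
      set_LINT_eq_integral(2)[OF c\<nu>[OF that]] ..
  have mono: "D s \<le> D t" if "0 \<le> s" "s \<le> t" "t \<le> T" for s t
  proof -
    have "AE x in lebesgue. indicator {0..s} x *\<^sub>R (N x - \<nu> x) \<le> indicator {0..t} x *\<^sub>R (N x - \<nu> x)"
      using \<nu>(2) by eventually_elim (use that in \<open>auto simp: indicator_def\<close>)
    moreover have "s \<le> T" using that by simp
    ultimately show ?thesis
      unfolding D[OF \<open>s \<le> T\<close>] D[OF that(3)] set_lebesgue_integral_def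
      by (intro integral_mono_AE i[unfolded set_integrable_def] that) auto
  qed
  have D0: "0 \<le> D 0"
  proof -
    have "(0::real) \<le> T" using t by simp
    then show ?thesis unfolding D[OF \<open>0 \<le> T\<close>] set_lebesgue_integral_def
      by (intro integral_nonneg_AE eventually_mono[OF \<nu>(2)]) (auto simp: indicator_def)
  qed
  have "G0 + integral {0..t} (\<lambda>s. growth \<mu> k s * (l * F s + \<nu> s)) \<le> growth \<mu> k t * G t"
  proof (rule integrating_factor_le[where T = T and b = "damping \<mu> k" and D = D])
    show "continuous_on {0..T} (damping \<mu> k)" by (rule continuous_on_subset[OF continuous_on_damping]) auto
    show "continuous_on {0..T} (\<lambda>s. l * F s + \<nu> s)"
      by (intro continuous_on_add clF c\<nu>) simp_all
    fix t assume t: "t \<in> {0<..T}"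
    then have tT: "t \<le> T" by simp
    have "integral {0..t} (\<lambda>s. l * F s + \<nu> s) = integral {0..t} (\<lambda>s. l * F s) + integral {0..t} \<nu>"
      by (rule integral_add[OF integrable_continuous_real[OF clF[OF tT]] integrable_continuous_real[OF c\<nu>[OF tT]]])
    then show "G t + integral {0..t} (\<lambda>s. damping \<mu> k s * G s) = G0 + integral {0..t} (\<lambda>s. l * F s + \<nu> s) + D t"
      using eq[OF t] by (simp add: D_def)
  qed (use \<mu> damping_nonneg DERIV_growth growth_ge_1[of \<mu> _ k] growth_0 mono D0 cG t in
        \<open>auto intro: order.strict_trans2[OF zero_less_one]\<close>)
  then show ?thesis using G0 by simp
qed

lemma powr_comparable:
  fixes x y \<theta> :: real
  assumes "K \<ge> 1" "x > 0" "x / K \<le> y" "y \<le> K * x"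
  shows "K powr (- \<bar>\<theta>\<bar>) * x powr \<theta> \<le> y powr \<theta>"
proof (cases "\<theta> \<ge> 0")
  case True
  have "(x / K) powr \<theta> \<le> y powr \<theta>" using assms True by (intro powr_mono2) auto
  then show ?thesis using assms True by (simp add: powr_divide powr_minus field_simps)
next
  case False
  have "0 < x / K" using assms by simp
  then have "y > 0" using assms by linarith
  have "(K * x) powr \<theta> \<le> y powr \<theta>" using assms False \<open>y > 0\<close> by (intro powr_mono2') auto
  then show ?thesis using assms False by (simp add: powr_mult)
qed

lemma partial2_const: "partial2 (\<lambda>_. c) i x = 0"
  by (simp add: partial2_def frechet_derivative_const)

text \<open>If the integral were 0, the nonnegative integrand, and with it \<open>u0\<close>, would
  vanish almost everywhere in the ball, and outside it by the support condition.\<close>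

lemma integral_pos_of_not_AE_0:
  fixes u0 w :: "'a::euclidean_space \<Rightarrow> real"
  assumes "L1loc u0" "AE x in lebesgue. u0 x \<ge> 0" "\<not> (AE x in lebesgue. u0 x = 0)"
    and "ess_support u0 \<subseteq> cball 0 R" and w: "continuous_on UNIV w" "\<And>x. w x > 0"
  shows "0 < (LINT x:cball 0 R|lebesgue. w x * u0 x)"
proof -
  let ?f = "\<lambda>x. indicator (cball 0 R) x *\<^sub>R (w x * u0 x)"
  have "set_integrable lebesgue (cball 0 R) u0" using assms(1) by (auto simp: L1loc_on_def)
  then have i: "integrable lebesgue (\<lambda>x. indicator (cball 0 R) x *\<^sub>R u0 x)" by (simp add: set_integrable_def)
  have "bounded (w ` cball 0 R)"
    by (intro compact_imp_bounded compact_continuous_image continuous_on_subset[OF w(1)]) auto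
  then obtain B where "\<forall>y\<in>w ` cball 0 R. norm y \<le> B" unfolding bounded_iff by metis
  then have B: "\<bar>w x\<bar> \<le> B" if "x \<in> cball 0 R" for x using that by simp
  have int: "integrable lebesgue ?f"
  proof (rule Bochner_Integration.integrable_bound)
    show "integrable lebesgue (\<lambda>x. B * (indicator (cball 0 R) x *\<^sub>R u0 x))" using i by simp
    have "(\<lambda>x. w x * (indicator (cball 0 R) x *\<^sub>R u0 x)) \<in> borel_measurable lebesgue"
      by (intro borel_measurable_times continuous_imp_lebesgue_measurable w borel_measurable_integrable[OF i])
    then show "?f \<in> borel_measurable lebesgue" by (simp add: mult.left_commute)
    show "AE x in lebesgue. norm (?f x) \<le> norm (B * (indicator (cball 0 R) x *\<^sub>R u0 x))"
    proof (rule AE_I2)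
      fix x
      show "norm (?f x) \<le> norm (B * (indicator (cball 0 R) x *\<^sub>R u0 x))"
      proof (cases "x \<in> cball 0 R")
        case True
        then have "\<bar>w x\<bar> \<le> \<bar>B\<bar>" using B[OF True] by linarith
        then show ?thesis using True by (simp add: abs_mult mult_right_mono)
      qed simp
    qed
  qed
  have nn: "AE x in lebesgue. 0 \<le> ?f x"
    using assms(2) by eventually_elim (simp add: less_imp_le[OF w(2)])
  have "(LINT x|lebesgue. ?f x) \<noteq> 0"
  proof
    assume "(LINT x|lebesgue. ?f x) = 0"
    then have "AE x in lebesgue. ?f x = 0" using integral_nonneg_eq_0_iff_AE[OF int nn] by simp
    then have "AE x in lebesgue. u0 x = 0"
      using ess_support_AE[OF assms(4)]
    proof eventually_elim
      case (elim x)
      then show ?case using w(2)[of x] by (cases "x \<in> cball 0 R") auto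
    qed
    then show False using assms(3) by simp
  qed
  moreover have "0 \<le> (LINT x|lebesgue. ?f x)" by (rule integral_nonneg_AE[OF nn])
  ultimately show ?thesis by (simp add: set_lebesgue_integral_def)
qed

text \<open>\<open>C\<close> is fixed before \<open>\<epsilon>\<close>, \<open>T\<close>,
  \<open>u\<close> and \<open>t\<close>. A bound at each time \<open>t >= 1\<close> below
  \<open>T\<close> serves both claims of the theorem: an infinite \<open>T\<close> contradicts it
  for large \<open>t\<close>, and a large finite \<open>T\<close> is estimated by taking
  \<open>t = T / 2\<close>.\<close>

lemma lifespan_bound:
  fixes u0 u1 :: "'a::euclidean_space \<Rightarrow> real" and k :: nat
  assumes \<mu>: "\<mu> > 0" and p: "p > 1" and R: "R > 0"
    and u0: "L1loc u0" "AE x in lebesgue. u0 x \<ge> 0" "\<not> (AE x in lebesgue. u0 x = 0)" "ess_support u0 \<subseteq> cball 0 R"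
    and u1: "AE x in lebesgue. u1 x \<ge> 0"
  obtains C where "C > 0"
    and "\<And>\<epsilon> T u t. \<epsilon> > 0 \<Longrightarrow> weak_solution (damping \<mu> k) (\<lambda>y z. \<bar>y\<bar> powr p) \<epsilon> u0 u1 R T u \<Longrightarrow> 1 \<le> t \<Longrightarrow> ereal t < T \<Longrightarrow>
      t powr strauss_gamma DIM('a) p * growth \<mu> k t powr (- (p * (p - 1))) * \<epsilon> powr (p * (p - 1)) \<le> C"
proof -
  define n where "n = real DIM('a)"
  define q where "q = p / (p - 1)"
  have q: "q > 0" using p by (simp add: q_def)
  \<comment> \<open>Hoelder's inequality produces the exponent
    \<open>(n - 1 - (n - 1) / 2 * q) * (1 - p)\<close>, which simplifies to this because
    \<open>q * (1 - p) = - p\<close>.\<close>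
  define \<theta> where "\<theta> = (n - 1) * (1 - p / 2)"
  define \<omega> where "\<omega> = unit_ball_vol n"
  have om: "\<omega> > 0" by (simp add: \<omega>_def n_def)
  define r where "r = 1 + R"
  \<comment> \<open>Large enough for \<open>t / K <= r + t / 2\<close> and for
    \<open>r + x <= K * t\<close> whenever \<open>1 <= t\<close> and \<open>x <= t\<close>.\<close>
  define K where "K = r + 2"
  have rK: "r \<ge> 1" "K \<ge> 1" using R by (auto simp: r_def K_def)
  obtain C1 where C1: "C1 > 0" "\<And>\<rho>. \<rho> \<ge> 0 \<Longrightarrow> (LINT x:cball (0::'a) \<rho>|lebesgue. spherical_exp x powr q)
      \<le> C1 * (exp (q * \<rho>) * (1 + \<rho>) powr (n - 1 - (n - 1) / 2 * q))"
    using spherical_exp_integral_le[OF q] unfolding n_def by metis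
  have sc: "continuous_on UNIV (spherical_exp :: 'a \<Rightarrow> real)" by (rule continuous_on_spherical_exp)
  have sp: "spherical_exp x > 0" for x :: 'a using spherical_exp_ge_1[of x] by linarith
  define I0 where "I0 = (LINT x:cball 0 R|lebesgue. spherical_exp x * u0 x)"
  define J0 where "J0 = (LINT x:cball 0 R|lebesgue. 1 * u0 x)"
  have I0: "I0 > 0" unfolding I0_def by (rule integral_pos_of_not_AE_0[OF u0 sc sp])
  have J0: "J0 > 0" unfolding J0_def by (rule integral_pos_of_not_AE_0[OF u0]) auto
  \<comment> \<open>The part of \<open>A powr p * B powr (1 - p)\<close> below that depends neither
    on \<open>\<epsilon>\<close> nor on time; \<open>exp (- p * R)\<close> is left over because the
    ball has radius \<open>R + s\<close> while the lower bound of \<open>F\<close> grows like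
    \<open>exp s\<close>.\<close>
  define \<kappa>0 where "\<kappa>0 = (I0 / 2) powr p * C1 powr (1 - p) * exp (- p * R)"
  have k0: "\<kappa>0 > 0" using I0 C1 by (simp add: \<kappa>0_def)
  \<comment> \<open>The first factor stems from \<open>power_growth\<close>, the second from its
    evaluation at \<open>t / 2\<close>: the square gives 1/4 and \<open>powr_comparable\<close> the
    power of \<open>K\<close>.\<close>
  define c where "c = 2 powr (- \<bar>\<theta>\<bar>) / 8 * (K powr (- \<bar>\<theta>\<bar>) / 4)"
  have c: "c > 0" using rK by (simp add: c_def)
  \<comment> \<open>The factor \<open>2 powr (- \<mu>)\<close> is the price of
    \<open>growth_double\<close>; the rest comes from the volume bound
    \<open>\<omega> * (K * t) powr n\<close>, raised to \<open>1 - p\<close> and stripped of its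
    power of \<open>t\<close>.\<close>
  define a where "a = 2 powr (- \<mu>) * (\<omega> powr (1 - p) * K powr (n * (1 - p)))"
  have a: "a > 0" using om rK by (simp add: a_def)
  define Cp where "Cp = 2 / (1 - 2 powr (- (p - 1) / 2))\<^sup>2"
  have Cp: "Cp > 0"
  proof -
    have "2 powr (- (p - 1) / 2) < (1::real)" using p by (intro powr_less_one) auto
    then show ?thesis using p by (simp add: Cp_def)
  qed
  \<comment> \<open>The 1/4 comes from the squared length \<open>t - t / 2\<close> of the interval
    on which the doubling argument runs.\<close>
  define d where "d = a / 4 * (\<kappa>0 * c) powr (p - 1)"
  have d: "d > 0" using a k0 c by (simp add: d_def)
  let ?m = "growth \<mu> k"
  have m: "?m s \<ge> 1" if "s \<ge> 0" for s using growth_ge_1[OF \<mu> that] .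
  have m0: "?m s > 0" if "s \<ge> 0" for s using m[OF that] by linarith
  have cm: "continuous_on {0..} ?m"
    by (rule DERIV_continuous_on[OF has_field_derivative_at_within[OF DERIV_growth]]) simp
  show thesis
  proof (rule that[of "Cp / d"])
    show "Cp / d > 0" using Cp d by simp
    fix \<epsilon> T u t
    assume eps: "\<epsilon> > (0::real)" and ws: "weak_solution (damping \<mu> k) (\<lambda>y z. \<bar>y\<bar> powr p) \<epsilon> u0 u1 R T u"
      and t1: "1 \<le> t" and tT: "ereal t < T"
    have t: "0 < t" using t1 by simp
    have cmt: "continuous_on {0..t} ?m" by (rule continuous_on_subset[OF cm]) auto
    obtain F G N G0 where
      F: "\<And>s. s \<in> {0..t} \<Longrightarrow> F s = (LINT x:cball 0 (R + s)|lebesgue. spherical_exp x * u s x)"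
        "\<And>s. s \<in> {0..t} \<Longrightarrow> set_integrable lebesgue (cball 0 (R + s)) (\<lambda>x. spherical_exp x * u s x)"
        "F 0 = \<epsilon> * I0" "continuous_on {0..t} F" "continuous_on {0..t} G"
        "\<And>s. s \<in> {0<..<t} \<Longrightarrow> (F has_real_derivative G s) (at s)"
      and N: "set_integrable lebesgue {0..t} N" "\<And>s. N s \<ge> 0" and G0: "G0 \<ge> 0"
      and eqF: "\<And>s. s \<in> {0<..t} \<Longrightarrow> G s + integral {0..s} (\<lambda>s. damping \<mu> k s * G s) =
        G0 + integral {0..s} (\<lambda>s. 1 * F s) + (LINT s:{0..s}|lebesgue. N s)"
      unfolding I0_def
      by (rule weak_solution_functional[OF ws continuous_on_damping eps R u0(4) u1 t tT, where \<phi> = spherical_exp and l = 1])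
         (auto simp: ck_spherical_exp spherical_exp_laplace less_imp_le[OF sp])
    obtain U V M M0 where
      U: "\<And>s. s \<in> {0..t} \<Longrightarrow> U s = (LINT x:cball 0 (R + s)|lebesgue. 1 * u s x)"
        "\<And>s. s \<in> {0..t} \<Longrightarrow> set_integrable lebesgue (cball 0 (R + s)) (\<lambda>x. 1 * u s x)"
        "U 0 = \<epsilon> * J0" "continuous_on {0..t} U" "continuous_on {0..t} V"
        "\<And>s. s \<in> {0<..<t} \<Longrightarrow> (U has_real_derivative V s) (at s)"
      and M: "set_integrable lebesgue {0..t} M"
        "AE s in lebesgue. s \<in> {0..t} \<longrightarrow> set_integrable lebesgue (cball 0 (R + s)) (\<lambda>x. \<bar>u s x\<bar> powr p) \<and>
          (LINT x:cball 0 (R + s)|lebesgue. 1 * \<bar>u s x\<bar> powr p) \<le> M s"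
      and M0: "M0 \<ge> 0"
      and eqU: "\<And>s. s \<in> {0<..t} \<Longrightarrow> V s + integral {0..s} (\<lambda>s. damping \<mu> k s * V s) =
        M0 + integral {0..s} (\<lambda>s. 0 * U s) + (LINT s:{0..s}|lebesgue. M s)"
      unfolding J0_def
      by (rule weak_solution_functional[OF ws continuous_on_damping eps R u0(4) u1 t tT, where \<phi> = "\<lambda>_. 1" and l = 0])
         (auto simp: partial2_const)
    \<comment> \<open>Here the nonlinear term enters through its sign alone, as the lower bound
      \<open>\<nu> = 0\<close>.\<close>
    have Fge: "\<epsilon> * I0 * exp s / (2 * ?m s) \<le> F s" if "s \<in> {0..t}" for s
    proof -
      have "integral {0..s} (\<lambda>s. ?m s * F s) \<le> ?m s * G s" if "s \<in> {0<..t}" for s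
        using functional_inequality[OF \<mu> F(4,5) N(1) continuous_on_const[of _ 0] _ G0 eqF that] N(2) by simp
      then have "F 0 * exp s / (2 * ?m s) \<le> F s"
        using that \<mu> I0 eps m F(3,4,6)
        by (intro exponential_growth[where b = "damping \<mu> k" and G = G and T = t])
           (auto intro: damping_nonneg DERIV_growth growth_0 growth_mono)
      then show ?thesis by (simp add: F(3))
    qed
    define \<kappa> where "\<kappa> = \<epsilon> powr p * \<kappa>0"
    have kap: "\<kappa> > 0" using eps k0 by (simp add: \<kappa>_def)
    \<comment> \<open>The exponentials match: \<open>exp (p * s)\<close> from the lower bound of
      \<open>F\<close> cancels \<open>exp (- p * s)\<close> from the weight integral, so that only
      powers of \<open>r + s\<close> and of the damping factor depend on time.\<close>
    have \<nu>1: "AE s in lebesgue. s \<in> {0..t} \<longrightarrow> \<kappa> * ?m s powr (- p) * (r + s) powr \<theta> \<le> M s"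
      using M(2)
    proof (eventually_elim, intro impI)
      fix s assume s: "s \<in> {0..t}" and "s \<in> {0..t} \<longrightarrow> set_integrable lebesgue (cball 0 (R + s)) (\<lambda>x. \<bar>u s x\<bar> powr p) \<and>
          (LINT x:cball 0 (R + s)|lebesgue. 1 * \<bar>u s x\<bar> powr p) \<le> M s"
      then have i: "set_integrable lebesgue (cball 0 (R + s)) (\<lambda>x. \<bar>u s x\<bar> powr p)"
        and le: "(LINT x:cball 0 (R + s)|lebesgue. \<bar>u s x\<bar> powr p) \<le> M s" by auto
      define A where "A = \<epsilon> * I0 * exp s / (2 * ?m s)"
      define B where "B = C1 * (exp (q * (R + s)) * (1 + (R + s)) powr (n - 1 - (n - 1) / 2 * q))"
      have ms: "?m s > 0" using m0 s by simp
      have B: "B > 0" using C1 R s by (simp add: B_def)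
      have A: "A > 0" using eps I0 ms by (simp add: A_def)
      have "A powr p * B powr (1 - p) \<le> (LINT x:cball 0 (R + s)|lebesgue. \<bar>u s x\<bar> powr p)"
      proof (rule Holder_lower_bound[OF p _ sp F(2)[OF s] i])
        show "set_integrable lebesgue (cball (0::'a) (R + s)) (\<lambda>x. spherical_exp x powr (p / (p - 1)))"
          using sp by (intro set_integrable_continuous_lebesgue continuous_on_powr sc continuous_on_const) (auto simp: less_imp_neq[symmetric])
        show "A \<le> (LINT x:cball 0 (R + s)|lebesgue. spherical_exp x * u s x)"
          using Fge[OF s] F(1)[OF s] by (simp add: A_def)
        show "(LINT x:cball 0 (R + s)|lebesgue. spherical_exp (x::'a) powr (p / (p - 1))) \<le> B"
          using C1(2)[of "R + s"] R s by (simp add: B_def q_def)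
      qed (use A B in auto)
      also have "A powr p * B powr (1 - p) = \<kappa> * ?m s powr (- p) * (r + s) powr \<theta>"
      proof -
        have 1: "A powr p = \<epsilon> powr p * (I0 / 2) powr p * exp (p * s) * ?m s powr (- p)"
          using eps I0 ms by (simp add: A_def powr_mult powr_divide powr_minus exp_powr_real field_simps)
        have q1: "q * (1 - p) = - p" using p by (simp add: q_def field_simps)
        have 2: "exp (q * (R + s)) powr (1 - p) = exp (- p * R) * exp (- p * s)"
        proof -
          have "q * (R + s) * (1 - p) = (q * (1 - p)) * (R + s)" by (simp add: mult_ac)
          also have "\<dots> = - p * R + - p * s" unfolding q1 by (simp add: algebra_simps)
          finally show ?thesis by (simp add: exp_powr_real exp_add[symmetric])
        qed
        have 3: "((1 + (R + s)) powr (n - 1 - (n - 1) / 2 * q)) powr (1 - p) = (r + s) powr \<theta>"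
        proof -
          have "(n - 1 - (n - 1) / 2 * q) * (1 - p) = (n - 1) * (1 - p) - (n - 1) / 2 * (q * (1 - p))"
            by (simp add: left_diff_distrib mult.assoc)
          also have "\<dots> = \<theta>" unfolding q1 \<theta>_def by (simp add: field_simps)
          finally show ?thesis by (simp add: powr_powr r_def add.assoc)
        qed
        have 4: "B powr (1 - p) = C1 powr (1 - p) * (exp (- p * R) * exp (- p * s) * (r + s) powr \<theta>)"
          unfolding B_def powr_mult 2 3 ..
        have "A powr p * B powr (1 - p) = \<epsilon> powr p * \<kappa>0 * ?m s powr (- p) * (r + s) powr \<theta> * (exp (p * s) * exp (- p * s))"
          unfolding 1 4 \<kappa>0_def by (simp only: mult_ac)
        moreover have "exp (p * s) * exp (- p * s) = 1" by (simp flip: exp_add)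
        ultimately show ?thesis by (simp add: \<kappa>_def)
      qed
      also note le
      finally show "\<kappa> * ?m s powr (- p) * (r + s) powr \<theta> \<le> M s" .
    qed
    have c\<nu>1: "continuous_on {0..t} (\<lambda>s. \<kappa> * ?m s powr (- p) * (r + s) powr \<theta>)"
      using m0 rK by (intro continuous_intros cmt) (auto simp: less_imp_neq[symmetric] add_pos_nonneg)
    have V1: "integral {0..s} (\<lambda>s. ?m s * (\<kappa> * ?m s powr (- p) * (r + s) powr \<theta>)) \<le> ?m s * V s" if "s \<in> {0<..t}" for s
      using functional_inequality[OF \<mu> U(4,5) M(1) c\<nu>1 \<nu>1 M0 eqU that] by simp
    have Uge: "\<kappa> * 2 powr (- \<bar>\<theta>\<bar>) / 8 * ?m s powr (- p) * (r + s) powr \<theta> * s\<^sup>2 \<le> U s" if "s \<in> {0..t}" for s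
      using that U(3,4,6) V1 J0 eps kap
      by (intro power_growth[OF cmt _ _ p rK(1)]) (auto intro: m growth_mono[OF \<mu>])
    have U0: "0 \<le> U s" if "s \<in> {0..t}" for s
    proof -
      have "0 \<le> \<kappa> * 2 powr (- \<bar>\<theta>\<bar>) / 8 * ?m s powr (- p) * (r + s) powr \<theta> * s\<^sup>2" using kap by simp
      then show ?thesis using Uge[OF that] by linarith
    qed
    define \<nu>2 where "\<nu>2 s = \<bar>U s\<bar> powr p * (\<omega> * (r + s) powr n) powr (1 - p)" for s
    have \<nu>2: "AE s in lebesgue. s \<in> {0..t} \<longrightarrow> \<nu>2 s \<le> M s"
      using M(2)
    proof (eventually_elim, intro impI)
      fix s assume s: "s \<in> {0..t}" and "s \<in> {0..t} \<longrightarrow> set_integrable lebesgue (cball 0 (R + s)) (\<lambda>x. \<bar>u s x\<bar> powr p) \<and>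
          (LINT x:cball 0 (R + s)|lebesgue. 1 * \<bar>u s x\<bar> powr p) \<le> M s"
      then have i: "set_integrable lebesgue (cball 0 (R + s)) (\<lambda>x. \<bar>u s x\<bar> powr p)"
        and le: "(LINT x:cball 0 (R + s)|lebesgue. \<bar>u s x\<bar> powr p) \<le> M s" by auto
      have "U s powr p * (\<omega> * (r + s) powr n) powr (1 - p) \<le> (LINT x:cball 0 (R + s)|lebesgue. \<bar>u s x\<bar> powr p)"
      proof (rule Holder_lower_bound[OF p _ _ U(2)[OF s] i])
        show "set_integrable lebesgue (cball (0::'a) (R + s)) (\<lambda>x. 1 powr (p / (p - 1)))"
          by (intro set_integrable_continuous_lebesgue continuous_on_const) auto
        show "(LINT x:cball (0::'a) (R + s)|lebesgue. 1 powr (p / (p - 1))) \<le> \<omega> * (r + s) powr n"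
        proof -
          have Rs: "R + s \<ge> 0" "R + s > 0" using R s by auto
          have "(LINT x:cball (0::'a) (R + s)|lebesgue. 1 powr (p / (p - 1))) = measure lebesgue (cball (0::'a) (R + s))"
            by (simp add: set_lebesgue_integral_def)
          also have "\<dots> = \<omega> * (R + s) ^ DIM('a)"
            using content_cball[OF Rs(1), of "0::'a"] by (simp add: \<omega>_def n_def)
          also have "(R + s) ^ DIM('a) = (R + s) powr n" using Rs by (simp add: n_def powr_realpow)
          also have "\<omega> * (R + s) powr n \<le> \<omega> * (r + s) powr n"
            using om Rs by (intro mult_left_mono powr_mono2) (auto simp: n_def r_def)
          finally show ?thesis .
        qed
        show "U s \<le> (LINT x:cball 0 (R + s)|lebesgue. 1 * u s x)" using U(1)[OF s] by simp
        show "0 < \<omega> * (r + s) powr n" using om rK s by simp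
      qed (use U0[OF s] in auto)
      then show "\<nu>2 s \<le> M s" using le U0[OF s] by (simp add: \<nu>2_def)
    qed
    have c\<nu>2: "continuous_on {0..t} \<nu>2"
      unfolding \<nu>2_def using om rK p
      by (intro continuous_on_mult continuous_on_powr' continuous_on_powr continuous_intros U(4))
         (auto simp: add_pos_nonneg less_imp_neq[symmetric])
    have V2: "integral {0..s} (\<lambda>s. ?m s * \<nu>2 s) \<le> ?m s * V s" if "s \<in> {0<..t}" for s
      using functional_inequality[OF \<mu> U(4,5) M(1) c\<nu>2 \<nu>2 M0 eqU that] by simp
    \<comment> \<open>The damping factor is at least \<open>growth \<mu> k (t / 2)\<close> under the
      integral and at most \<open>2 powr \<mu>\<close> times that value outside it, so it cancels up
      to a constant.\<close>
    have V3: "a * t powr (n * (1 - p)) * integral {t / 2..s} (\<lambda>s. \<bar>U s\<bar> powr p) \<le> V s" if s: "s \<in> {t / 2<..<t}" for s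
    proof -
      have sT: "s \<in> {0<..t}" "0 \<le> s" "s \<le> t" using s t by auto
      have cU: "continuous_on {t / 2..s} (\<lambda>s. \<bar>U s\<bar> powr p)"
        using s t p by (intro continuous_on_powr' continuous_intros continuous_on_subset[OF U(4)]) auto
      have cm\<nu>: "continuous_on {0..t} (\<lambda>s. ?m s * \<nu>2 s)" by (intro continuous_on_mult cmt c\<nu>2)
      have i0: "(\<lambda>s. ?m s * \<nu>2 s) integrable_on {x..y}" if "0 \<le> x" "y \<le> t" for x y
        by (rule integrable_continuous_real, rule continuous_on_subset[OF cm\<nu>]) (use that in auto)
      let ?b = "?m (t / 2) * (\<omega> powr (1 - p) * (K powr (n * (1 - p)) * t powr (n * (1 - p))))"
      have "?b * integral {t / 2..s} (\<lambda>s. \<bar>U s\<bar> powr p) = integral {t / 2..s} (\<lambda>s. ?b * \<bar>U s\<bar> powr p)"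
        by simp
      also have "\<dots> \<le> integral {t / 2..s} (\<lambda>s. ?m s * \<nu>2 s)"
      proof (rule integral_le)
        show "(\<lambda>s. ?b * \<bar>U s\<bar> powr p) integrable_on {t / 2..s}"
          by (intro integrable_continuous_real continuous_on_mult continuous_on_const cU)
        show "(\<lambda>s. ?m s * \<nu>2 s) integrable_on {t / 2..s}" using s t by (intro i0) auto
        fix x assume x: "x \<in> {t / 2..s}"
        then have xt: "0 \<le> x" "t / 2 \<le> x" "x \<le> t" using s t by auto
        have "(K * t) powr (n * (1 - p)) \<le> (r + x) powr (n * (1 - p))"
        proof (rule powr_mono2')
          show "n * (1 - p) \<le> 0" using p by (intro mult_nonneg_nonpos) (auto simp: n_def)
          have "r * 1 \<le> r * t" using t1 rK by (intro mult_left_mono) auto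
          then show "r + x \<le> K * t" using xt t by (simp add: K_def algebra_simps)
        qed (use xt rK in auto)
        then have e: "K powr (n * (1 - p)) * t powr (n * (1 - p)) \<le> (r + x) powr (n * (1 - p))"
          by (simp add: powr_mult)
        have "?b \<le> ?m x * (\<omega> powr (1 - p) * (r + x) powr (n * (1 - p)))"
          using xt t m0[of x] growth_mono[OF \<mu>, of "t / 2" x k]
          by (intro mult_mono mult_left_mono e) auto
        also have "\<omega> powr (1 - p) * (r + x) powr (n * (1 - p)) = (\<omega> * (r + x) powr n) powr (1 - p)"
          by (simp add: powr_mult powr_powr)
        finally have "?b * \<bar>U x\<bar> powr p \<le> ?m x * (\<omega> * (r + x) powr n) powr (1 - p) * \<bar>U x\<bar> powr p"
          by (intro mult_right_mono) auto
        then show "?b * \<bar>U x\<bar> powr p \<le> ?m x * \<nu>2 x" by (simp add: \<nu>2_def mult_ac)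
      qed
      also have "\<dots> \<le> integral {0..s} (\<lambda>s. ?m s * \<nu>2 s)"
      proof (rule integral_subset_le)
        show "\<forall>x\<in>{0..s}. 0 \<le> ?m x * \<nu>2 x"
        proof
          fix x assume "x \<in> {0..s}"
          then have "0 < ?m x" by (intro m0) simp
          then show "0 \<le> ?m x * \<nu>2 x" by (simp add: \<nu>2_def)
        qed
      qed (use s t i0 in auto)
      also have "\<dots> \<le> ?m s * V s" by (rule V2[OF sT(1)])
      finally have 1: "?b * integral {t / 2..s} (\<lambda>s. \<bar>U s\<bar> powr p) \<le> ?m s * V s" .
      have int0: "0 \<le> integral {t / 2..s} (\<lambda>s. \<bar>U s\<bar> powr p)"
        by (intro integral_nonneg integrable_continuous_real cU) auto
      have ms: "?m s \<le> 2 powr \<mu> * ?m (t / 2)"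
      proof -
        have "?m s \<le> ?m (2 * (t / 2))" using s t by (intro growth_mono[OF \<mu>]) auto
        also have "\<dots> \<le> 2 powr \<mu> * ?m (t / 2)" using t by (intro growth_double[OF \<mu>]) auto
        finally show ?thesis .
      qed
      let ?I = "integral {t / 2..s} (\<lambda>s. \<bar>U s\<bar> powr p)"
      have "?m s * (a * t powr (n * (1 - p)) * ?I) \<le> (2 powr \<mu> * ?m (t / 2)) * (a * t powr (n * (1 - p)) * ?I)"
        using ms a int0 by (intro mult_right_mono) auto
      also have "\<dots> = (2 powr \<mu> * 2 powr (- \<mu>)) * (?b * ?I)" unfolding a_def by (simp only: mult_ac)
      also have "2 powr \<mu> * 2 powr (- \<mu>) = (1::real)" by (simp flip: powr_add)
      also have "1 * (?b * ?I) \<le> ?m s * V s" using 1 by simp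
      finally show ?thesis using m0[OF sT(2)] by simp
    qed
    \<comment> \<open>A lower bound for \<open>U (t / 2)\<close> in which the damping factor is
      already taken at \<open>t\<close>; its exponent is negative, so this only weakens the
      bound.\<close>
    define Y where "Y = \<epsilon> powr p * (\<kappa>0 * c) * ?m t powr (- p) * t powr (\<theta> + 2)"
    have Y: "Y > 0" using eps k0 c m0[of t] t by (simp add: Y_def)
    have YU: "Y \<le> U (t / 2)"
    proof -
      have h: "t / 2 \<in> {0..t}" using t by auto
      have "?m t powr (- p) \<le> ?m (t / 2) powr (- p)"
        using p t m0[of "t / 2"] by (intro powr_mono2' growth_mono[OF \<mu>]) auto
      moreover have "K powr (- \<bar>\<theta>\<bar>) * t powr \<theta> \<le> (r + t / 2) powr \<theta>"
      proof (rule powr_comparable[OF rK(2) t])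
        have "t / K \<le> t / 2" using t rK by (intro divide_left_mono) (auto simp: K_def)
        then show "t / K \<le> r + t / 2" using rK by linarith
        have "r * 1 \<le> r * t" using t1 rK by (intro mult_left_mono) auto
        then show "r + t / 2 \<le> K * t" using t by (simp add: K_def algebra_simps)
      qed
      ultimately have "\<kappa> * 2 powr (- \<bar>\<theta>\<bar>) / 8 * ?m t powr (- p) * (K powr (- \<bar>\<theta>\<bar>) * t powr \<theta>) * (t / 2)\<^sup>2
          \<le> \<kappa> * 2 powr (- \<bar>\<theta>\<bar>) / 8 * ?m (t / 2) powr (- p) * (r + t / 2) powr \<theta> * (t / 2)\<^sup>2"
        using kap by (intro mult_mono mult_left_mono) auto
      also have "\<dots> \<le> U (t / 2)" by (rule Uge[OF h])
      finally have "\<kappa> * 2 powr (- \<bar>\<theta>\<bar>) / 8 * ?m t powr (- p) * (K powr (- \<bar>\<theta>\<bar>) * t powr \<theta>) * (t / 2)\<^sup>2 \<le> U (t / 2)" .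
      moreover have "t powr (\<theta> + 2) = t powr \<theta> * t\<^sup>2" using t by (simp add: powr_add)
      ultimately show ?thesis by (simp add: Y_def c_def \<kappa>_def power2_eq_square mult_ac)
    qed
    have "(t - t / 2)\<^sup>2 * (a * t powr (n * (1 - p))) * Y powr (p - 1) \<le> Cp"
      unfolding Cp_def
    proof (rule doubling_blowup[OF p _ Y])
      show "0 < a * t powr (n * (1 - p))" using a t by simp
      show "continuous_on {t / 2..t} U" by (rule continuous_on_subset[OF U(4)]) (use t in auto)
      show "(U has_real_derivative V s) (at s)" if "s \<in> {t / 2<..<t}" for s using that t by (intro U(6)) auto
    qed (use t V3 YU in auto)
    moreover have "(t - t / 2)\<^sup>2 * (a * t powr (n * (1 - p))) * Y powr (p - 1) =
        d * (t powr strauss_gamma DIM('a) p * ?m t powr (- (p * (p - 1))) * \<epsilon> powr (p * (p - 1)))"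
    proof -
      have 1: "Y powr (p - 1) = \<epsilon> powr (p * (p - 1)) * (\<kappa>0 * c) powr (p - 1) * ?m t powr (- (p * (p - 1))) * t powr ((\<theta> + 2) * (p - 1))"
        unfolding Y_def by (simp add: powr_mult powr_powr)
      have 2: "(t - t / 2)\<^sup>2 = t powr 2 / 4" using t by (simp add: power2_eq_square)
      have 3: "t powr 2 * t powr (n * (1 - p)) * t powr ((\<theta> + 2) * (p - 1)) = t powr strauss_gamma DIM('a) p"
      proof -
        have "2 + n * (1 - p) + (\<theta> + 2) * (p - 1) = strauss_gamma DIM('a) p"
          unfolding strauss_gamma_def \<theta>_def n_def by (simp add: field_simps power2_eq_square)
        then show ?thesis by (simp flip: powr_add)
      qed
      show ?thesis unfolding 1 2 3[symmetric] d_def by (simp add: mult_ac)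
    qed
    ultimately show "t powr strauss_gamma DIM('a) p * ?m t powr (- (p * (p - 1))) * \<epsilon> powr (p * (p - 1)) \<le> Cp / d"
      using d by (simp add: le_divide_eq mult.commute)
  qed
qed


text \<open>The definite description is evaluated through the factorization
  \<open>c * ((x - s) * (s - y))\<close> with roots \<open>y < 0 < x\<close>, and the polynomial is
  positive between them. In dimension 1 the quadratic term vanishes.\<close>

lemma strauss_gamma_pos:
  assumes "n \<ge> 1" "p > 1" "n \<ge> 2 \<longrightarrow> p < strauss_exponent n"
  shows "strauss_gamma n p > 0"
proof (cases "n = 1")
  case True
  then show ?thesis using assms by (simp add: strauss_gamma_def)
next
  case False
  then have n: "n \<ge> 2" using assms by simp
  define a c where "a = (real n + 1) / 2" and "c = (real n - 1) / 2"
  have ac: "a > 0" "c > 0" using n by (auto simp: a_def c_def)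
  define D where "D = sqrt (a\<^sup>2 + 4 * c)"
  have D2: "D\<^sup>2 = a\<^sup>2 + 4 * c" using ac by (simp add: D_def)
  have "sqrt (a\<^sup>2) < D" unfolding D_def using ac by (intro real_sqrt_less_mono) simp
  then have D: "D > a" using ac by simp
  define x y where "x = (a + D) / (2 * c)" and "y = (a - D) / (2 * c)"
  have xy: "x > 0" "y < 0" using ac D by (auto simp: x_def y_def divide_neg_pos)
  have fact: "strauss_gamma n s = c * ((x - s) * (s - y))" for s
  proof -
    have s: "x + y = a / c" by (simp add: x_def y_def add_divide_distrib[symmetric])
    have "x * y = (a\<^sup>2 - D\<^sup>2) / (4 * c\<^sup>2)"
      by (simp add: x_def y_def power2_eq_square algebra_simps)
    also have "\<dots> = - 1 / c" unfolding D2 using ac by (simp add: power2_eq_square)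
    finally have p: "x * y = - 1 / c" .
    have "c * ((x - s) * (s - y)) = c * (x + y) * s - c * (x * y) - c * s\<^sup>2"
      by (simp add: power2_eq_square algebra_simps)
    also have "\<dots> = 1 + a * s - c * s\<^sup>2" unfolding s p using ac by simp
    finally show ?thesis by (simp add: strauss_gamma_def a_def c_def)
  qed
  have "strauss_exponent n = x"
    unfolding strauss_exponent_def
    by (rule the_equality) (use fact xy ac in auto)
  then show ?thesis using assms n fact[of p] xy ac by simp
qed

section \<open>From the bound at single times to the lifespan\<close>

lemma growth_le_powr:
  assumes "k \<ge> 1" "\<mu> > 0" "t \<ge> 1" "\<delta> > 0"
  shows "growth \<mu> k t \<le> ((iter_exp k + 1) powr \<delta> / \<delta>) powr \<mu> * t powr (\<delta> * \<mu>)"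
proof -
  let ?E = "iter_exp k"
  have E: "?E \<ge> 1" by (rule iter_exp_ge_1)
  have "iter_ln k (?E + t) \<le> ln (?E + t)" using assms by (intro iter_ln_le_ln) auto
  also have "\<dots> \<le> (?E + t) powr \<delta> / \<delta>" using assms E by (intro ln_powr_bound) auto
  also have "\<dots> \<le> ((?E + 1) * t) powr \<delta> / \<delta>"
  proof -
    have "?E * 1 \<le> ?E * t" using assms E by (intro mult_left_mono) auto
    then show ?thesis using assms E by (intro divide_right_mono powr_mono2) (auto simp: algebra_simps)
  qed
  also have "\<dots> = (?E + 1) powr \<delta> / \<delta> * t powr \<delta>" using E assms by (simp add: powr_mult)
  finally have "growth \<mu> k t \<le> ((?E + 1) powr \<delta> / \<delta> * t powr \<delta>) powr \<mu>"
    unfolding growth_def using assms iter_ln_pos[of k k "?E + t"] by (intro powr_mono2) auto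
  then show ?thesis by (simp only: powr_mult powr_powr)
qed

text \<open>The bound fails for large \<open>t\<close> because \<open>growth\<close> is smaller than every positive power.\<close>
lemma growth_bound_contradiction:
  assumes "k \<ge> 1" "\<mu> > 0" "\<gamma> > 0" "s > 0"
    and bound: "\<And>t. t \<ge> 1 \<Longrightarrow> t powr \<gamma> * growth \<mu> k t powr (- s) \<le> B"
  shows False
proof -
  \<comment> \<open>Since \<open>\<delta> * \<mu> * s = \<gamma> / 2\<close>, the damping factor to
    the power \<open>s\<close> costs at most a constant times \<open>t powr (\<gamma> / 2)\<close>,
    and half of the power \<open>\<gamma>\<close> survives.\<close>
  define \<delta> where "\<delta> = \<gamma> / (2 * \<mu> * s)"
  have \<delta>: "\<delta> > 0" "\<delta> * \<mu> * s = \<gamma> / 2" using assms by (auto simp: \<delta>_def)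
  define A where "A = (((iter_exp k + 1) powr \<delta> / \<delta>) powr \<mu>) powr s"
  have A: "A > 0" using \<delta> iter_exp_ge_1[of k] by (simp add: A_def)
  have *: "t powr (\<gamma> / 2) \<le> A * B" if t: "t \<ge> 1" for t
  proof -
    have g: "growth \<mu> k t > 0" using growth_ge_1[of \<mu> t k] assms t by linarith
    have "growth \<mu> k t powr s \<le> (((iter_exp k + 1) powr \<delta> / \<delta>) powr \<mu> * t powr (\<delta> * \<mu>)) powr s"
      using growth_le_powr[OF assms(1,2) t \<delta>(1)] g assms by (intro powr_mono2) auto
    also have "\<dots> = A * t powr (\<delta> * \<mu> * s)" by (simp only: A_def powr_mult powr_powr)
    also have "\<dots> = A * t powr (\<gamma> / 2)" by (simp only: \<delta>(2))
    finally have 1: "growth \<mu> k t powr s \<le> A * t powr (\<gamma> / 2)" .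
    have "t powr \<gamma> = t powr \<gamma> * growth \<mu> k t powr (- s) * growth \<mu> k t powr s"
      using g by (simp add: powr_minus)
    also have "\<dots> \<le> B * growth \<mu> k t powr s" using bound[OF t] by (intro mult_right_mono) auto
    also have "\<dots> \<le> B * (A * t powr (\<gamma> / 2))"
    proof (intro mult_left_mono 1)
      have "0 \<le> t powr \<gamma> * growth \<mu> k t powr (- s)" by simp
      then show "0 \<le> B" using bound[OF t] by linarith
    qed
    finally have "t powr (\<gamma> / 2) * t powr (\<gamma> / 2) \<le> (A * B) * t powr (\<gamma> / 2)"
      by (simp add: powr_add[symmetric] mult_ac)
    then show ?thesis using t by simp
  qed
  have AB: "A * B \<ge> 1" using *[of 1] by simp
  \<comment> \<open>Chosen so that \<open>t powr (\<gamma> / 2) = A * B + 1\<close>, which violates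
    \<open>*\<close>.\<close>
  define t where "t = (A * B + 1) powr (2 / \<gamma>)"
  have "t \<ge> 1" using AB assms by (simp add: t_def ge_one_powr_ge_zero)
  moreover have "t powr (\<gamma> / 2) = A * B + 1" using AB assms by (simp add: t_def powr_powr)
  ultimately show False using *[of t] by simp
qed

theorem theorem2p1:
  fixes \<mu> p R :: real and k :: nat and u0 u1 :: "real ^ 'n \<Rightarrow> real"
  assumes "\<mu> > 0" and "k \<ge> 1" and "p > 1"
    and "CARD('n) \<ge> 2 \<longrightarrow> p < strauss_exponent CARD('n)"
    and "W11loc u0" and "L1loc u1"
    and "AE x in lebesgue. u0 x \<ge> 0" and "AE x in lebesgue. u1 x \<ge> 0"
    and "compact (ess_support u0)" and "compact (ess_support u1)"
    and "R > 0" and "ess_support u0 \<union> ess_support u1 \<subseteq> cball 0 R"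
    and "\<not> (AE x in lebesgue. u0 x = 0)"
  shows "(\<forall>\<epsilon>>0. \<forall>T u.
            solution_with_lifespan (damping \<mu> k) (\<lambda>y z. \<bar>y\<bar> powr p) \<epsilon> u0 u1 R T u \<longrightarrow> T < \<infinity>) \<and>
         (\<exists>\<epsilon>0>0. \<exists>C>0. \<forall>\<epsilon>\<in>{0<..\<epsilon>0}. \<forall>(T::real) u.
            solution_with_lifespan (damping \<mu> k) (\<lambda>y z. \<bar>y\<bar> powr p) \<epsilon> u0 u1 R (ereal T) u \<longrightarrow>
            T * iter_ln k (iter_exp k + T) powr (- (\<mu> * p * (p - 1) / strauss_gamma CARD('n) p))
              \<le> C * \<epsilon> powr (- (p * (p - 1) / strauss_gamma CARD('n) p)))"
proof -
  define \<gamma> where "\<gamma> = strauss_gamma CARD('n) p"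
  have \<gamma>: "\<gamma> > 0"
    unfolding \<gamma>_def by (rule strauss_gamma_pos) (use assms in \<open>auto simp: Suc_le_eq\<close>)
  define s where "s = p * (p - 1)"
  have s: "s > 0" using assms by (simp add: s_def)
  have "L1loc u0" using assms(5) by (auto simp: W11loc_def weak_gradient_def)
  moreover have "ess_support u0 \<subseteq> cball 0 R" using assms(12) by simp
  ultimately obtain C where C: "C > 0"
    "\<And>\<epsilon> T u t. \<epsilon> > 0 \<Longrightarrow> weak_solution (damping \<mu> k) (\<lambda>y z. \<bar>y\<bar> powr p) \<epsilon> u0 u1 R T u \<Longrightarrow> 1 \<le> t \<Longrightarrow> ereal t < T \<Longrightarrow>
      t powr \<gamma> * growth \<mu> k t powr (- s) * \<epsilon> powr s \<le> C"
    using lifespan_bound[OF assms(1,3,11) _ assms(7,13) _ assms(8)] unfolding \<gamma>_def s_def by (auto simp: DIM_cart)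
  have part1: "T < \<infinity>" if eps: "\<epsilon> > 0" and ws: "weak_solution (damping \<mu> k) (\<lambda>y z. \<bar>y\<bar> powr p) \<epsilon> u0 u1 R T u" for \<epsilon> T u
  proof (rule ccontr)
    assume "\<not> T < \<infinity>"
    then have T: "ereal t < T" for t by (cases T) auto
    have "t powr \<gamma> * growth \<mu> k t powr (- s) \<le> C * \<epsilon> powr (- s)" if t: "t \<ge> 1" for t
      using C(2)[OF eps ws t T] eps by (simp add: powr_minus field_simps)
    then show False by (rule growth_bound_contradiction[OF assms(2,1) \<gamma> s])
  qed
  have part2: "T * iter_ln k (iter_exp k + T) powr (- (\<mu> * p * (p - 1) / \<gamma>)) \<le> (2 + 2 * C powr (1 / \<gamma>)) * \<epsilon> powr (- (s / \<gamma>))"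
    if eps: "0 < \<epsilon>" "\<epsilon> \<le> 1" and ws: "weak_solution (damping \<mu> k) (\<lambda>y z. \<bar>y\<bar> powr p) \<epsilon> u0 u1 R (ereal T) u" for \<epsilon> T u
  proof -
    have T: "T > 0" using ws by (simp add: weak_solution_def)
    \<comment> \<open>The exponent is negative and the iterated logarithm increases, so passing from
      \<open>T\<close> to an earlier \<open>t\<close> can only enlarge the factor.\<close>
    have mono: "iter_ln k (iter_exp k + T) powr (- (\<mu> * p * (p - 1) / \<gamma>)) \<le> growth \<mu> k t powr (- (s / \<gamma>))"
      if "0 \<le> t" "t \<le> T" for t
    proof -
      have "growth \<mu> k t powr (- (s / \<gamma>)) = iter_ln k (iter_exp k + t) powr (- (\<mu> * p * (p - 1) / \<gamma>))"
        by (simp add: growth_def powr_powr s_def mult.assoc)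
      moreover have "iter_ln k (iter_exp k + T) powr (- (\<mu> * p * (p - 1) / \<gamma>)) \<le> iter_ln k (iter_exp k + t) powr (- (\<mu> * p * (p - 1) / \<gamma>))"
        using that iter_ln_pos[of k k "iter_exp k + t"] iter_ln_mono(2)[of k k "iter_exp k + t" "iter_exp k + T"] assms \<gamma>
        by (intro powr_mono2') auto
      ultimately show ?thesis by simp
    qed
    \<comment> \<open>Here the choice \<open>\<epsilon>0 = 1\<close> enters: lifespans
      \<open>T <= 2\<close> are absorbed by the summand 2 of the constant.\<close>
    have e1: "1 \<le> \<epsilon> powr (- (s / \<gamma>))"
    proof -
      have "1 powr (- (s / \<gamma>)) \<le> \<epsilon> powr (- (s / \<gamma>))" using eps s \<gamma> by (intro powr_mono2') auto
      then show ?thesis by simp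
    qed
    have C': "C powr (1 / \<gamma>) > 0" using C by simp
    show ?thesis
    proof (cases "T \<le> 2")
      case True
      have "T * iter_ln k (iter_exp k + T) powr (- (\<mu> * p * (p - 1) / \<gamma>)) \<le> 2 * 1"
        using True T mono[of 0] by (intro mult_mono) (auto simp: growth_0)
      also have "\<dots> \<le> (2 + 2 * C powr (1 / \<gamma>)) * \<epsilon> powr (- (s / \<gamma>))"
        using e1 C' by (intro mult_mono) auto
      finally show ?thesis .
    next
      case False
      \<comment> \<open>The bound is available at times from 1 up to, but excluding,
        \<open>T\<close>. Half of \<open>T > 2\<close> is such a time, at the price of a factor
        2.\<close>
      define t where "t = T / 2"
      have t: "1 \<le> t" "t \<le> T" "T = 2 * t" "ereal t < ereal T" using False by (auto simp: t_def)
      have g: "growth \<mu> k t > 0" using growth_ge_1[of \<mu> t k] assms t by linarith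
      have "t powr \<gamma> * growth \<mu> k t powr (- s) \<le> C * \<epsilon> powr (- s)"
        using C(2)[OF eps(1) ws t(1,4)] eps by (simp add: powr_minus field_simps)
      then have "(t powr \<gamma> * growth \<mu> k t powr (- s)) powr (1 / \<gamma>) \<le> (C * \<epsilon> powr (- s)) powr (1 / \<gamma>)"
        using \<gamma> by (intro powr_mono2) auto
      then have 1: "t * growth \<mu> k t powr (- (s / \<gamma>)) \<le> C powr (1 / \<gamma>) * \<epsilon> powr (- (s / \<gamma>))"
        using \<gamma> t by (simp add: powr_mult powr_powr)
      have "T * iter_ln k (iter_exp k + T) powr (- (\<mu> * p * (p - 1) / \<gamma>)) \<le> T * growth \<mu> k t powr (- (s / \<gamma>))"
        using T t by (intro mult_left_mono mono) auto
      also have "\<dots> = 2 * (t * growth \<mu> k t powr (- (s / \<gamma>)))" using t(3) by simp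
      also have "\<dots> \<le> 2 * (C powr (1 / \<gamma>) * \<epsilon> powr (- (s / \<gamma>)))" using 1 by simp
      also have "\<dots> \<le> (2 + 2 * C powr (1 / \<gamma>)) * \<epsilon> powr (- (s / \<gamma>))" by (simp add: distrib_right)
      finally show ?thesis .
    qed
  qed
  show ?thesis
  proof (intro conjI)
    show "\<forall>\<epsilon>>0. \<forall>T u. solution_with_lifespan (damping \<mu> k) (\<lambda>y z. \<bar>y\<bar> powr p) \<epsilon> u0 u1 R T u \<longrightarrow> T < \<infinity>"
      using part1 by (auto simp: solution_with_lifespan_def)
    have "2 + 2 * C powr (1 / \<gamma>) > 0" by (simp add: add_pos_nonneg)
    then show "\<exists>\<epsilon>0>0. \<exists>C>0. \<forall>\<epsilon>\<in>{0<..\<epsilon>0}. \<forall>(T::real) u.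
            solution_with_lifespan (damping \<mu> k) (\<lambda>y z. \<bar>y\<bar> powr p) \<epsilon> u0 u1 R (ereal T) u \<longrightarrow>
            T * iter_ln k (iter_exp k + T) powr (- (\<mu> * p * (p - 1) / strauss_gamma CARD('n) p))
              \<le> C * \<epsilon> powr (- (p * (p - 1) / strauss_gamma CARD('n) p))"
      using part2 unfolding \<gamma>_def[symmetric] s_def[symmetric] solution_with_lifespan_def
      by (intro exI[of _ 1] exI[of _ "2 + 2 * C powr (1 / \<gamma>)"] conjI ballI allI impI) auto
  qed
qed

end
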